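(* Let $W_j=\mathbf C^{d_{j+1}}\times\mathbf C^{d_j}$, $j=1,2$, $W_3=\mathbf C^{d_3}\times\mathbf C^{d_1}$, $s_1,s_2,s_3\in\overline{\mathbf R_\flat}$, and let $T$ be the map $(K_2,K_1)\mapsto K_2\circ K_1$ from $\widehat{\mathcal A}_0(W_2)\times\widehat{\mathcal A}_0(W_1)$ to $\widehat{\mathcal A}_0(W_3)$. Then the following is true: (1) $T$ is uniquely extendable to continuous mappings from $\widehat{\mathcal B}_{(s_3,s_2)}(W_2)\times\widehat{\mathcal C}_{(s_2,s_1)}(W_1)$ or from $\widehat{\mathcal C}_{(s_3,s_2)}(W_2)\times\widehat{\mathcal B}_{(s_2,s_1)}(W_1)$ to $\widehat{\mathcal C}_{(s_3,s_1)}(W_3)$. The same holds true with $\widehat{\mathcal B}_{(s_j,s_k)}$ in place of $\widehat{\mathcal C}_{(s_j,s_k)}$ at each occurrence. (2) $T$ is uniquely extendable to continuous mappings from $\widehat{\mathcal B}_{(s_3,s_2)}^\star(W_2)\times\widehat{\mathcal C}_{(s_2,s_1)}^\star(W_1)$ or from $\widehat{\mathcal C}_{(s_3,s_2)}^\star(W_2)\times\widehat{\mathcal B}_{(s_2,s_1)}^\star(W_1)$ to $\widehat{\mathcal C}_{(s_3,s_1)}^\star(W_3)$. The same holds true with $\widehat{\mathcal B}^\star_{(s_j,s_k)}$ in place of $\widehat{\mathcal C}^\star_{(s_j,s_k)}$ at each occurrence. If instead $s_1,s_2,s_3\in\mathbf R_{\flat,\infty}$, then the same holds true with $\widehat{\mathcal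 B}_{0,(s_j,s_k)}$ and $\widehat{\mathcal C}_{0,(s_j,s_k)}$ in place of $\widehat{\mathcal B}_{(s_j,s_k)}$ and $\widehat{\mathcal C}_{(s_j,s_k)}$, respectively, at each occurrence (and likewise for the $\star$-versions).
   Context: **Indices and weights.** $\mathbf N=\{0,1,2,\dots\}$. $\overline{\mathbf R_\flat}=[0,\infty)\cup\{\flat_\sigma:\sigma>0\}$, $\mathbf R_{\flat,\infty}=(0,\infty]\cup\{\flat_\sigma:\sigma>0\}$, where the $\flat_\sigma$ are formal symbols, ordered so that $x_1<\flat_{\sigma_1}<\flat_{\sigma_2}<x_2$ whenever $x_1<\frac12\le x_2$ and $\sigma_1<\sigma_2$. For $r>0$ and a multi-index $\alpha$: $\vartheta_{r,s}(\alpha)=e^{r|\alpha|^{1/(2s)}}$ if $s\in(0,\infty)$; $\vartheta_{r,s}(\alpha)=r^{|\alpha|}(\alpha!)^{1/(2\sigma)}$ if $s=\flat_\sigma$; $\vartheta_{r,\infty}(\alpha)=(1+|\alpha|^2)^{r/2}$; $\vartheta_{r,0}(\alpha)=1$ if $|\alpha|\le r$ and $=\infty$ if $|\alpha|>r$. Conventions: $a/\infty=0$ for all $a\in(0,\infty]$, $\infty\cdot0=0$. For $\omega:\Lambda\to[0,\infty]$, $\ell_{[\omega]}(\Lambda)$ is the set of $c:\Lambda\to\mathbf C$ with $\|c\,\omega\|_{\ell^p(\Lambda)}<\infty$, with this (quasi-/semi-)norm, $p\in(0,\infty]$ fixed (the limit spaces below do not depend on $p$). **Spaces.** For an index pair $(t_2,t_1)$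 and $\Lambda=\mathbf N^{n_2}\times\mathbf N^{n_1}\ni\alpha=(\alpha_2,\alpha_1)$ put $\omega_{r_2,r_1}(\alpha)=\vartheta_{r_2,t_2}(\alpha_2)/\vartheta_{r_1,t_1}(\alpha_1)$ and $\omega^\star_{r_2,r_1}(\alpha)=\vartheta_{r_1,t_1}(\alpha_1)/\vartheta_{r_2,t_2}(\alpha_2)$. With limits over positive parameters, and $t=(t_2,t_1)$: $\ell_{\mathcal B,t}=\operatorname{proj\,lim}_{r_1}\operatorname{ind\,lim}_{r_2}\ell_{[\omega_{r_2,r_1}]}$, $\ell_{\mathcal B,0,t}=\operatorname{proj\,lim}_{r_2}\operatorname{ind\,lim}_{r_1}\ell_{[\omega_{r_2,r_1}]}$, $\ell_{\mathcal B,t}^\star=\operatorname{proj\,lim}_{r_2}\operatorname{ind\,lim}_{r_1}\ell_{[\omega^\star_{r_2,r_1}]}$, $\ell_{\mathcal B,0,t}^\star=\operatorname{proj\,lim}_{r_1}\operatorname{ind\,lim}_{r_2}\ell_{[\omega^\star_{r_2,r_1}]}$; the $\mathcal C$-spaces are obtained by swapping the order of the limits: $\ell_{\mathcal C,t}=\operatorname{ind\,lim}_{r_2}\operatorname{proj\,lim}_{r_1}\ell_{[\omega_{r_2,r_1}]}$, $\ell_{\mathcal C,0,t}=\operatorname{ind\,lim}_{r_1}\operatorname{proj\,lim}_{r_2}\ell_{[\omega_{r_2,r_1}]}$, $\ell_{\mathcal C,t}^\star=\operatorname{ind\,lim}_{r_1}\operatorname{proj\,lim}_{r_2}\ell_{[\omega^\star_{r_2,r_1}]}$,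 $\ell_{\mathcal C,0,t}^\star=\operatorname{ind\,lim}_{r_2}\operatorname{proj\,lim}_{r_1}\ell_{[\omega^\star_{r_2,r_1}]}$. As sets, projective/inductive limits are intersections/unions. With $e_\alpha(z)=z^\alpha/\sqrt{\alpha!}$ and $W=\mathbf C^{n_2}\times\mathbf C^{n_1}$, the spaces $\widehat{\mathcal B}_t(W),\widehat{\mathcal B}_{0,t}(W),\widehat{\mathcal B}_t^\star(W),\widehat{\mathcal B}_{0,t}^\star(W)$ and $\widehat{\mathcal C}_t(W),\widehat{\mathcal C}_{0,t}(W),\widehat{\mathcal C}_t^\star(W),\widehat{\mathcal C}_{0,t}^\star(W)$ consist of the formal series $K(z_2,z_1)=\sum c(K;\alpha_2,\alpha_1)e_{\alpha_2}(z_2)e_{\alpha_1}(\overline{z_1})$ with coefficients in the corresponding sequence space, with transported topology. $\widehat{\mathcal A}_0(W)$ is the set of such series with finitely many non-zero coefficients. **Composition.** $K_2\circ K_1$ is the kernel of the composed operator $T_{K_2}\circ T_{K_1}$, where $T_KF=\sum_{\alpha_2}\big(\sum_{\alpha_1}c(K;\alpha_2,\alpha_1)c(F;\alpha_1)\big)e_{\alpha_2}$ for $F=\sum_{\alpha_1} c(F;\alpha_1)e_{\alpha_1}$; that is, $c(K_2\circ K_1;\alpha_3,\alpha_1)=\sum_{\beta\in\mathbf N^{d_2}}c(K_2;\alpha_3,\beta)c(K_1;\beta,\alpha_1)$.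
   Formalization: "Continuous mappings" is read as separately continuous and jointly sequentially continuous (uniqueness is in this class), because continuity for the product topology fails: the (0,0) coefficient contains the pairing of a non-normable Fréchet space with its dual. *)

theory Defs
  imports "HOL-Analysis.Analysis"
begin

section \<open>Indices and weights\<close>

text \<open>\<open>Flat \<sigma>\<close> is the formal symbol \<open>\<flat>\<^sub>\<sigma>\<close>. The constructors carry arbitrary reals; the admissible
  parameters are singled out by the two index sets.\<close>

datatype windex = Fin real | Flat real | Infty

definition R_flat_closed :: "windex set" where
  "R_flat_closed = Fin ` {0..} \<union> Flat ` {0<..}"

definition R_flat_infty :: "windex set" where
  "R_flat_infty = Fin ` {0<..} \<union> {Infty} \<union> Flat ` {0<..}"

definition mlen :: "nat ^ 'n::finite \<Rightarrow> nat" where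
  "mlen \<alpha> = (\<Sum>i\<in>UNIV. \<alpha> $ i)"

definition mfact :: "nat ^ 'n::finite \<Rightarrow> real" where
  "mfact \<alpha> = (\<Prod>i\<in>UNIV. fact (\<alpha> $ i))"

fun theta :: "real \<Rightarrow> windex \<Rightarrow> nat ^ 'n::finite \<Rightarrow> ennreal" where
  "theta r (Fin s) \<alpha> =
     (if s = 0 then (if real (mlen \<alpha>) \<le> r then 1 else \<infinity>)
      else ennreal (exp (r * real (mlen \<alpha>) powr (1 / (2 * s)))))"
| "theta r (Flat \<sigma>) \<alpha> = ennreal (r ^ mlen \<alpha> * mfact \<alpha> powr (1 / (2 * \<sigma>)))"
| "theta r Infty \<alpha> = ennreal ((1 + (real (mlen \<alpha>))\<^sup>2) powr (r / 2))"

section \<open>Weighted sequence spaces and limits\<close>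

definition epow :: "ennreal \<Rightarrow> real \<Rightarrow> ennreal" where
  "epow x q = (if x = \<infinity> then \<infinity> else ennreal (enn2real x powr q))"

definition lp_norm :: "ennreal \<Rightarrow> ('i \<Rightarrow> ennreal) \<Rightarrow> ennreal" where
  "lp_norm p a = (if p = \<infinity> then (SUP i. a i)
     else epow (infsum (\<lambda>i. epow (a i) (enn2real p)) UNIV) (1 / enn2real p))"

text \<open>The conventions \<open>a / \<infinity> = 0\<close>, for \<open>a = \<infinity>\<close> too, and \<open>\<infinity> * 0 = 0\<close> are those of \<^typ>\<open>ennreal\<close>.
  So where the weight is \<open>\<infinity>\<close> a finite norm forces the coefficient to vanish, and where the weight
  is \<open>0\<close> the coefficient is unconstrained.\<close>

definition wnorm :: "ennreal \<Rightarrow> ('i \<Rightarrow> ennreal) \<Rightarrow> ('i \<Rightarrow> complex) \<Rightarrow> ennreal" where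
  "wnorm p \<omega> c = lp_norm p (\<lambda>i. ennreal (norm (c i)) * \<omega> i)"

definition ell_set :: "ennreal \<Rightarrow> ('i \<Rightarrow> ennreal) \<Rightarrow> ('i \<Rightarrow> complex) set" where
  "ell_set p \<omega> = {c. wnorm p \<omega> c < \<infinity>}"

definition ell :: "ennreal \<Rightarrow> ('i \<Rightarrow> ennreal) \<Rightarrow> ('i \<Rightarrow> complex) topology" where
  "ell p \<omega> = topology (\<lambda>U. U \<subseteq> ell_set p \<omega> \<and>
     (\<forall>c\<in>U. \<exists>\<epsilon>>0. {x \<in> ell_set p \<omega>. wnorm p \<omega> (x - c) < \<epsilon>} \<subseteq> U))"

text \<open>Projective limit: the intersection, with the coarsest topology making all inclusions into the
  steps continuous.\<close>

definition proj_lim :: "'j set \<Rightarrow> ('j \<Rightarrow> 'a topology) \<Rightarrow> 'a topology" where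
  "proj_lim J X = topology_generated_by
     {U \<inter> (\<Inter>j\<in>J. topspace (X j)) | j U. j \<in> J \<and> openin (X j) U}"

definition abs_convex :: "('i \<Rightarrow> complex) set \<Rightarrow> bool" where
  "abs_convex V \<longleftrightarrow> (\<forall>u\<in>V. \<forall>v\<in>V. \<forall>a b::complex. norm a + norm b \<le> 1 \<longrightarrow>
     (\<lambda>i. a * u i + b * v i) \<in> V)"

definition zero_nbhd :: "('i \<Rightarrow> complex) topology \<Rightarrow> ('i \<Rightarrow> complex) set \<Rightarrow> bool" where
  "zero_nbhd X V \<longleftrightarrow> (\<exists>W. openin X W \<and> (\<lambda>i. 0) \<in> W \<and> W \<subseteq> V)"

text \<open>Locally convex inductive limit: the union, with the finest locally convex topology making all
  inclusions of the steps continuous. A base of neighbourhoods of zero is given by the absolutely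
  convex sets that meet each step in a neighbourhood of zero of that step.\<close>

definition ind_lim :: "'j set \<Rightarrow> ('j \<Rightarrow> ('i \<Rightarrow> complex) topology) \<Rightarrow> ('i \<Rightarrow> complex) topology" where
  "ind_lim J X = topology (\<lambda>U. U \<subseteq> (\<Union>j\<in>J. topspace (X j)) \<and>
     (\<forall>c\<in>U. \<exists>V. abs_convex V \<and> (\<forall>j\<in>J. zero_nbhd (X j) (V \<inter> topspace (X j))) \<and>
        {x \<in> (\<Union>j\<in>J. topspace (X j)). x - c \<in> V} \<subseteq> U))"

lemma openin_ell:
  "openin (ell p \<omega>) U \<longleftrightarrow> U \<subseteq> ell_set p \<omega> \<and>
     (\<forall>c\<in>U. \<exists>\<epsilon>>0. {x \<in> ell_set p \<omega>. wnorm p \<omega> (x - c) < \<epsilon>} \<subseteq> U)"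
proof -
  have "istopology (\<lambda>U. U \<subseteq> ell_set p \<omega> \<and>
     (\<forall>c\<in>U. \<exists>\<epsilon>>0. {x \<in> ell_set p \<omega>. wnorm p \<omega> (x - c) < \<epsilon>} \<subseteq> U))"
    unfolding istopology_def
  proof (intro conjI allI impI)
    fix S T assume S: "S \<subseteq> ell_set p \<omega> \<and>
        (\<forall>c\<in>S. \<exists>\<epsilon>>0. {x \<in> ell_set p \<omega>. wnorm p \<omega> (x - c) < \<epsilon>} \<subseteq> S)"
      and T: "T \<subseteq> ell_set p \<omega> \<and>
        (\<forall>c\<in>T. \<exists>\<epsilon>>0. {x \<in> ell_set p \<omega>. wnorm p \<omega> (x - c) < \<epsilon>} \<subseteq> T)"
    show "S \<inter> T \<subseteq> ell_set p \<omega>" using S by blast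
    show "\<forall>c\<in>S \<inter> T. \<exists>\<epsilon>>0. {x \<in> ell_set p \<omega>. wnorm p \<omega> (x - c) < \<epsilon>} \<subseteq> S \<inter> T"
    proof
      fix c assume c: "c \<in> S \<inter> T"
      obtain e where e: "e > 0" "{x \<in> ell_set p \<omega>. wnorm p \<omega> (x - c) < e} \<subseteq> S"
        using c S by blast
      obtain d where d: "d > 0" "{x \<in> ell_set p \<omega>. wnorm p \<omega> (x - c) < d} \<subseteq> T"
        using c T by blast
      have "{x \<in> ell_set p \<omega>. wnorm p \<omega> (x - c) < min e d} \<subseteq> S \<inter> T"
        using d(2) e(2) by auto
      moreover have "min e d > 0" using d(1) e(1) by simp
      ultimately show "\<exists>\<epsilon>>0. {x \<in> ell_set p \<omega>. wnorm p \<omega> (x - c) < \<epsilon>} \<subseteq> S \<inter> T" by blast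
    qed
  next
    fix \<K> assume K: "\<forall>K\<in>\<K>. K \<subseteq> ell_set p \<omega> \<and>
        (\<forall>c\<in>K. \<exists>\<epsilon>>0. {x \<in> ell_set p \<omega>. wnorm p \<omega> (x - c) < \<epsilon>} \<subseteq> K)"
    show "\<Union>\<K> \<subseteq> ell_set p \<omega>" using K by blast
    show "\<forall>c\<in>\<Union>\<K>. \<exists>\<epsilon>>0. {x \<in> ell_set p \<omega>. wnorm p \<omega> (x - c) < \<epsilon>} \<subseteq> \<Union>\<K>"
      using K by (meson Union_iff Union_upper order_trans)
  qed
  then show ?thesis by (simp add: ell_def topology_inverse')
qed

lemma topspace_ell [simp]: "topspace (ell p \<omega>) = ell_set p \<omega>"
proof
  show "topspace (ell p \<omega>) \<subseteq> ell_set p \<omega>"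
    using openin_ell openin_topspace by blast
  have "openin (ell p \<omega>) (ell_set p \<omega>)"
    unfolding openin_ell by (auto intro!: exI[of _ 1])
  then show "ell_set p \<omega> \<subseteq> topspace (ell p \<omega>)" by (rule openin_subset)
qed

lemma topspace_proj_lim [simp]:
  assumes "J \<noteq> {}"
  shows "topspace (proj_lim J X) = (\<Inter>j\<in>J. topspace (X j))"
  unfolding proj_lim_def topology_generated_by_topspace using assms by blast

lemma openin_ind_lim:
  "openin (ind_lim J X) U \<longleftrightarrow> U \<subseteq> (\<Union>j\<in>J. topspace (X j)) \<and>
     (\<forall>c\<in>U. \<exists>V. abs_convex V \<and> (\<forall>j\<in>J. zero_nbhd (X j) (V \<inter> topspace (X j))) \<and>
        {x \<in> (\<Union>j\<in>J. topspace (X j)). x - c \<in> V} \<subseteq> U)"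
proof -
  let ?E = "\<Union>j\<in>J. topspace (X j)"
  let ?N = "\<lambda>V. abs_convex V \<and> (\<forall>j\<in>J. zero_nbhd (X j) (V \<inter> topspace (X j)))"
  have N_Int: "?N (V \<inter> W)" if "?N V" "?N W" for V W
  proof (intro conjI ballI)
    show "abs_convex (V \<inter> W)" using that unfolding abs_convex_def by blast
    fix j assume "j \<in> J"
    then have "zero_nbhd (X j) (V \<inter> topspace (X j))" "zero_nbhd (X j) (W \<inter> topspace (X j))"
      using that by blast+
    then obtain A B where "openin (X j) A" "(\<lambda>i. 0) \<in> A" "A \<subseteq> V \<inter> topspace (X j)"
      and "openin (X j) B" "(\<lambda>i. 0) \<in> B" "B \<subseteq> W \<inter> topspace (X j)"
      unfolding zero_nbhd_def by blast
    then show "zero_nbhd (X j) ((V \<inter> W) \<inter> topspace (X j))"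
      unfolding zero_nbhd_def by (intro exI[of _ "A \<inter> B"]) auto
  qed
  have "istopology (\<lambda>U. U \<subseteq> ?E \<and> (\<forall>c\<in>U. \<exists>V. ?N V \<and> {x \<in> ?E. x - c \<in> V} \<subseteq> U))"
    unfolding istopology_def
  proof (intro conjI allI impI)
    fix S T assume S: "S \<subseteq> ?E \<and> (\<forall>c\<in>S. \<exists>V. ?N V \<and> {x \<in> ?E. x - c \<in> V} \<subseteq> S)"
      and T: "T \<subseteq> ?E \<and> (\<forall>c\<in>T. \<exists>V. ?N V \<and> {x \<in> ?E. x - c \<in> V} \<subseteq> T)"
    show "S \<inter> T \<subseteq> ?E" using S by blast
    show "\<forall>c\<in>S \<inter> T. \<exists>V. ?N V \<and> {x \<in> ?E. x - c \<in> V} \<subseteq> S \<inter> T"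
    proof
      fix c assume c: "c \<in> S \<inter> T"
      obtain V where V: "?N V" "{x \<in> ?E. x - c \<in> V} \<subseteq> S" using S c by blast
      obtain W where W: "?N W" "{x \<in> ?E. x - c \<in> W} \<subseteq> T" using T c by blast
      have "{x \<in> ?E. x - c \<in> V \<inter> W} \<subseteq> S \<inter> T" using V(2) W(2) by blast
      then show "\<exists>V. ?N V \<and> {x \<in> ?E. x - c \<in> V} \<subseteq> S \<inter> T" using N_Int[OF V(1) W(1)] by blast
    qed
  next
    fix \<K> assume K: "\<forall>K\<in>\<K>. K \<subseteq> ?E \<and> (\<forall>c\<in>K. \<exists>V. ?N V \<and> {x \<in> ?E. x - c \<in> V} \<subseteq> K)"
    show "\<Union>\<K> \<subseteq> ?E" using K by blast
    show "\<forall>c\<in>\<Union>\<K>. \<exists>V. ?N V \<and> {x \<in> ?E. x - c \<in> V} \<subseteq> \<Union>\<K>"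
      using K by (meson Union_iff Union_upper order_trans)
  qed
  then show ?thesis by (simp add: ind_lim_def topology_inverse' conj_assoc)
qed

text \<open>The hypothesis only says that each step contains zero.\<close>

lemma topspace_ind_lim:
  assumes "\<And>j. j \<in> J \<Longrightarrow> (\<lambda>i. 0) \<in> topspace (X j)"
  shows "topspace (ind_lim J X) = (\<Union>j\<in>J. topspace (X j))"
proof
  show "topspace (ind_lim J X) \<subseteq> (\<Union>j\<in>J. topspace (X j))"
    using openin_ind_lim openin_topspace by blast
  have "abs_convex UNIV" by (simp add: abs_convex_def)
  moreover have "zero_nbhd (X j) (UNIV \<inter> topspace (X j))" if "j \<in> J" for j
    unfolding zero_nbhd_def using assms[OF that] by (intro exI[of _ "topspace (X j)"]) simp
  ultimately have "openin (ind_lim J X) (\<Union>j\<in>J. topspace (X j))"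
    unfolding openin_ind_lim by blast
  then show "(\<Union>j\<in>J. topspace (X j)) \<subseteq> topspace (ind_lim J X)" by (rule openin_subset)
qed

section \<open>Spaces of kernels\<close>

text \<open>A formal series \<open>\<Sum> c(\<alpha>\<^sub>2, \<alpha>\<^sub>1) e\<^bsub>\<alpha>\<^sub>2\<^esub>(z\<^sub>2) e\<^bsub>\<alpha>\<^sub>1\<^esub>(cnj z\<^sub>1)\<close> is identified with its coefficient family,
  so that the topology transported from the sequence space is that of the sequence space itself.\<close>

type_synonym ('n2, 'n1) kernel = "(nat ^ 'n2) \<times> (nat ^ 'n1) \<Rightarrow> complex"

fun omega :: "windex \<times> windex \<Rightarrow> real \<Rightarrow> real \<Rightarrow>
    (nat ^ 'n2::finite) \<times> (nat ^ 'n1::finite) \<Rightarrow> ennreal" where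
  "omega (t2, t1) r2 r1 (\<alpha>2, \<alpha>1) = theta r2 t2 \<alpha>2 / theta r1 t1 \<alpha>1"

fun omega_star :: "windex \<times> windex \<Rightarrow> real \<Rightarrow> real \<Rightarrow>
    (nat ^ 'n2::finite) \<times> (nat ^ 'n1::finite) \<Rightarrow> ennreal" where
  "omega_star (t2, t1) r2 r1 (\<alpha>2, \<alpha>1) = theta r1 t1 \<alpha>1 / theta r2 t2 \<alpha>2"

definition A0_hat :: "('n2::finite, 'n1::finite) kernel set" where
  "A0_hat = {K. finite {\<alpha>. K \<alpha> \<noteq> 0}}"

definition B_hat :: "ennreal \<Rightarrow> windex \<times> windex \<Rightarrow> ('n2::finite, 'n1::finite) kernel topology" where
  "B_hat p t = proj_lim {0<..} (\<lambda>r1. ind_lim {0<..} (\<lambda>r2. ell p (omega t r2 r1)))"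

definition B0_hat :: "ennreal \<Rightarrow> windex \<times> windex \<Rightarrow> ('n2::finite, 'n1::finite) kernel topology" where
  "B0_hat p t = proj_lim {0<..} (\<lambda>r2. ind_lim {0<..} (\<lambda>r1. ell p (omega t r2 r1)))"

definition B_hat_star :: "ennreal \<Rightarrow> windex \<times> windex \<Rightarrow> ('n2::finite, 'n1::finite) kernel topology" where
  "B_hat_star p t = proj_lim {0<..} (\<lambda>r2. ind_lim {0<..} (\<lambda>r1. ell p (omega_star t r2 r1)))"

definition B0_hat_star :: "ennreal \<Rightarrow> windex \<times> windex \<Rightarrow> ('n2::finite, 'n1::finite) kernel topology" where
  "B0_hat_star p t = proj_lim {0<..} (\<lambda>r1. ind_lim {0<..} (\<lambda>r2. ell p (omega_star t r2 r1)))"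

definition C_hat :: "ennreal \<Rightarrow> windex \<times> windex \<Rightarrow> ('n2::finite, 'n1::finite) kernel topology" where
  "C_hat p t = ind_lim {0<..} (\<lambda>r2. proj_lim {0<..} (\<lambda>r1. ell p (omega t r2 r1)))"

definition C0_hat :: "ennreal \<Rightarrow> windex \<times> windex \<Rightarrow> ('n2::finite, 'n1::finite) kernel topology" where
  "C0_hat p t = ind_lim {0<..} (\<lambda>r1. proj_lim {0<..} (\<lambda>r2. ell p (omega t r2 r1)))"

definition C_hat_star :: "ennreal \<Rightarrow> windex \<times> windex \<Rightarrow> ('n2::finite, 'n1::finite) kernel topology" where
  "C_hat_star p t = ind_lim {0<..} (\<lambda>r1. proj_lim {0<..} (\<lambda>r2. ell p (omega_star t r2 r1)))"

definition C0_hat_star :: "ennreal \<Rightarrow> windex \<times> windex \<Rightarrow> ('n2::finite, 'n1::finite) kernel topology" where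
  "C0_hat_star p t = ind_lim {0<..} (\<lambda>r2. proj_lim {0<..} (\<lambda>r1. ell p (omega_star t r2 r1)))"

definition kernel_comp ::
  "('n3::finite, 'n2::finite) kernel \<Rightarrow> ('n2, 'n1::finite) kernel \<Rightarrow> ('n3, 'n1) kernel" where
  "kernel_comp K2 K1 = (\<lambda>(\<alpha>3, \<alpha>1). infsum (\<lambda>\<beta>. K2 (\<alpha>3, \<beta>) * K1 (\<beta>, \<alpha>1)) UNIV)"

lemma kernel_comp_A0_hat:
  assumes "K2 \<in> A0_hat" "K1 \<in> A0_hat"
  shows "kernel_comp K2 K1 \<in> A0_hat"
proof -
  let ?S = "fst ` {\<alpha>. K2 \<alpha> \<noteq> 0} \<times> snd ` {\<alpha>. K1 \<alpha> \<noteq> 0}"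
  have "{\<alpha>. kernel_comp K2 K1 \<alpha> \<noteq> 0} \<subseteq> ?S"
  proof (rule subsetI)
    fix \<alpha> assume "\<alpha> \<in> {\<alpha>. kernel_comp K2 K1 \<alpha> \<noteq> 0}"
    then obtain a c where ac: "\<alpha> = (a, c)" "kernel_comp K2 K1 (a, c) \<noteq> 0" by (cases \<alpha>) auto
    then obtain b where "K2 (a, b) * K1 (b, c) \<noteq> 0"
      unfolding kernel_comp_def by (metis (no_types, lifting) infsum_0 old.prod.case)
    then show "\<alpha> \<in> ?S" unfolding ac(1) by (force simp: image_iff)
  qed
  moreover have "finite ?S" using assms by (simp add: A0_hat_def)
  ultimately show ?thesis by (simp add: A0_hat_def finite_subset)
qed

section \<open>Unique continuous extension\<close>

text \<open>Continuity of a map of two variables is understood as separate continuity together with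
  sequential continuity on the product. Continuity on the product topology is not available here:
  the composition of \<open>K2 \<in> B\<close>, supported in \<open>\<alpha>\<^sub>3 = 0\<close>, with \<open>K1 \<in> C\<close>, supported in \<open>\<alpha>\<^sub>1 = 0\<close>, contains as its
  coefficient at \<open>(0, 0)\<close> the pairing of a non-normable Frechet space (families \<open>u\<close> with \<open>u / \<theta>\<^sub>r\<close> in
  \<open>\<ell>\<^sup>p\<close> for every \<open>r\<close>) with its dual (families \<open>v\<close> with \<open>v \<theta>\<^sub>r\<close> in \<open>\<ell>\<^sup>p\<close> for some \<open>r\<close>), and such a
  pairing is jointly continuous only on normable spaces.\<close>

definition separately_continuous ::
  "'a topology \<Rightarrow> 'b topology \<Rightarrow> 'c topology \<Rightarrow> ('a \<times> 'b \<Rightarrow> 'c) \<Rightarrow> bool" where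
  "separately_continuous X Y Z U \<longleftrightarrow>
     (\<forall>y\<in>topspace Y. continuous_map X Z (\<lambda>x. U (x, y))) \<and>
     (\<forall>x\<in>topspace X. continuous_map Y Z (\<lambda>y. U (x, y)))"

definition sequentially_continuous_map :: "'a topology \<Rightarrow> 'b topology \<Rightarrow> ('a \<Rightarrow> 'b) \<Rightarrow> bool" where
  "sequentially_continuous_map X Z f \<longleftrightarrow>
     (\<forall>x l. limitin X x l sequentially \<longrightarrow> limitin Z (\<lambda>n. f (x n)) (f l) sequentially)"

text \<open>The values of \<open>T\<close> outside \<open>D\<close> play no role.\<close>

definition uniquely_extendable ::
  "('a \<times> 'b \<Rightarrow> 'c) \<Rightarrow> ('a \<times> 'b) set \<Rightarrow> 'a topology \<Rightarrow> 'b topology \<Rightarrow> 'c topology \<Rightarrow> bool" where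
  "uniquely_extendable T D X Y Z \<longleftrightarrow>
     D \<subseteq> topspace X \<times> topspace Y \<and>
     (\<exists>!U. U \<in> topspace X \<times> topspace Y \<rightarrow>\<^sub>E topspace Z \<and> (\<forall>k\<in>D. U k = T k) \<and>
        separately_continuous X Y Z U \<and> sequentially_continuous_map (prod_topology X Y) Z U)"

end

theory Submission
  imports Defs "HOL-Real_Asymp.Real_Asymp"
begin

text \<open>Write \<open>\<omega>\<^bsub>b,a\<^esub> = u\<^sub>b / v\<^sub>a\<close>, where \<open>b\<close> is the index of the inductive and \<open>a\<close> that of the projective limit.
  Refining an index gains a summable factor, so \<open>\<ell>\<^sup>p\<close> may be replaced by \<open>\<ell>\<^sup>\<infinity>\<close> throughout, and
  truncations of a kernel converge to it; together with the continuity of coordinates this gives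
  uniqueness. The same gain yields
  \<open>\<parallel>K\<^sub>2 \<circ> K\<^sub>1\<parallel>\<^bsub>r\<^sub>3,r\<^sub>1\<^esub> \<le> C \<parallel>K\<^sub>2\<parallel>\<^bsub>r\<^sub>3,\<rho>\<^esub> \<parallel>K\<^sub>1\<parallel>\<^bsub>r\<^sub>2,r\<^sub>1\<^esub>\<close> for every \<open>r\<^sub>2\<close> with suitable \<open>\<rho> = \<rho>(r\<^sub>2)\<close>. Separate continuity
  is then a matter of ordering quantifiers. For sequential continuity, a convergent sequence in
  the \<open>\<B>\<close>-factor is bounded, for each projective index, in a single step of the inductive limit;
  hence composition with its members is equicontinuous in the other factor. The starred spaces arise
  by exchanging the variables, and the spaces with index \<open>0\<close> by replacing the weights \<open>\<theta>\<close> with \<open>1 / \<theta>\<close>.\<close>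

section \<open>Continuous inclusions between limits\<close>

abbreviation embeds :: "'a topology \<Rightarrow> 'a topology \<Rightarrow> bool" where
  "embeds X Y \<equiv> continuous_map X Y (\<lambda>x. x)"

lemma topology_eqI_inclusions:
  assumes "embeds X Y" "embeds Y X"
  shows "X = Y"
proof -
  have sp: "topspace X = topspace Y"
    using assms by (auto simp: continuous_map_def)
  have "openin X U \<longleftrightarrow> openin Y U" for U
  proof -
    have "openin X {x \<in> topspace X. x \<in> U}" if "openin Y U"
      using assms(1) that by (simp add: continuous_map_def)
    moreover have "openin Y {x \<in> topspace Y. x \<in> U}" if "openin X U"
      using assms(2) that by (simp add: continuous_map_def)
    moreover have "{x \<in> topspace X. x \<in> U} = U" if "openin X U \<or> openin Y U"
      using that openin_subset[of X U] openin_subset[of Y U] sp by blast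
    ultimately show ?thesis using sp by auto
  qed
  then show ?thesis by (simp add: topology_eq)
qed

lemma wnorm_zero [simp]: "wnorm p \<omega> (\<lambda>i. 0) = 0"
  by (simp add: wnorm_def lp_norm_def epow_def)

lemma zero_mem_ell_set [simp]: "(\<lambda>i. 0) \<in> ell_set p \<omega>"
  by (simp add: ell_set_def)

lemma ell_inclusion:
  assumes C: "0 < C" "\<And>x. wnorm q \<omega>' x \<le> ennreal C * wnorm p \<omega> x"
  shows "embeds (ell p \<omega>) (ell q \<omega>')"
proof -
  have sub: "ell_set p \<omega> \<subseteq> ell_set q \<omega>'"
    unfolding ell_set_def using C(2) by (auto intro!: le_less_trans[OF C(2)] ennreal_mult_less_top[THEN iffD2])
  show ?thesis
    unfolding continuous_map_def topspace_ell
  proof (intro conjI allI impI)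
    show "(\<lambda>x. x) \<in> ell_set p \<omega> \<rightarrow> ell_set q \<omega>'" using sub by blast
    fix U assume U: "openin (ell q \<omega>') U"
    show "openin (ell p \<omega>) {x \<in> ell_set p \<omega>. x \<in> U}"
      unfolding openin_ell
    proof (intro conjI ballI)
      fix c assume c: "c \<in> {x \<in> ell_set p \<omega>. x \<in> U}"
      then obtain e where e: "e > 0" "{x \<in> ell_set q \<omega>'. wnorm q \<omega>' (x - c) < e} \<subseteq> U"
        using U unfolding openin_ell by blast
      have d0: "e / ennreal C > 0"
        using e(1) by (simp add: ennreal_zero_less_divide)
      have "ennreal C * y < e" if "y < e / ennreal C" for y
      proof -
        have "ennreal C * y < ennreal C * (e / ennreal C)"
          using that C(1) by (intro ennreal_mult_strict_left_mono) auto
        also have "\<dots> = e"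
          using C(1) by (simp add: ennreal_times_divide mult.commute mult_divide_eq_ennreal)
        finally show ?thesis .
      qed
      then have "wnorm q \<omega>' (x - c) < e" if "wnorm p \<omega> (x - c) < e / ennreal C" for x
        using that C(2) le_less_trans by blast
      then show "\<exists>\<epsilon>>0. {x \<in> ell_set p \<omega>. wnorm p \<omega> (x - c) < \<epsilon>} \<subseteq> {x \<in> ell_set p \<omega>. x \<in> U}"
        using d0 e(2) sub by blast
    qed blast
  qed
qed

lemma ind_lim_inclusion:
  assumes inc: "\<And>j. j \<in> J \<Longrightarrow> \<exists>j'\<in>J'. embeds (X j) (X' j')"
    and z: "\<And>j. j \<in> J \<Longrightarrow> (\<lambda>i. 0) \<in> topspace (X j)" "\<And>j. j \<in> J' \<Longrightarrow> (\<lambda>i. 0) \<in> topspace (X' j)"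
  shows "embeds (ind_lim J X) (ind_lim J' X')"
proof -
  have sub: "(\<lambda>x. x) \<in> (\<Union>j\<in>J. topspace (X j)) \<rightarrow> (\<Union>j\<in>J'. topspace (X' j))"
  proof (rule Pi_I)
    fix x assume "x \<in> (\<Union>j\<in>J. topspace (X j))"
    then obtain j where j: "j \<in> J" "x \<in> topspace (X j)" by blast
    then obtain j' where "j' \<in> J'" "embeds (X j) (X' j')" using inc by blast
    then show "x \<in> (\<Union>j\<in>J'. topspace (X' j))" using j(2) by (auto simp: continuous_map_def)
  qed
  have "openin (ind_lim J X) {x \<in> (\<Union>j\<in>J. topspace (X j)). x \<in> U}"
    if U: "openin (ind_lim J' X') U" for U
    unfolding openin_ind_lim
  proof (intro conjI ballI)
    fix c assume "c \<in> {x \<in> (\<Union>j\<in>J. topspace (X j)). x \<in> U}"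
    then have "c \<in> U" by blast
    then obtain V where V: "abs_convex V" "\<forall>j\<in>J'. zero_nbhd (X' j) (V \<inter> topspace (X' j))"
      "{x \<in> (\<Union>j\<in>J'. topspace (X' j)). x - c \<in> V} \<subseteq> U"
      using U unfolding openin_ind_lim by blast
    have "zero_nbhd (X j) (V \<inter> topspace (X j))" if j: "j \<in> J" for j
    proof -
      obtain j' where j': "j' \<in> J'" "embeds (X j) (X' j')" using inc j by blast
      have "zero_nbhd (X' j') (V \<inter> topspace (X' j'))" using V(2) j'(1) by simp
      then obtain W where "openin (X' j') W" "(\<lambda>i. 0) \<in> W" "W \<subseteq> V"
        by (auto simp: zero_nbhd_def)
      then show ?thesis
        unfolding zero_nbhd_def using j'(2) z(1)[OF j]
        by (intro exI[of _ "{x \<in> topspace (X j). x \<in> W}"]) (auto simp: continuous_map_def)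
    qed
    moreover have "{x \<in> (\<Union>j\<in>J. topspace (X j)). x - c \<in> V} \<subseteq> {x \<in> (\<Union>j\<in>J. topspace (X j)). x \<in> U}"
      using V(3) funcset_mem[OF sub] by blast
    ultimately show "\<exists>V. abs_convex V \<and> (\<forall>j\<in>J. zero_nbhd (X j) (V \<inter> topspace (X j))) \<and>
        {x \<in> (\<Union>j\<in>J. topspace (X j)). x - c \<in> V} \<subseteq> {x \<in> (\<Union>j\<in>J. topspace (X j)). x \<in> U}"
      using V(1) by (intro exI[of _ V]) simp
  qed blast
  then show ?thesis
    using sub by (simp add: continuous_map_def topspace_ind_lim z)
qed

lemma proj_lim_inclusion:
  assumes J: "J \<noteq> {}" "J' \<noteq> {}"
    and inc: "\<And>j'. j' \<in> J' \<Longrightarrow> \<exists>j\<in>J. embeds (X j) (X' j')"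
  shows "embeds (proj_lim J X) (proj_lim J' X')"
proof -
  have sub: "(\<Inter>j\<in>J. topspace (X j)) \<subseteq> (\<Inter>j\<in>J'. topspace (X' j))"
  proof (intro subsetI INT_I)
    fix x j' assume x: "x \<in> (\<Inter>j\<in>J. topspace (X j))" and "j' \<in> J'"
    then obtain j where "j \<in> J" "embeds (X j) (X' j')" using inc by blast
    then show "x \<in> topspace (X' j')" using x continuous_map_funspace by fastforce
  qed
  show ?thesis
    unfolding proj_lim_def[of J'] continuous_on_generated_topo_iff
  proof (intro conjI allI ballI impI)
    fix U' assume "U' \<in> {U \<inter> (\<Inter>j\<in>J'. topspace (X' j)) | j U. j \<in> J' \<and> openin (X' j) U}"
    then obtain j' U where U: "U' = U \<inter> (\<Inter>j\<in>J'. topspace (X' j))" "j' \<in> J'" "openin (X' j') U"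
      by blast
    obtain j where j: "j \<in> J" "embeds (X j) (X' j')" using inc U(2) by blast
    have "(\<lambda>x. x) -` U' \<inter> topspace (proj_lim J X) =
        {x \<in> topspace (X j). x \<in> U} \<inter> (\<Inter>j\<in>J. topspace (X j))"
      using sub j(1) unfolding U(1) topspace_proj_lim[OF J(1)] by blast
    moreover have "openin (X j) {x \<in> topspace (X j). x \<in> U}"
      using j(2) U(3) by (auto simp: continuous_map_def)
    ultimately show "openin (proj_lim J X) ((\<lambda>x. x) -` U' \<inter> topspace (proj_lim J X))"
      unfolding proj_lim_def using j(1) by (metis (mono_tags, lifting) mem_Collect_eq topology_generated_by_Basis)
  next
    show "(\<lambda>x. x) ` topspace (proj_lim J X) \<subseteq> \<Union> {U \<inter> (\<Inter>j\<in>J'. topspace (X' j)) | j U. j \<in> J' \<and> openin (X' j) U}"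
      unfolding topology_generated_by_topspace[symmetric] proj_lim_def[symmetric] topspace_proj_lim[OF J(1)]
        topspace_proj_lim[OF J(2)]
      using sub by simp
  qed
qed

section \<open>Topologies given by absolutely convex neighbourhoods of zero\<close>

definition linear_set :: "('i \<Rightarrow> complex) set \<Rightarrow> bool" where
  "linear_set E \<longleftrightarrow> (\<lambda>i. 0) \<in> E \<and> (\<forall>x\<in>E. \<forall>y\<in>E. \<forall>a b. (\<lambda>i. a * x i + b * y i) \<in> E)"

definition lin_top :: "('i \<Rightarrow> complex) topology \<Rightarrow> ('i \<Rightarrow> complex) set \<Rightarrow> ('i \<Rightarrow> complex) set set \<Rightarrow> bool" where
  "lin_top X E \<V> \<longleftrightarrow> linear_set E \<and> \<V> \<noteq> {} \<and>
     (\<forall>V\<in>\<V>. abs_convex V \<and> (\<lambda>i. 0) \<in> V) \<and>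
     (\<forall>V\<in>\<V>. \<exists>W\<in>\<V>. \<forall>x\<in>W \<inter> E. (\<lambda>i. 2 * x i) \<in> V) \<and>
     (\<forall>V\<in>\<V>. \<forall>V'\<in>\<V>. \<exists>W\<in>\<V>. W \<inter> E \<subseteq> V \<inter> V') \<and>
     (\<forall>U. openin X U \<longleftrightarrow> U \<subseteq> E \<and> (\<forall>c\<in>U. \<exists>V\<in>\<V>. {x \<in> E. x - c \<in> V} \<subseteq> U))"

lemma linear_set_combine: "linear_set E \<Longrightarrow> x \<in> E \<Longrightarrow> y \<in> E \<Longrightarrow> (\<lambda>i. a * x i + b * y i) \<in> E"
  by (simp add: linear_set_def)

lemma linear_set_diff: "linear_set E \<Longrightarrow> x \<in> E \<Longrightarrow> y \<in> E \<Longrightarrow> x - y \<in> E"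
  using linear_set_combine[of E x y 1 "-1"] by (simp add: fun_diff_def)

lemma linear_set_scale: "linear_set E \<Longrightarrow> x \<in> E \<Longrightarrow> (\<lambda>i. a * x i) \<in> E"
  using linear_set_combine[of E x x a 0] by simp

lemma linear_set_zero: "linear_set E \<Longrightarrow> (\<lambda>i. 0) \<in> E"
  by (simp add: linear_set_def)

lemma linear_set_INT: "(\<And>j. j \<in> J \<Longrightarrow> linear_set (E j)) \<Longrightarrow> linear_set (\<Inter>j\<in>J. E j)"
  unfolding linear_set_def by simp

lemma linear_set_UN:
  assumes "J \<noteq> {}" "\<And>j. j \<in> J \<Longrightarrow> linear_set (E j)"
    "\<And>j j'. j \<in> J \<Longrightarrow> j' \<in> J \<Longrightarrow> \<exists>k\<in>J. E j \<subseteq> E k \<and> E j' \<subseteq> E k"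
  shows "linear_set (\<Union>j\<in>J. E j)"
  unfolding linear_set_def
proof (intro conjI ballI allI)
  show "(\<lambda>i. 0) \<in> (\<Union>j\<in>J. E j)" using assms(1) linear_set_zero[OF assms(2)] by blast
  fix x y a b assume "x \<in> (\<Union>j\<in>J. E j)" "y \<in> (\<Union>j\<in>J. E j)"
  then obtain j j' where j: "j \<in> J" "j' \<in> J" and "x \<in> E j" "y \<in> E j'" by blast
  moreover obtain k where "k \<in> J" "E j \<subseteq> E k" "E j' \<subseteq> E k" using assms(3)[OF j] by blast
  ultimately have "(\<lambda>i. a * x i + b * y i) \<in> E k"
    by (intro linear_set_combine assms(2)) auto
  then show "(\<lambda>i. a * x i + b * y i) \<in> (\<Union>j\<in>J. E j)" using \<open>k \<in> J\<close> by blast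
qed

lemma lin_topD:
  assumes "lin_top X E \<V>"
  shows "linear_set E" "\<V> \<noteq> {}"
    "V \<in> \<V> \<Longrightarrow> abs_convex V" "V \<in> \<V> \<Longrightarrow> (\<lambda>i. 0) \<in> V"
    "V \<in> \<V> \<Longrightarrow> \<exists>W\<in>\<V>. \<forall>x\<in>W \<inter> E. (\<lambda>i. 2 * x i) \<in> V"
    "V \<in> \<V> \<Longrightarrow> V' \<in> \<V> \<Longrightarrow> \<exists>W\<in>\<V>. W \<inter> E \<subseteq> V \<inter> V'"
    "openin X U \<longleftrightarrow> U \<subseteq> E \<and> (\<forall>c\<in>U. \<exists>V\<in>\<V>. {x \<in> E. x - c \<in> V} \<subseteq> U)"
proof -
  note * = assms[unfolded lin_top_def]
  show "linear_set E" using * by (elim conjE)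
  show "\<V> \<noteq> {}" using * by (elim conjE)
  show "abs_convex V" "(\<lambda>i. 0) \<in> V" if "V \<in> \<V>" using * that by simp_all
  have "\<forall>V\<in>\<V>. \<exists>W\<in>\<V>. \<forall>x\<in>W \<inter> E. (\<lambda>i. 2 * x i) \<in> V" using * by (elim conjE)
  then show "\<exists>W\<in>\<V>. \<forall>x\<in>W \<inter> E. (\<lambda>i. 2 * x i) \<in> V" if "V \<in> \<V>" using that by (rule bspec)
  have "\<forall>V\<in>\<V>. \<forall>V'\<in>\<V>. \<exists>W\<in>\<V>. W \<inter> E \<subseteq> V \<inter> V'" using * by (elim conjE)
  then show "\<exists>W\<in>\<V>. W \<inter> E \<subseteq> V \<inter> V'" if "V \<in> \<V>" "V' \<in> \<V>" using that by simp
  have "\<forall>U. openin X U \<longleftrightarrow> U \<subseteq> E \<and> (\<forall>c\<in>U. \<exists>V\<in>\<V>. {x \<in> E. x - c \<in> V} \<subseteq> U)" using * by (elim conjE)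
  then show "openin X U \<longleftrightarrow> U \<subseteq> E \<and> (\<forall>c\<in>U. \<exists>V\<in>\<V>. {x \<in> E. x - c \<in> V} \<subseteq> U)" by (rule spec)
qed

lemma abs_convex_combine:
  "abs_convex V \<Longrightarrow> u \<in> V \<Longrightarrow> v \<in> V \<Longrightarrow> norm a + norm b \<le> 1 \<Longrightarrow> (\<lambda>i. a * u i + b * v i) \<in> V"
  by (simp add: abs_convex_def)

lemma abs_convex_half:
  assumes V: "abs_convex V"
  shows "abs_convex {x. (\<lambda>i. 2 * x i) \<in> V}"
  unfolding abs_convex_def
proof (intro ballI allI impI)
  fix u v and a b :: complex
  assume "u \<in> {x. (\<lambda>i. 2 * x i) \<in> V}" "v \<in> {x. (\<lambda>i. 2 * x i) \<in> V}" and ab: "norm a + norm b \<le> 1"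
  then have "(\<lambda>i. a * (2 * u i) + b * (2 * v i)) \<in> V"
    using abs_convex_combine[OF V _ _ ab, of "\<lambda>i. 2 * u i" "\<lambda>i. 2 * v i"] by blast
  then show "(\<lambda>i. a * u i + b * v i) \<in> {x. (\<lambda>i. 2 * x i) \<in> V}" by (simp add: algebra_simps)
qed

lemma lin_top_half:
  assumes X: "lin_top X E \<V>" and "V \<in> \<V>"
  shows "\<exists>W\<in>\<V>. \<forall>x\<in>W \<inter> E. \<forall>y\<in>W \<inter> E. (\<lambda>i. x i + y i) \<in> V"
proof -
  obtain W where W: "W \<in> \<V>" "\<forall>x\<in>W \<inter> E. (\<lambda>i. 2 * x i) \<in> V" using lin_topD(5)[OF assms] by blast
  have "(\<lambda>i. x i + y i) \<in> V" if "x \<in> W \<inter> E" "y \<in> W \<inter> E" for x y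
    using abs_convex_combine[OF lin_topD(3)[OF assms], of "\<lambda>i. 2 * x i" "\<lambda>i. 2 * y i" "1/2" "1/2"]
      W(2) that by simp
  then show ?thesis using W(1) by blast
qed

lemma topspace_lin_top:
  assumes X: "lin_top X E \<V>"
  shows "topspace X = E"
proof
  show "topspace X \<subseteq> E" using lin_topD(7)[OF X, of "topspace X"] by simp
  have "openin X E" using lin_topD(2)[OF X] by (auto simp: lin_topD(7)[OF X])
  then show "E \<subseteq> topspace X" by (rule openin_subset)
qed

lemma lin_top_openin_nbhd:
  assumes X: "lin_top X E \<V>" and c: "c \<in> E" and V: "V \<in> \<V>"
  obtains W where "openin X W" "c \<in> W" "W \<subseteq> {x \<in> E. x - c \<in> V}"
proof
  let ?W = "{w \<in> E. \<exists>W\<in>\<V>. {x \<in> E. x - w \<in> W} \<subseteq> {x \<in> E. x - c \<in> V}}"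
  show "openin X ?W"
    unfolding lin_topD(7)[OF X]
  proof (intro conjI ballI)
    fix w assume "w \<in> ?W"
    then obtain W where W: "w \<in> E" "W \<in> \<V>" "{x \<in> E. x - w \<in> W} \<subseteq> {x \<in> E. x - c \<in> V}" by blast
    obtain W' where W': "W' \<in> \<V>" "\<forall>x\<in>W' \<inter> E. \<forall>y\<in>W' \<inter> E. (\<lambda>i. x i + y i) \<in> W"
      using lin_top_half[OF X W(2)] by blast
    have "v \<in> ?W" if v: "v \<in> E" "v - w \<in> W'" for v
    proof -
      have "x - w \<in> W" if "x \<in> E" "x - v \<in> W'" for x
      proof -
        have "(\<lambda>i. (x - v) i + (v - w) i) \<in> W"
          using W' that v linear_set_diff[OF lin_topD(1)[OF X]] W(1) by blast
        then show ?thesis by (simp add: fun_diff_def)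
      qed
      then have "{x \<in> E. x - v \<in> W'} \<subseteq> {x \<in> E. x - c \<in> V}" using W(3) by blast
      then show ?thesis using v W'(1) by blast
    qed
    then show "\<exists>V\<in>\<V>. {x \<in> E. x - w \<in> V} \<subseteq> ?W" using W'(1) by blast
  qed blast
  show "c \<in> ?W" using c V by blast
  show "?W \<subseteq> {x \<in> E. x - c \<in> V}"
  proof
    fix w assume "w \<in> ?W"
    then obtain W where W: "w \<in> E" "W \<in> \<V>" "{x \<in> E. x - w \<in> W} \<subseteq> {x \<in> E. x - c \<in> V}" by blast
    have "w - w = (\<lambda>i. 0)" by (simp add: fun_diff_def)
    then have "w - w \<in> W" using lin_topD(4)[OF X W(2)] by simp
    then show "w \<in> {x \<in> E. x - c \<in> V}" using W(1,3) by blast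
  qed
qed

lemma zero_nbhd_lin_top:
  assumes X: "lin_top X E \<V>"
  shows "zero_nbhd X V \<longleftrightarrow> (\<exists>W\<in>\<V>. W \<inter> E \<subseteq> V)"
proof
  assume "zero_nbhd X V"
  then obtain W where W: "openin X W" "(\<lambda>i. 0) \<in> W" "W \<subseteq> V" by (auto simp: zero_nbhd_def)
  then obtain V' where "V' \<in> \<V>" "{x \<in> E. x - (\<lambda>i. 0) \<in> V'} \<subseteq> W" using lin_topD(7)[OF X] by blast
  then have "V' \<inter> E \<subseteq> V" using W(3) by (auto simp: fun_diff_def)
  then show "\<exists>W\<in>\<V>. W \<inter> E \<subseteq> V" using \<open>V' \<in> \<V>\<close> by (rule bexI)
next
  assume "\<exists>W\<in>\<V>. W \<inter> E \<subseteq> V"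
  then obtain W where W: "W \<in> \<V>" "W \<inter> E \<subseteq> V" by (rule bexE)
  obtain U where "openin X U" "(\<lambda>i. 0) \<in> U" "U \<subseteq> {x \<in> E. x - (\<lambda>i. 0) \<in> W}"
    by (rule lin_top_openin_nbhd[OF X linear_set_zero[OF lin_topD(1)[OF X]] W(1)])
  moreover then have "U \<subseteq> V" using W(2) by (auto simp: fun_diff_def)
  ultimately show "zero_nbhd X V" unfolding zero_nbhd_def by blast
qed

lemma limitin_lin_top:
  assumes X: "lin_top X E \<V>"
  shows "limitin X x l F \<longleftrightarrow> l \<in> E \<and> (\<forall>V\<in>\<V>. eventually (\<lambda>n. x n \<in> E \<and> x n - l \<in> V) F)"
proof
  assume L: "limitin X x l F"
  then have l: "l \<in> E" by (simp add: limitin_def topspace_lin_top[OF X])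
  have "eventually (\<lambda>n. x n \<in> E \<and> x n - l \<in> V) F" if V: "V \<in> \<V>" for V
  proof -
    obtain W where "openin X W" "l \<in> W" "W \<subseteq> {x \<in> E. x - l \<in> V}"
      by (rule lin_top_openin_nbhd[OF X l V])
    then show ?thesis using L by (auto simp: limitin_def elim!: allE[of _ W] eventually_mono)
  qed
  then show "l \<in> E \<and> (\<forall>V\<in>\<V>. eventually (\<lambda>n. x n \<in> E \<and> x n - l \<in> V) F)" using l by blast
next
  assume R: "l \<in> E \<and> (\<forall>V\<in>\<V>. eventually (\<lambda>n. x n \<in> E \<and> x n - l \<in> V) F)"
  have "eventually (\<lambda>n. x n \<in> U) F" if U: "openin X U" "l \<in> U" for U
  proof -
    obtain V where V: "V \<in> \<V>" "{x \<in> E. x - l \<in> V} \<subseteq> U" using U lin_topD(7)[OF X] by blast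
    have "eventually (\<lambda>n. x n \<in> E \<and> x n - l \<in> V) F" using R V(1) by blast
    then show ?thesis using V(2) by (auto elim!: eventually_mono)
  qed
  then show "limitin X x l F" using R by (simp add: limitin_def topspace_lin_top[OF X])
qed

lemma continuous_map_lin_top:
  assumes X: "lin_top X E \<V>" and Z: "lin_top Z E' \<W>"
    and f: "\<And>x. x \<in> E \<Longrightarrow> f x \<in> E'" "\<And>x y. x \<in> E \<Longrightarrow> y \<in> E \<Longrightarrow> f (x - y) = f x - f y"
    and c: "\<And>W. W \<in> \<W> \<Longrightarrow> \<exists>V\<in>\<V>. \<forall>x\<in>V \<inter> E. f x \<in> W"
  shows "continuous_map X Z f"
  unfolding continuous_map_def topspace_lin_top[OF X] topspace_lin_top[OF Z]
proof (intro conjI allI impI)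
  show "f \<in> E \<rightarrow> E'" using f(1) by blast
  fix U assume U: "openin Z U"
  show "openin X {x \<in> E. f x \<in> U}"
    unfolding lin_topD(7)[OF X]
  proof (intro conjI ballI)
    fix l assume l: "l \<in> {x \<in> E. f x \<in> U}"
    then have "f l \<in> U" by simp
    then obtain W where W: "W \<in> \<W>" "{x \<in> E'. x - f l \<in> W} \<subseteq> U" using U lin_topD(7)[OF Z] by blast
    obtain V where V: "V \<in> \<V>" "\<forall>x\<in>V \<inter> E. f x \<in> W" using c[OF W(1)] by blast
    have "f x \<in> U" if x: "x \<in> E" "x - l \<in> V" for x
    proof -
      have "x - l \<in> E" using x l linear_set_diff[OF lin_topD(1)[OF X]] by blast
      then have "f (x - l) \<in> W" using x V(2) by blast
      then have "f x - f l \<in> W" using f(2)[of x l] x l by simp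
      then show ?thesis using W(2) f(1)[OF x(1)] by blast
    qed
    then show "\<exists>V\<in>\<V>. {x \<in> E. x - l \<in> V} \<subseteq> {x \<in> E. f x \<in> U}" using V(1) by blast
  qed blast
qed

lemma lin_top_ind_lim:
  assumes J: "J \<noteq> {}" and X: "\<And>j. j \<in> J \<Longrightarrow> lin_top (X j) (E j) (\<V> j)"
    and dir: "\<And>j j'. j \<in> J \<Longrightarrow> j' \<in> J \<Longrightarrow> \<exists>k\<in>J. E j \<subseteq> E k \<and> E j' \<subseteq> E k"
  shows "lin_top (ind_lim J X) (\<Union>j\<in>J. E j)
    {V. abs_convex V \<and> (\<forall>j\<in>J. \<exists>W\<in>\<V> j. W \<inter> E j \<subseteq> V)}" (is "lin_top _ ?E ?N")
  unfolding lin_top_def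
proof (intro conjI ballI allI)
  show "linear_set ?E" by (rule linear_set_UN[OF J lin_topD(1)[OF X] dir])
  show "?N \<noteq> {}"
  proof -
    have "UNIV \<in> ?N" using lin_topD(2)[OF X] by (auto simp: abs_convex_def)
    then show ?thesis by blast
  qed
next
  fix V assume "V \<in> ?N"
  then show "abs_convex V" by blast
next
  fix V assume V: "V \<in> ?N"
  obtain j where j: "j \<in> J" using J by blast
  then obtain W where "W \<in> \<V> j" "W \<inter> E j \<subseteq> V" using V by blast
  then show "(\<lambda>i. 0) \<in> V" using lin_topD(4)[OF X[OF j]] linear_set_zero[OF lin_topD(1)[OF X[OF j]]] by blast
next
  fix V assume V: "V \<in> ?N"
  let ?W = "{x. (\<lambda>i. 2 * x i) \<in> V}"
  have "abs_convex ?W" using V by (intro abs_convex_half) simp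
  moreover have "\<exists>W\<in>\<V> j. W \<inter> E j \<subseteq> ?W" if j: "j \<in> J" for j
  proof -
    obtain W where W: "W \<in> \<V> j" "W \<inter> E j \<subseteq> V" using V j by blast
    obtain W' where W': "W' \<in> \<V> j" "\<forall>x\<in>W' \<inter> E j. (\<lambda>i. 2 * x i) \<in> W"
      using lin_topD(5)[OF X[OF j] W(1)] by blast
    then have "W' \<inter> E j \<subseteq> ?W"
      using W(2) linear_set_scale[OF lin_topD(1)[OF X[OF j]]] by blast
    then show ?thesis using W'(1) by blast
  qed
  ultimately have "?W \<in> ?N" by blast
  then show "\<exists>W\<in>?N. \<forall>x\<in>W \<inter> ?E. (\<lambda>i. 2 * x i) \<in> V" by (rule bexI[rotated]) simp
next
  fix V V' assume V: "V \<in> ?N" and V': "V' \<in> ?N"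
  have "abs_convex (V \<inter> V')" using V V' by (simp add: abs_convex_def)
  moreover have "\<exists>W\<in>\<V> j. W \<inter> E j \<subseteq> V \<inter> V'" if j: "j \<in> J" for j
  proof -
    obtain W W' where W: "W \<in> \<V> j" "W \<inter> E j \<subseteq> V" "W' \<in> \<V> j" "W' \<inter> E j \<subseteq> V'" using V V' j by blast
    obtain W'' where "W'' \<in> \<V> j" "W'' \<inter> E j \<subseteq> W \<inter> W'" using lin_topD(6)[OF X[OF j] W(1,3)] by blast
    then show ?thesis using W by (intro bexI[of _ W'']) auto
  qed
  ultimately have "V \<inter> V' \<in> ?N" by blast
  then show "\<exists>W\<in>?N. W \<inter> ?E \<subseteq> V \<inter> V'" by (rule bexI[rotated]) (rule Int_lower1)
next
  fix U
  have sp: "(\<Union>j\<in>J. topspace (X j)) = ?E" using topspace_lin_top[OF X] by simp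
  have nb: "zero_nbhd (X j) (V \<inter> topspace (X j)) \<longleftrightarrow> (\<exists>W\<in>\<V> j. W \<inter> E j \<subseteq> V)" if "j \<in> J" for j V
    using zero_nbhd_lin_top[OF X[OF that]] topspace_lin_top[OF X[OF that]] by auto
  have "(\<forall>j\<in>J. zero_nbhd (X j) (V \<inter> topspace (X j))) \<longleftrightarrow> (\<forall>j\<in>J. \<exists>W\<in>\<V> j. W \<inter> E j \<subseteq> V)" for V
    using nb by simp
  then show "openin (ind_lim J X) U \<longleftrightarrow> U \<subseteq> ?E \<and> (\<forall>c\<in>U. \<exists>V\<in>?N. {x \<in> ?E. x - c \<in> V} \<subseteq> U)"
    unfolding openin_ind_lim sp by (simp add: Bex_def conj_assoc)
qed

lemma openin_proj_lim_projection:
  "j \<in> J \<Longrightarrow> openin (X j) U \<Longrightarrow> openin (proj_lim J X) (U \<inter> (\<Inter>j\<in>J. topspace (X j)))"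
  unfolding proj_lim_def by (rule topology_generated_by_Basis) blast

lemma lin_top_proj_lim:
  assumes J: "J \<noteq> {}" and X: "\<And>j. j \<in> J \<Longrightarrow> lin_top (X j) (E j) (\<V> j)"
    and dir: "\<And>j j'. j \<in> J \<Longrightarrow> j' \<in> J \<Longrightarrow> \<exists>k\<in>J. (\<forall>V\<in>\<V> j. \<exists>W\<in>\<V> k. W \<inter> E k \<subseteq> V) \<and>
      (\<forall>V\<in>\<V> j'. \<exists>W\<in>\<V> k. W \<inter> E k \<subseteq> V)"
  shows "lin_top (proj_lim J X) (\<Inter>j\<in>J. E j) (\<Union>j\<in>J. \<V> j)" (is "lin_top _ ?E ?N")
proof -
  have base: "\<exists>W\<in>?N. W \<inter> ?E \<subseteq> V \<inter> V'" if VV: "V \<in> ?N" "V' \<in> ?N" for V V'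
  proof -
    obtain j j' where j: "j \<in> J" "j' \<in> J" "V \<in> \<V> j" "V' \<in> \<V> j'" using VV by blast
    then obtain k W W' where k: "k \<in> J" and W: "W \<in> \<V> k" "W \<inter> E k \<subseteq> V" "W' \<in> \<V> k" "W' \<inter> E k \<subseteq> V'"
      using dir[OF j(1,2)] by blast
    obtain W'' where W'': "W'' \<in> \<V> k" "W'' \<inter> E k \<subseteq> W \<inter> W'" using lin_topD(6)[OF X[OF k] W(1,3)] by blast
    then have "W'' \<inter> ?E \<subseteq> V \<inter> V'" using W k by blast
    then show ?thesis using W''(1) k by blast
  qed
  have lin: "linear_set ?E" by (rule linear_set_INT[OF lin_topD(1)[OF X]])
  show ?thesis
  unfolding lin_top_def
proof (intro conjI ballI allI)
  show "linear_set ?E" by (rule lin)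
  show "?N \<noteq> {}" using J lin_topD(2)[OF X] by blast
next
  fix V assume "V \<in> ?N"
  then show "abs_convex V" "(\<lambda>i. 0) \<in> V" using lin_topD(3,4)[OF X] by blast+
next
  fix V assume "V \<in> ?N"
  then obtain j where j: "j \<in> J" "V \<in> \<V> j" by blast
  then obtain W where "W \<in> \<V> j" "\<forall>x\<in>W \<inter> E j. (\<lambda>i. 2 * x i) \<in> V" using lin_topD(5)[OF X] by blast
  then show "\<exists>W\<in>?N. \<forall>x\<in>W \<inter> ?E. (\<lambda>i. 2 * x i) \<in> V" using j(1) by blast
next
  show "\<exists>W\<in>?N. W \<inter> ?E \<subseteq> V \<inter> V'" if "V \<in> ?N" "V' \<in> ?N" for V V' using base that .
next
  fix U
  have sp: "(\<Inter>j\<in>J. topspace (X j)) = ?E" using topspace_lin_top[OF X] by simp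
  show "openin (proj_lim J X) U \<longleftrightarrow> U \<subseteq> ?E \<and> (\<forall>c\<in>U. \<exists>V\<in>?N. {x \<in> ?E. x - c \<in> V} \<subseteq> U)"
  proof
    assume "openin (proj_lim J X) U"
    then have "generate_topology_on {U \<inter> (\<Inter>j\<in>J. topspace (X j)) | j U. j \<in> J \<and> openin (X j) U} U"
      unfolding proj_lim_def openin_topology_generated_by_iff .
    then show "U \<subseteq> ?E \<and> (\<forall>c\<in>U. \<exists>V\<in>?N. {x \<in> ?E. x - c \<in> V} \<subseteq> U)"
    proof (induction rule: generate_topology_on.induct)
      case Empty
      then show ?case by simp
    next
      case (Int A B)
      show ?case
      proof (intro conjI ballI)
        show "A \<inter> B \<subseteq> ?E" using Int by blast
        fix c assume c: "c \<in> A \<inter> B"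
        obtain V V' where V: "V \<in> ?N" "{x \<in> ?E. x - c \<in> V} \<subseteq> A" "V' \<in> ?N" "{x \<in> ?E. x - c \<in> V'} \<subseteq> B"
          using Int.IH c by (meson IntE)
        obtain W'' where W'': "W'' \<in> ?N" "W'' \<inter> ?E \<subseteq> V \<inter> V'" using base[OF V(1,3)] by blast
        have "c \<in> ?E" using c Int.IH(1) by blast
        then have "{x \<in> ?E. x - c \<in> W''} \<subseteq> {x \<in> ?E. x - c \<in> V} \<inter> {x \<in> ?E. x - c \<in> V'}"
          using W''(2) linear_set_diff[OF lin] by blast
        then have "{x \<in> ?E. x - c \<in> W''} \<subseteq> A \<inter> B" using V(2,4) by blast
        then show "\<exists>V\<in>?N. {x \<in> ?E. x - c \<in> V} \<subseteq> A \<inter> B" using W''(1) by blast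
      qed
    next
      case (UN K)
      then show ?case by (meson Union_iff Union_upper Union_least order_trans)
    next
      case (Basis s)
      then obtain j U where s: "s = U \<inter> ?E" and j: "j \<in> J" "openin (X j) U" unfolding sp by blast
      show ?case
      proof (intro conjI ballI)
        fix c assume "c \<in> s"
        then have "c \<in> U" using s by blast
        then obtain V where V: "V \<in> \<V> j" "{x \<in> E j. x - c \<in> V} \<subseteq> U"
          using j(2) lin_topD(7)[OF X[OF j(1)]] by blast
        then have "{x \<in> ?E. x - c \<in> V} \<subseteq> s" using s j(1) by blast
        then show "\<exists>V\<in>?N. {x \<in> ?E. x - c \<in> V} \<subseteq> s" using V(1) j(1) by blast
      qed (use s in blast)
    qed
  next
    assume U: "U \<subseteq> ?E \<and> (\<forall>c\<in>U. \<exists>V\<in>?N. {x \<in> ?E. x - c \<in> V} \<subseteq> U)"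
    have "\<exists>W. openin (proj_lim J X) W \<and> c \<in> W \<and> W \<subseteq> U" if c: "c \<in> U" for c
    proof -
      obtain j V where j: "j \<in> J" "V \<in> \<V> j" "{x \<in> ?E. x - c \<in> V} \<subseteq> U" using U c by blast
      have "c \<in> E j" using c U j(1) by blast
      then obtain W where W: "openin (X j) W" "c \<in> W" "W \<subseteq> {x \<in> E j. x - c \<in> V}"
        by (rule lin_top_openin_nbhd[OF X[OF j(1)] _ j(2)])
      have "openin (proj_lim J X) (W \<inter> ?E)"
        using openin_proj_lim_projection[of j J X W] j(1) W(1) unfolding sp by blast
      moreover have "c \<in> W \<inter> ?E" using W(2) c U by blast
      moreover have "W \<inter> ?E \<subseteq> U" using W(3) j(3) by blast
      ultimately show ?thesis by blast
    qed
    then show "openin (proj_lim J X) U" by (subst openin_subopen) blast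
  qed
qed
qed

section \<open>Weighted sup norms\<close>

abbreviation sup_norm :: "('i \<Rightarrow> ennreal) \<Rightarrow> ('i \<Rightarrow> complex) \<Rightarrow> ennreal" where
  "sup_norm \<equiv> wnorm \<infinity>"

lemma wnorm_sup: "sup_norm \<omega> x = (SUP i. ennreal (norm (x i)) * \<omega> i)"
  by (simp add: wnorm_def lp_norm_def)

lemma wnorm_sup_upper: "ennreal (norm (x i)) * \<omega> i \<le> sup_norm \<omega> x"
  unfolding wnorm_sup by (rule SUP_upper) simp

lemma wnorm_sup_least: "(\<And>i. ennreal (norm (x i)) * \<omega> i \<le> C) \<Longrightarrow> sup_norm \<omega> x \<le> C"
  unfolding wnorm_sup by (rule SUP_least)

lemma wnorm_sup_mono:
  assumes "\<And>i. norm (x i) \<le> norm (y i)" "\<And>i. \<omega> i \<le> \<omega>' i"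
  shows "sup_norm \<omega> x \<le> sup_norm \<omega>' y"
proof (rule wnorm_sup_least)
  fix i
  have "ennreal (norm (x i)) * \<omega> i \<le> ennreal (norm (y i)) * \<omega>' i"
    by (intro mult_mono ennreal_leI assms) auto
  then show "ennreal (norm (x i)) * \<omega> i \<le> sup_norm \<omega>' y" by (rule order_trans[OF _ wnorm_sup_upper])
qed

lemma wnorm_sup_combine:
  "sup_norm \<omega> (\<lambda>i. a * x i + b * y i) \<le> ennreal (norm a) * sup_norm \<omega> x + ennreal (norm b) * sup_norm \<omega> y"
proof (rule wnorm_sup_least)
  fix i
  have "ennreal (norm (a * x i + b * y i)) \<le> ennreal (norm a) * ennreal (norm (x i)) + ennreal (norm b) * ennreal (norm (y i))"
    by (simp flip: ennreal_mult'' ennreal_plus) (metis norm_mult norm_triangle_ineq)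
  then have "ennreal (norm (a * x i + b * y i)) * \<omega> i \<le>
      (ennreal (norm a) * ennreal (norm (x i)) + ennreal (norm b) * ennreal (norm (y i))) * \<omega> i"
    by (rule mult_right_mono) simp
  also have "\<dots> = ennreal (norm a) * (ennreal (norm (x i)) * \<omega> i) + ennreal (norm b) * (ennreal (norm (y i)) * \<omega> i)"
    by (simp add: distrib_right mult.assoc)
  also have "\<dots> \<le> ennreal (norm a) * sup_norm \<omega> x + ennreal (norm b) * sup_norm \<omega> y"
    by (intro add_mono mult_left_mono wnorm_sup_upper) auto
  finally show "ennreal (norm (a * x i + b * y i)) * \<omega> i \<le> \<dots>" .
qed

lemma wnorm_sup_add: "sup_norm \<omega> (\<lambda>i. x i + y i) \<le> sup_norm \<omega> x + sup_norm \<omega> y"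
  using wnorm_sup_combine[of \<omega> 1 x 1 y] by simp

lemma wnorm_sup_scale: "sup_norm \<omega> (\<lambda>i. a * x i) \<le> ennreal (norm a) * sup_norm \<omega> x"
  using wnorm_sup_combine[of \<omega> a x 0 x] by simp

lemma wnorm_sup_double:
  assumes "sup_norm \<omega> x < e / 2"
  shows "sup_norm \<omega> (\<lambda>i. 2 * x i) < e"
proof -
  have "2 * sup_norm \<omega> x < 2 * (e / 2)"
    using assms by (intro ennreal_mult_strict_left_mono) auto
  also have "2 * (e / 2) = e"
    by (simp add: ennreal_times_divide mult.commute mult_divide_eq_ennreal)
  finally show ?thesis using wnorm_sup_scale[of \<omega> 2 x] by (auto intro: le_less_trans)
qed

lemma wnorm_sup_cong:
  assumes "\<And>i. 0 < w i \<Longrightarrow> x i = y i"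
  shows "sup_norm w x = sup_norm w y"
proof -
  have "ennreal (norm (x i)) * w i = ennreal (norm (y i)) * w i" for i
    using assms[of i] by (cases "w i = 0") (auto simp: zero_less_iff_neq_zero)
  then show ?thesis unfolding wnorm_sup by simp
qed

lemma linear_set_ell_sup: "linear_set (ell_set \<infinity> \<omega>)"
  unfolding linear_set_def
proof (intro conjI ballI allI)
  fix x y :: "_ \<Rightarrow> complex" and a b :: complex assume "x \<in> ell_set \<infinity> \<omega>" "y \<in> ell_set \<infinity> \<omega>"
  then have "ennreal (norm a) * sup_norm \<omega> x + ennreal (norm b) * sup_norm \<omega> y < \<infinity>"
    by (simp add: ell_set_def ennreal_mult_less_top)
  then show "(\<lambda>i. a * x i + b * y i) \<in> ell_set \<infinity> \<omega>"
    unfolding ell_set_def using le_less_trans[OF wnorm_sup_combine[of \<omega> a x b y]] by blast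
qed simp

lemma abs_convex_sup_ball: "abs_convex {x. sup_norm \<omega> x < \<epsilon>}"
  unfolding abs_convex_def
proof (intro ballI allI impI)
  fix u v and a b :: complex
  assume u: "u \<in> {x. sup_norm \<omega> x < \<epsilon>}" and v: "v \<in> {x. sup_norm \<omega> x < \<epsilon>}" and ab: "norm a + norm b \<le> 1"
  let ?m = "max (sup_norm \<omega> u) (sup_norm \<omega> v)"
  have "sup_norm \<omega> (\<lambda>i. a * u i + b * v i) \<le> ennreal (norm a) * sup_norm \<omega> u + ennreal (norm b) * sup_norm \<omega> v"
    by (rule wnorm_sup_combine)
  also have "\<dots> \<le> ennreal (norm a) * ?m + ennreal (norm b) * ?m"
    by (intro add_mono mult_left_mono) auto
  also have "\<dots> = ennreal (norm a + norm b) * ?m"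
    by (simp add: distrib_right ennreal_plus)
  also have "\<dots> \<le> 1 * ?m"
    using ab ennreal_leI[OF ab] by (intro mult_right_mono) (auto simp del: ennreal_plus)
  also have "\<dots> < \<epsilon>" using u v by simp
  finally show "(\<lambda>i. a * u i + b * v i) \<in> {x. sup_norm \<omega> x < \<epsilon>}" by simp
qed

definition sup_balls :: "('i \<Rightarrow> ennreal) \<Rightarrow> ('i \<Rightarrow> complex) set set" where
  "sup_balls \<omega> = (\<lambda>\<epsilon>. {x. sup_norm \<omega> x < \<epsilon>}) ` {0<..}"

lemma lin_top_ell_sup: "lin_top (ell \<infinity> \<omega>) (ell_set \<infinity> \<omega>) (sup_balls \<omega>)"
  unfolding lin_top_def
proof (intro conjI ballI allI)
  show "linear_set (ell_set \<infinity> \<omega>)" by (rule linear_set_ell_sup)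
  show "sup_balls \<omega> \<noteq> {}" unfolding sup_balls_def using zero_less_one by blast
  show "abs_convex V" "(\<lambda>i. 0) \<in> V" if "V \<in> sup_balls \<omega>" for V
    using that abs_convex_sup_ball by (auto simp: sup_balls_def)
  show "\<exists>W\<in>sup_balls \<omega>. \<forall>x\<in>W \<inter> ell_set \<infinity> \<omega>. (\<lambda>i. 2 * x i) \<in> V" if V: "V \<in> sup_balls \<omega>" for V
  proof -
    obtain e where e: "e > 0" "V = {x. sup_norm \<omega> x < e}" using V by (auto simp: sup_balls_def)
    have "sup_norm \<omega> (\<lambda>i. 2 * x i) < e" if "sup_norm \<omega> x < e / 2" for x
      using that by (rule wnorm_sup_double)
    moreover have "{x. sup_norm \<omega> x < e / 2} \<in> sup_balls \<omega>"
      unfolding sup_balls_def using e(1) by (auto simp: ennreal_zero_less_divide)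
    ultimately show ?thesis unfolding e(2) by (intro bexI[of _ "{x. sup_norm \<omega> x < e / 2}"]) auto
  qed
  show "\<exists>W\<in>sup_balls \<omega>. W \<inter> ell_set \<infinity> \<omega> \<subseteq> V \<inter> V'" if V: "V \<in> sup_balls \<omega>" "V' \<in> sup_balls \<omega>" for V V'
  proof -
    obtain e e' where e: "e > 0" "V = {x. sup_norm \<omega> x < e}" "e' > 0" "V' = {x. sup_norm \<omega> x < e'}"
      using V by (auto simp: sup_balls_def)
    then have "{x. sup_norm \<omega> x < min e e'} \<in> sup_balls \<omega>"
      unfolding sup_balls_def by (intro imageI) simp
    then show ?thesis by (rule bexI[rotated]) (auto simp: e)
  qed
  show "openin (ell \<infinity> \<omega>) U \<longleftrightarrow> U \<subseteq> ell_set \<infinity> \<omega> \<and>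
      (\<forall>c\<in>U. \<exists>V\<in>sup_balls \<omega>. {x \<in> ell_set \<infinity> \<omega>. x - c \<in> V} \<subseteq> U)" for U
    unfolding openin_ell sup_balls_def by (simp add: Bex_def)
qed

lemma epow_le:
  assumes "x \<le> ennreal y" "0 \<le> y" "0 \<le> q"
  shows "epow x q \<le> ennreal (y powr q)"
proof -
  obtain r where r: "x = ennreal r" "0 \<le> r" using assms(1) by (cases x) (auto simp: top_unique)
  then have "r \<le> y" using assms by simp
  then show ?thesis using r assms by (simp add: epow_def powr_mono2 ennreal_leI)
qed

lemma wnorm_sup_le_wnorm:
  assumes p: "0 < p"
  shows "sup_norm \<omega> x \<le> wnorm p \<omega> x"
proof (cases "p = \<infinity>")
  case False
  then obtain q where q: "p = ennreal q" "0 < q" using p by (cases p) auto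
  show ?thesis
  proof (rule wnorm_sup_least)
    fix i
    let ?a = "\<lambda>i. ennreal (norm (x i)) * \<omega> i"
    let ?S = "infsum (\<lambda>i. epow (?a i) q) UNIV"
    have w: "wnorm p \<omega> x = epow ?S (1 / q)"
      using q by (simp add: wnorm_def lp_norm_def)
    show "?a i \<le> wnorm p \<omega> x"
    proof (cases "?S = \<infinity>")
      case True
      then show ?thesis unfolding w by (simp add: epow_def)
    next
      case False
      then obtain s where s: "?S = ennreal s" "0 \<le> s" by (cases ?S) auto
      have "epow (?a i) q = infsum (\<lambda>i. epow (?a i) q) {i}" by simp
      also have "\<dots> \<le> ?S"
        by (rule infsum_mono_neutral) (auto intro: nonneg_summable_on_complete)
      finally have le: "epow (?a i) q \<le> ennreal s" unfolding s(1) .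
      then obtain r where r: "?a i = ennreal r" "0 \<le> r"
        by (cases "?a i") (auto simp: epow_def top_unique)
      have "r powr q \<le> s" using le r s by (simp add: epow_def)
      then have "(r powr q) powr (1 / q) \<le> s powr (1 / q)"
        using q by (intro powr_mono2) auto
      then have "r \<le> s powr (1 / q)" using q r by (simp add: powr_powr)
      then show ?thesis unfolding w r(1) s(1) using s by (simp add: epow_def ennreal_leI)
    qed
  qed
qed simp

lemma wnorm_le_wnorm_sup:
  fixes \<omega> \<omega>' :: "'i \<Rightarrow> ennreal"
  assumes q: "0 < q" and h: "\<And>i. 0 < h i" "(\<lambda>i. h i powr q) summable_on UNIV"
    and le: "\<And>i. \<omega>' i \<le> ennreal (h i) * \<omega> i"
  shows "wnorm (ennreal q) \<omega>' x \<le> ennreal ((infsum (\<lambda>i. h i powr q) UNIV) powr (1 / q)) * sup_norm \<omega> x"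
proof -
  let ?H = "infsum (\<lambda>i. h i powr q) UNIV"
  have H: "0 < ?H"
  proof -
    have "h undefined powr q \<le> ?H"
      using finite_sum_le_infsum[OF h(2), of "{undefined}"] by simp
    then show ?thesis using h(1)[of undefined] by (auto intro: less_le_trans[rotated])
  qed
  show ?thesis
  proof (cases "sup_norm \<omega> x = \<infinity>")
    case True
    then show ?thesis using H by (simp add: ennreal_mult_top)
  next
    case False
    then obtain m where m: "sup_norm \<omega> x = ennreal m" "0 \<le> m" by (cases "sup_norm \<omega> x") auto
    let ?a = "\<lambda>i. ennreal (norm (x i)) * \<omega>' i"
    have a: "?a i \<le> ennreal (h i * m)" for i
    proof -
      have "?a i \<le> ennreal (norm (x i)) * (ennreal (h i) * \<omega> i)" by (intro mult_left_mono le) auto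
      also have "\<dots> = ennreal (h i) * (ennreal (norm (x i)) * \<omega> i)" by (simp add: ac_simps)
      also have "\<dots> \<le> ennreal (h i) * ennreal m"
        unfolding m(1)[symmetric] by (intro mult_left_mono wnorm_sup_upper) auto
      finally show ?thesis using h(1)[of i] m by (simp add: ennreal_mult)
    qed
    have "infsum (\<lambda>i. epow (?a i) q) UNIV \<le> ennreal (m powr q * ?H)"
      unfolding nonneg_infsum_complete[of UNIV "\<lambda>i. epow (?a i) q", OF zero_le]
    proof (rule SUP_least)
      fix F :: "'i set" assume "F \<in> {F. finite F \<and> F \<subseteq> UNIV}"
      then have F: "finite F" by simp
      have "(\<Sum>i\<in>F. epow (?a i) q) \<le> (\<Sum>i\<in>F. ennreal ((h i * m) powr q))"
        using q m h(1) by (intro sum_mono epow_le a) (auto simp: less_imp_le)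
      also have "\<dots> = ennreal (m powr q * (\<Sum>i\<in>F. h i powr q))"
        using m h(1) by (simp add: sum_ennreal powr_mult less_imp_le sum_distrib_left mult.commute)
      also have "\<dots> \<le> ennreal (m powr q * ?H)"
        using finite_sum_le_infsum[OF h(2) F] by (intro ennreal_leI mult_left_mono) auto
      finally show "(\<Sum>i\<in>F. epow (?a i) q) \<le> \<dots>" .
    qed
    then have "epow (infsum (\<lambda>i. epow (?a i) q) UNIV) (1 / q) \<le> ennreal ((m powr q * ?H) powr (1 / q))"
      using q H by (intro epow_le) auto
    also have "(m powr q * ?H) powr (1 / q) = ?H powr (1 / q) * m"
      using q m H by (simp add: powr_mult powr_powr)
    finally show ?thesis
      using q m by (simp add: wnorm_def lp_norm_def ennreal_mult)
  qed
qed

section \<open>Systems of weights\<close>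

definition proj_ind :: "ennreal \<Rightarrow> (real \<Rightarrow> real \<Rightarrow> 'i \<Rightarrow> ennreal) \<Rightarrow> ('i \<Rightarrow> complex) topology" where
  "proj_ind p \<omega> = proj_lim {0<..} (\<lambda>a. ind_lim {0<..} (\<lambda>b. ell p (\<omega> b a)))"

definition ind_proj :: "ennreal \<Rightarrow> (real \<Rightarrow> real \<Rightarrow> 'i \<Rightarrow> ennreal) \<Rightarrow> ('i \<Rightarrow> complex) topology" where
  "ind_proj p \<omega> = ind_lim {0<..} (\<lambda>b. proj_lim {0<..} (\<lambda>a. ell p (\<omega> b a)))"

abbreviation ind_set :: "(real \<Rightarrow> real \<Rightarrow> 'i \<Rightarrow> ennreal) \<Rightarrow> real \<Rightarrow> ('i \<Rightarrow> complex) set" where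
  "ind_set \<omega> a \<equiv> \<Union>b\<in>{0<..}. ell_set \<infinity> (\<omega> b a)"

definition proj_ind_set :: "(real \<Rightarrow> real \<Rightarrow> 'i \<Rightarrow> ennreal) \<Rightarrow> ('i \<Rightarrow> complex) set" where
  "proj_ind_set \<omega> = (\<Inter>a\<in>{0<..}. ind_set \<omega> a)"

definition ind_proj_set :: "(real \<Rightarrow> real \<Rightarrow> 'i \<Rightarrow> ennreal) \<Rightarrow> ('i \<Rightarrow> complex) set" where
  "ind_proj_set \<omega> = (\<Union>b\<in>{0<..}. \<Inter>a\<in>{0<..}. ell_set \<infinity> (\<omega> b a))"

definition ind_nbhds :: "(real \<Rightarrow> real \<Rightarrow> 'i \<Rightarrow> ennreal) \<Rightarrow> real \<Rightarrow> ('i \<Rightarrow> complex) set set" where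
  "ind_nbhds \<omega> a = {V. abs_convex V \<and> (\<forall>b>0. \<exists>\<epsilon>>0. \<forall>x. sup_norm (\<omega> b a) x < \<epsilon> \<longrightarrow> x \<in> V)}"

definition proj_ind_nbhds :: "(real \<Rightarrow> real \<Rightarrow> 'i \<Rightarrow> ennreal) \<Rightarrow> ('i \<Rightarrow> complex) set set" where
  "proj_ind_nbhds \<omega> = (\<Union>a\<in>{0<..}. ind_nbhds \<omega> a)"

definition ind_proj_nbhds :: "(real \<Rightarrow> real \<Rightarrow> 'i \<Rightarrow> ennreal) \<Rightarrow> ('i \<Rightarrow> complex) set set" where
  "ind_proj_nbhds \<omega> = {V. abs_convex V \<and> (\<forall>b>0. \<exists>a>0. \<exists>\<epsilon>>0. \<forall>x.
     (\<forall>a'>0. sup_norm (\<omega> b a') x < \<infinity>) \<longrightarrow> sup_norm (\<omega> b a) x < \<epsilon> \<longrightarrow> x \<in> V)}"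

lemma ind_nbhdsI:
  "abs_convex V \<Longrightarrow> (\<And>b. 0 < b \<Longrightarrow> \<exists>\<epsilon>>0. \<forall>x. sup_norm (\<omega> b a) x < \<epsilon> \<longrightarrow> x \<in> V) \<Longrightarrow> V \<in> ind_nbhds \<omega> a"
  by (simp add: ind_nbhds_def)

lemma ind_proj_nbhdsI:
  "abs_convex V \<Longrightarrow> (\<And>b. 0 < b \<Longrightarrow> \<exists>a>0. \<exists>\<epsilon>>0. \<forall>x.
     (\<forall>a'>0. sup_norm (\<omega> b a') x < \<infinity>) \<longrightarrow> sup_norm (\<omega> b a) x < \<epsilon> \<longrightarrow> x \<in> V) \<Longrightarrow> V \<in> ind_proj_nbhds \<omega>"
  by (simp add: ind_proj_nbhds_def)

lemma decreasing_chain_directed: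
  fixes w :: "real \<Rightarrow> 'm \<Rightarrow> ennreal"
  assumes chain: "\<exists>s::nat \<Rightarrow> real. (\<forall>k. 0 < s k) \<and> (\<forall>k. \<forall>m\<in>A. w (s (Suc k)) m \<le> w (s k) m) \<and>
      (\<forall>r>0. \<exists>k. \<forall>m\<in>A. w (s k) m \<le> w r m)"
    and r: "0 < r" "0 < r'"
  shows "\<exists>r''>0. \<forall>m\<in>A. w r'' m \<le> w r m \<and> w r'' m \<le> w r' m"
proof -
  obtain s :: "nat \<Rightarrow> real" where s: "\<And>k. 0 < s k" "\<And>k m. m \<in> A \<Longrightarrow> w (s (Suc k)) m \<le> w (s k) m"
      "\<And>r. 0 < r \<Longrightarrow> \<exists>k. \<forall>m\<in>A. w (s k) m \<le> w r m"
    using chain by blast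
  obtain k k' where k: "\<forall>m\<in>A. w (s k) m \<le> w r m" "\<forall>m\<in>A. w (s k') m \<le> w r' m"
    using s(3)[OF r(1)] s(3)[OF r(2)] by blast
  have "w (s (max k k')) m \<le> w (s j) m" if "m \<in> A" "j \<le> max k k'" for j m
    using lift_Suc_antimono_le[of "\<lambda>k. w (s k) m", OF s(2)[OF that(1)] that(2)] .
  then have "\<forall>m\<in>A. w (s (max k k')) m \<le> w r m \<and> w (s (max k k')) m \<le> w r' m"
    using k by (meson max.cobounded1 max.cobounded2 order_trans)
  then show ?thesis using s(1) by blast
qed

locale weight_system =
  fixes \<omega> :: "real \<Rightarrow> real \<Rightarrow> 'i \<Rightarrow> ennreal"
  assumes cofinal: "\<exists>s::nat \<Rightarrow> real. (\<forall>k. 0 < s k) \<and> (\<forall>k. \<forall>a>0. \<forall>i. \<omega> (s (Suc k)) a i \<le> \<omega> (s k) a i) \<and>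
      (\<forall>b>0. \<exists>k. \<forall>a>0. \<forall>i. \<omega> (s k) a i \<le> \<omega> b a i)"
    and directed: "0 < a \<Longrightarrow> 0 < a' \<Longrightarrow> \<exists>a''>0. \<forall>b>0. \<forall>i. \<omega> b a i \<le> \<omega> b a'' i \<and> \<omega> b a' i \<le> \<omega> b a'' i"
    and positive: "\<exists>a>0. \<forall>b>0. 0 < \<omega> b a i"
    and positive_indep: "0 < b \<Longrightarrow> 0 < b' \<Longrightarrow> 0 < a \<Longrightarrow> 0 < \<omega> b a i \<Longrightarrow> 0 < \<omega> b' a i"
    and finite_weight: "\<exists>b>0. \<forall>a>0. \<omega> b a i < \<infinity>"
    and nuclear: "0 < q \<Longrightarrow> \<exists>\<beta> \<alpha>. (\<forall>r>0. 0 < \<beta> r \<and> 0 < \<alpha> r) \<and> (\<forall>b>0. \<forall>a>0. \<exists>h. (\<forall>i. 0 < h i) \<and>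
      (\<lambda>i. h i powr q) summable_on UNIV \<and> (\<forall>i. \<omega> (\<beta> b) a i \<le> ennreal (h i) * \<omega> b (\<alpha> a) i))"
begin

lemma ell_inclusion_nuclear:
  assumes p: "0 < p" "p \<noteq> \<infinity>"
  obtains \<beta> \<alpha> where "\<And>r. 0 < r \<Longrightarrow> 0 < \<beta> r" "\<And>r. 0 < r \<Longrightarrow> 0 < \<alpha> r"
    "\<And>a b. 0 < a \<Longrightarrow> 0 < b \<Longrightarrow> embeds (ell \<infinity> (\<omega> b (\<alpha> a))) (ell p (\<omega> (\<beta> b) a))"
proof -
  obtain q where q: "p = ennreal q" "0 < q" using p by (cases p) auto
  obtain \<beta> \<alpha> where ba: "\<forall>r>0. 0 < \<beta> r \<and> 0 < \<alpha> r" "\<forall>b>0. \<forall>a>0. \<exists>h. (\<forall>i. 0 < h i) \<and>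
      (\<lambda>i. h i powr q) summable_on UNIV \<and> (\<forall>i. \<omega> (\<beta> b) a i \<le> ennreal (h i) * \<omega> b (\<alpha> a) i)"
    using nuclear[OF q(2)] by blast
  have "embeds (ell \<infinity> (\<omega> b (\<alpha> a))) (ell p (\<omega> (\<beta> b) a))" if ab: "0 < a" "0 < b" for a b
  proof -
    obtain h where h: "\<And>i. 0 < h i" "(\<lambda>i. h i powr q) summable_on UNIV"
      "\<And>i. \<omega> (\<beta> b) a i \<le> ennreal (h i) * \<omega> b (\<alpha> a) i"
      using ba(2)[rule_format, OF ab(2,1)] by auto
    let ?C = "infsum (\<lambda>i. h i powr q) UNIV powr (1 / q)"
    have "wnorm p (\<omega> (\<beta> b) a) x \<le> ennreal (?C + 1) * sup_norm (\<omega> b (\<alpha> a)) x" for x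
    proof -
      have "wnorm p (\<omega> (\<beta> b) a) x \<le> ennreal ?C * sup_norm (\<omega> b (\<alpha> a)) x"
        unfolding q(1) by (rule wnorm_le_wnorm_sup[OF q(2) h])
      also have "\<dots> \<le> ennreal (?C + 1) * sup_norm (\<omega> b (\<alpha> a)) x"
        by (intro mult_right_mono ennreal_leI) auto
      finally show ?thesis .
    qed
    then show ?thesis by (intro ell_inclusion[of "?C + 1"]) (auto intro: add_nonneg_pos)
  qed
  then show ?thesis using ba(1) that[of \<beta> \<alpha>] by simp
qed

lemma ell_inclusion_sup: "0 < p \<Longrightarrow> embeds (ell p w) (ell \<infinity> w)"
  using wnorm_sup_le_wnorm[of p w] by (intro ell_inclusion[of 1]) auto

end

lemma proj_ind_ind_proj_inclusion:
  assumes pos: "\<And>r. 0 < r \<Longrightarrow> 0 < \<beta> r" "\<And>r. 0 < r \<Longrightarrow> 0 < \<alpha> r"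
    and inc: "\<And>a b. 0 < a \<Longrightarrow> 0 < b \<Longrightarrow> embeds (ell p (\<omega> b (\<alpha> a))) (ell q (\<omega> (\<beta> b) a))"
  shows "embeds (proj_ind p \<omega>) (proj_ind q \<omega>)"
    and "embeds (ind_proj p \<omega>) (ind_proj q \<omega>)"
proof -
  have ne: "{0<..} \<noteq> ({} :: real set)" by simp
  show "embeds (proj_ind p \<omega>) (proj_ind q \<omega>)"
    unfolding proj_ind_def
  proof (rule proj_lim_inclusion[OF ne ne], intro bexI)
    fix a :: real assume a: "a \<in> {0<..}"
    show "embeds (ind_lim {0<..} (\<lambda>b. ell p (\<omega> b (\<alpha> a)))) (ind_lim {0<..} (\<lambda>b. ell q (\<omega> b a)))"
    proof (rule ind_lim_inclusion, intro bexI)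
      fix b :: real assume "b \<in> {0<..}"
      then show "embeds (ell p (\<omega> b (\<alpha> a))) (ell q (\<omega> (\<beta> b) a))" "\<beta> b \<in> {0<..}"
        using a inc pos by auto
    qed simp_all
    show "\<alpha> a \<in> {0<..}" using a pos by simp
  qed
  show "embeds (ind_proj p \<omega>) (ind_proj q \<omega>)"
    unfolding ind_proj_def
  proof (rule ind_lim_inclusion, intro bexI)
    fix b :: real assume b: "b \<in> {0<..}"
    show "embeds (proj_lim {0<..} (\<lambda>a. ell p (\<omega> b a))) (proj_lim {0<..} (\<lambda>a. ell q (\<omega> (\<beta> b) a)))"
    proof (rule proj_lim_inclusion[OF ne ne], intro bexI)
      fix a :: real assume "a \<in> {0<..}"
      then show "embeds (ell p (\<omega> b (\<alpha> a))) (ell q (\<omega> (\<beta> b) a))" "\<alpha> a \<in> {0<..}"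
        using b inc pos by auto
    qed
    show "\<beta> b \<in> {0<..}" using b pos by simp
  qed (simp_all add: topspace_proj_lim[OF ne])
qed

context weight_system
begin

lemma limits_eq_sup:
  assumes p: "0 < p"
  shows "proj_ind p \<omega> = proj_ind \<infinity> \<omega>" and "ind_proj p \<omega> = ind_proj \<infinity> \<omega>"
proof -
  have sup: "embeds (ell p (\<omega> b a)) (ell \<infinity> (\<omega> b a))" for b a
    using ell_inclusion_sup[OF p] .
  have "proj_ind p \<omega> = proj_ind \<infinity> \<omega> \<and> ind_proj p \<omega> = ind_proj \<infinity> \<omega>" if ninf: "p \<noteq> \<infinity>"
  proof -
    obtain \<beta> \<alpha> where "\<And>r. 0 < r \<Longrightarrow> 0 < \<beta> r" "\<And>r. 0 < r \<Longrightarrow> 0 < \<alpha> r"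
      "\<And>a b. 0 < a \<Longrightarrow> 0 < b \<Longrightarrow> embeds (ell \<infinity> (\<omega> b (\<alpha> a))) (ell p (\<omega> (\<beta> b) a))"
      using ell_inclusion_nuclear[OF p ninf] by blast
    note into = proj_ind_ind_proj_inclusion[of \<beta> \<alpha> \<infinity> \<omega> p, OF this]
    have "embeds (proj_ind p \<omega>) (proj_ind \<infinity> \<omega>)" "embeds (ind_proj p \<omega>) (ind_proj \<infinity> \<omega>)"
      using proj_ind_ind_proj_inclusion[of "\<lambda>r. r" "\<lambda>r. r" p \<omega> \<infinity>] sup by simp_all
    with into show ?thesis by (intro conjI topology_eqI_inclusions)
  qed
  then show "proj_ind p \<omega> = proj_ind \<infinity> \<omega>" "ind_proj p \<omega> = ind_proj \<infinity> \<omega>" by (cases "p = \<infinity>"; simp)+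
qed

lemma directed_b: "0 < b \<Longrightarrow> 0 < b' \<Longrightarrow> \<exists>b''>0. \<forall>a>0. \<forall>i. \<omega> b'' a i \<le> \<omega> b a i \<and> \<omega> b'' a i \<le> \<omega> b' a i"
  using decreasing_chain_directed[of "{0<..} \<times> UNIV" "\<lambda>r (a, i). \<omega> r a i" b b'] cofinal by (simp add: Ball_def)

lemma sup_balls_iff: "(\<exists>W\<in>sup_balls w. W \<inter> ell_set \<infinity> w \<subseteq> V) \<longleftrightarrow> (\<exists>\<epsilon>>0. \<forall>x. sup_norm w x < \<epsilon> \<longrightarrow> x \<in> V)"
proof -
  have "x \<in> ell_set \<infinity> w" if "sup_norm w x < \<epsilon>" for x \<epsilon>
    using that by (auto simp: ell_set_def intro: less_le_trans)
  then show ?thesis unfolding sup_balls_def by (simp add: Bex_def) blast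
qed

lemma ell_set_mono: "(\<And>i. w i \<le> w' i) \<Longrightarrow> ell_set \<infinity> w' \<subseteq> ell_set \<infinity> w"
  using wnorm_sup_mono[of _ _ w w'] by (auto simp: ell_set_def intro: le_less_trans)

lemma lin_top_ind:
  assumes a: "0 < a"
  shows "lin_top (ind_lim {0<..} (\<lambda>b. ell \<infinity> (\<omega> b a))) (ind_set \<omega> a) (ind_nbhds \<omega> a)"
proof -
  have "lin_top (ind_lim {0<..} (\<lambda>b. ell \<infinity> (\<omega> b a))) (ind_set \<omega> a)
      {V. abs_convex V \<and> (\<forall>b\<in>{0<..}. \<exists>W\<in>sup_balls (\<omega> b a). W \<inter> ell_set \<infinity> (\<omega> b a) \<subseteq> V)}"
  proof (rule lin_top_ind_lim)
    fix b b' :: real assume "b \<in> {0<..}" "b' \<in> {0<..}"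
    then obtain k where k: "k > 0" "\<forall>a>0. \<forall>i. \<omega> k a i \<le> \<omega> b a i \<and> \<omega> k a i \<le> \<omega> b' a i"
      using directed_b[of b b'] by auto
    then show "\<exists>k\<in>{0<..}. ell_set \<infinity> (\<omega> b a) \<subseteq> ell_set \<infinity> (\<omega> k a) \<and> ell_set \<infinity> (\<omega> b' a) \<subseteq> ell_set \<infinity> (\<omega> k a)"
      using a by (intro bexI[of _ k] conjI ell_set_mono) auto
  qed (simp, rule lin_top_ell_sup)
  then show ?thesis unfolding sup_balls_iff ind_nbhds_def by (simp add: Ball_def)
qed

lemma lin_top_proj_ind: "lin_top (proj_ind \<infinity> \<omega>) (proj_ind_set \<omega>) (proj_ind_nbhds \<omega>)"
  unfolding proj_ind_def proj_ind_set_def proj_ind_nbhds_def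
proof (rule lin_top_proj_lim)
  fix a a' :: real assume a: "a \<in> {0<..}" "a' \<in> {0<..}"
  then obtain k where k: "k > 0" "\<And>b i. 0 < b \<Longrightarrow> \<omega> b a i \<le> \<omega> b k i \<and> \<omega> b a' i \<le> \<omega> b k i"
    using directed[of a a'] by auto
  have "ind_nbhds \<omega> c \<subseteq> ind_nbhds \<omega> k" if c: "\<And>b i. 0 < b \<Longrightarrow> \<omega> b c i \<le> \<omega> b k i" for c
  proof -
    have le: "sup_norm (\<omega> b c) x \<le> sup_norm (\<omega> b k) x" if "0 < b" for b x
      by (rule wnorm_sup_mono) (use c that in auto)
    have "\<exists>\<epsilon>>0. \<forall>x. sup_norm (\<omega> b k) x < \<epsilon> \<longrightarrow> x \<in> V"
      if "0 < b" "\<exists>\<epsilon>>0. \<forall>x. sup_norm (\<omega> b c) x < \<epsilon> \<longrightarrow> x \<in> V" for b V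
      using that(2) le_less_trans[OF le[OF that(1)]] by meson
    then show ?thesis unfolding ind_nbhds_def by (simp add: Collect_mono_iff)
  qed
  then have "ind_nbhds \<omega> a \<subseteq> ind_nbhds \<omega> k" "ind_nbhds \<omega> a' \<subseteq> ind_nbhds \<omega> k" using k(2) by blast+
  then show "\<exists>k\<in>{0<..}. (\<forall>V\<in>ind_nbhds \<omega> a. \<exists>W\<in>ind_nbhds \<omega> k. W \<inter> ind_set \<omega> k \<subseteq> V) \<and>
      (\<forall>V\<in>ind_nbhds \<omega> a'. \<exists>W\<in>ind_nbhds \<omega> k. W \<inter> ind_set \<omega> k \<subseteq> V)"
    using k(1) by (intro bexI[of _ k] conjI ballI) (auto intro!: bexI Int_lower1)
qed (simp, rule lin_top_ind, simp)

lemma lin_top_proj: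
  assumes b: "0 < b"
  shows "lin_top (proj_lim {0<..} (\<lambda>a. ell \<infinity> (\<omega> b a))) (\<Inter>a\<in>{0<..}. ell_set \<infinity> (\<omega> b a)) (\<Union>a\<in>{0<..}. sup_balls (\<omega> b a))"
proof (rule lin_top_proj_lim)
  fix a a' :: real assume "a \<in> {0<..}" "a' \<in> {0<..}"
  then obtain k where k: "k > 0" "\<And>i. \<omega> b a i \<le> \<omega> b k i \<and> \<omega> b a' i \<le> \<omega> b k i"
    using directed[of a a'] b by auto
  have *: "\<exists>W\<in>sup_balls (\<omega> b k). W \<inter> ell_set \<infinity> (\<omega> b k) \<subseteq> V"
    if c: "\<And>i. \<omega> b c i \<le> \<omega> b k i" and V: "V \<in> sup_balls (\<omega> b c)" for c V
  proof -
    have le: "sup_norm (\<omega> b c) x \<le> sup_norm (\<omega> b k) x" for x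
      by (rule wnorm_sup_mono) (use c in auto)
    obtain e where "e > 0" "V = {x. sup_norm (\<omega> b c) x < e}" using V by (auto simp: sup_balls_def)
    then show ?thesis unfolding sup_balls_iff using le_less_trans[OF le] by (intro exI[of _ e]) simp
  qed
  show "\<exists>k\<in>{0<..}. (\<forall>V\<in>sup_balls (\<omega> b a). \<exists>W\<in>sup_balls (\<omega> b k). W \<inter> ell_set \<infinity> (\<omega> b k) \<subseteq> V) \<and>
      (\<forall>V\<in>sup_balls (\<omega> b a'). \<exists>W\<in>sup_balls (\<omega> b k). W \<inter> ell_set \<infinity> (\<omega> b k) \<subseteq> V)"
    by (intro bexI[of _ k] conjI ballI *) (simp_all add: k)
qed (simp, rule lin_top_ell_sup)

lemma lin_top_ind_proj: "lin_top (ind_proj \<infinity> \<omega>) (ind_proj_set \<omega>) (ind_proj_nbhds \<omega>)"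
proof -
  let ?E = "\<lambda>b. \<Inter>a\<in>{0<..}. ell_set \<infinity> (\<omega> b a)"
  have "lin_top (ind_proj \<infinity> \<omega>) (ind_proj_set \<omega>)
      {V. abs_convex V \<and> (\<forall>b\<in>{0<..}. \<exists>W\<in>(\<Union>a\<in>{0<..}. sup_balls (\<omega> b a)). W \<inter> ?E b \<subseteq> V)}"
    unfolding ind_proj_def ind_proj_set_def
  proof (rule lin_top_ind_lim)
    fix b b' :: real assume "b \<in> {0<..}" "b' \<in> {0<..}"
    then obtain k where k: "k > 0" "\<forall>a>0. \<forall>i. \<omega> k a i \<le> \<omega> b a i \<and> \<omega> k a i \<le> \<omega> b' a i"
      using directed_b[of b b'] by auto
    then have "ell_set \<infinity> (\<omega> b a) \<subseteq> ell_set \<infinity> (\<omega> k a)" "ell_set \<infinity> (\<omega> b' a) \<subseteq> ell_set \<infinity> (\<omega> k a)" if "0 < a" for a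
      using that by (intro ell_set_mono; simp)+
    then show "\<exists>k\<in>{0<..}. ?E b \<subseteq> ?E k \<and> ?E b' \<subseteq> ?E k"
      using k(1) by (intro bexI[of _ k] conjI INT_anti_mono) auto
  qed (simp, rule lin_top_proj, simp)
  also have "{V. abs_convex V \<and> (\<forall>b\<in>{0<..}. \<exists>W\<in>(\<Union>a\<in>{0<..}. sup_balls (\<omega> b a)). W \<inter> ?E b \<subseteq> V)} = ind_proj_nbhds \<omega>"
  proof -
    have "(\<exists>W\<in>(\<Union>a\<in>{0<..}. sup_balls (\<omega> b a)). W \<inter> ?E b \<subseteq> V) \<longleftrightarrow>
        (\<exists>a>0. \<exists>\<epsilon>>0. \<forall>x. (\<forall>a'>0. sup_norm (\<omega> b a') x < \<infinity>) \<longrightarrow> sup_norm (\<omega> b a) x < \<epsilon> \<longrightarrow> x \<in> V)" for b V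
    proof -
      have "{x. sup_norm (\<omega> b a) x < \<epsilon>} \<inter> ?E b \<subseteq> V \<longleftrightarrow>
          (\<forall>x. (\<forall>a'>0. sup_norm (\<omega> b a') x < \<infinity>) \<longrightarrow> sup_norm (\<omega> b a) x < \<epsilon> \<longrightarrow> x \<in> V)" for a \<epsilon>
        by (auto simp: ell_set_def subset_iff)
      moreover have "(\<exists>W\<in>(\<Union>a\<in>{0<..}. sup_balls (\<omega> b a)). P W) \<longleftrightarrow>
          (\<exists>a>0. \<exists>\<epsilon>>0. P {x. sup_norm (\<omega> b a) x < \<epsilon>})" for P
        unfolding sup_balls_def by (auto simp: Bex_def)
      ultimately show ?thesis by presburger
    qed
    then show ?thesis unfolding ind_proj_nbhds_def by (simp add: Ball_def)
  qed
  finally show ?thesis .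
qed

lemma ind_proj_set_subset: "ind_proj_set \<omega> \<subseteq> proj_ind_set \<omega>"
  unfolding ind_proj_set_def proj_ind_set_def by blast

end

section \<open>Truncations and coordinates\<close>

lemma abs_convex_coordinate: "abs_convex {x. norm (x i) < e}"
proof -
  let ?w = "\<lambda>j. if j = i then 1 else 0 :: ennreal"
  have "sup_norm ?w x = ennreal (norm (x i))" for x
  proof (rule antisym)
    show "sup_norm ?w x \<le> ennreal (norm (x i))" by (rule wnorm_sup_least) simp
    show "ennreal (norm (x i)) \<le> sup_norm ?w x" using wnorm_sup_upper[of x i ?w] by simp
  qed
  then have "{x. norm (x i) < e} = {x. sup_norm ?w x < ennreal e}" by (simp add: ennreal_less_iff)
  then show ?thesis using abs_convex_sup_ball by simp
qed

lemma norm_coordinate_less: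
  assumes "sup_norm w x < ennreal e * w i"
  shows "norm (x i) < e"
proof (rule ccontr)
  assume "\<not> norm (x i) < e"
  then have "ennreal e * w i \<le> ennreal (norm (x i)) * w i" by (intro mult_right_mono ennreal_leI) auto
  also have "\<dots> \<le> sup_norm w x" by (rule wnorm_sup_upper)
  finally show False using assms by simp
qed

lemma continuous_map_coordinate:
  assumes X: "lin_top X E \<V>" and V: "\<And>e. 0 < e \<Longrightarrow> {x. norm (x i) < e} \<in> \<V>"
  shows "continuous_map X euclidean (\<lambda>x. x i)"
  unfolding continuous_map_def topspace_lin_top[OF X]
proof (intro conjI allI impI)
  fix U :: "complex set" assume "openin euclidean U"
  then have U: "open U" by simp
  show "openin X {x \<in> E. x i \<in> U}"
    unfolding lin_topD(7)[OF X]
  proof (intro conjI ballI)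
    fix c assume "c \<in> {x \<in> E. x i \<in> U}"
    then obtain e where e: "0 < e" "\<And>z. dist z (c i) < e \<Longrightarrow> z \<in> U"
      using U unfolding open_dist by blast
    then have "{x \<in> E. x - c \<in> {x. norm (x i) < e}} \<subseteq> {x \<in> E. x i \<in> U}"
      by (auto simp: dist_norm)
    then show "\<exists>V\<in>\<V>. {x \<in> E. x - c \<in> V} \<subseteq> {x \<in> E. x i \<in> U}"
      using V[OF e(1)] by (rule bexI)
  qed blast
qed simp

definition truncate :: "'i set \<Rightarrow> ('i \<Rightarrow> complex) \<Rightarrow> 'i \<Rightarrow> complex" where
  "truncate S x = (\<lambda>i. if i \<in> S then x i else 0)"

lemma wnorm_truncate_le:
  "sup_norm w (truncate S x) \<le> sup_norm w x" "sup_norm w (truncate S x - x) \<le> sup_norm w x"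
  by (rule wnorm_sup_mono; simp add: truncate_def)+

lemma eventually_tail_less:
  fixes h :: "'i \<Rightarrow> real"
  assumes h: "h summable_on UNIV" "\<And>i. 0 \<le> h i" and d: "0 < d"
  shows "eventually (\<lambda>S. \<forall>i. i \<notin> S \<longrightarrow> h i < d) (finite_subsets_at_top UNIV)"
proof -
  have "(sum h \<longlongrightarrow> infsum h UNIV) (finite_subsets_at_top UNIV)"
    using has_sum_infsum[OF h(1)] by (simp add: has_sum_def)
  then have "eventually (\<lambda>S. dist (sum h S) (infsum h UNIV) < d) (finite_subsets_at_top UNIV)"
    using d by (rule tendstoD)
  then have "eventually (\<lambda>S. finite S \<and> dist (sum h S) (infsum h UNIV) < d) (finite_subsets_at_top UNIV)"
    using eventually_finite_subsets_at_top_weakI[of UNIV "finite"] by (auto intro: eventually_conj)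
  then show ?thesis
  proof (rule eventually_mono, intro allI impI)
    fix S i assume S: "finite S \<and> dist (sum h S) (infsum h UNIV) < d" and i: "i \<notin> S"
    have "h i + sum h S = sum h (insert i S)" using S i by simp
    also have "\<dots> \<le> infsum h UNIV"
      using S h by (intro finite_sum_le_infsum) auto
    finally show "h i < d" using S unfolding dist_real_def by linarith
  qed
qed

lemma ennreal_small_multiple:
  fixes M \<epsilon> :: ennreal
  assumes "M < \<infinity>" "0 < \<epsilon>"
  obtains d where "0 < d" "ennreal d * M < \<epsilon>"
proof -
  obtain m where m: "M = ennreal m" "0 \<le> m" using assms(1) by (cases M) auto
  show ?thesis
  proof (cases \<epsilon>)
    case (real e)
    then have e: "0 < e" using assms(2) by simp
    have "ennreal (e / (m + 1)) * M = ennreal (e / (m + 1) * m)"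
      unfolding m(1) using m e by (intro ennreal_mult[symmetric]) auto
    also have "\<dots> < \<epsilon>" using m e real by (auto simp: ennreal_less_iff field_simps)
    finally show ?thesis using that[of "e / (m + 1)"] e m by simp
  next
    case top
    then show ?thesis using that[of 1] assms(1) by simp
  qed
qed

lemma wnorm_truncate_diff_le:
  assumes le: "\<And>i. w' i \<le> ennreal (h i) * w i" and S: "\<forall>i. i \<notin> S \<longrightarrow> h i < d"
  shows "sup_norm w' (truncate S x - x) \<le> ennreal d * sup_norm w x"
proof (rule wnorm_sup_least)
  fix i
  show "ennreal (norm ((truncate S x - x) i)) * w' i \<le> ennreal d * sup_norm w x"
  proof (cases "i \<in> S")
    case False
    then have "ennreal (norm ((truncate S x - x) i)) * w' i = ennreal (norm (x i)) * w' i"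
      by (simp add: truncate_def)
    also have "\<dots> \<le> ennreal (norm (x i)) * (ennreal (h i) * w i)"
      by (intro mult_left_mono le) simp
    also have "\<dots> = ennreal (h i) * (ennreal (norm (x i)) * w i)" by (simp add: ac_simps)
    also have "\<dots> \<le> ennreal d * sup_norm w x"
      using S False by (intro mult_mono wnorm_sup_upper ennreal_leI) (auto simp: less_imp_le)
    finally show ?thesis .
  qed (simp add: truncate_def)
qed

lemma eventually_truncate_small:
  assumes h: "\<And>i. 0 < h i" "h summable_on UNIV" "\<And>i. w' i \<le> ennreal (h i) * w i"
    and x: "sup_norm w x < \<infinity>" and e: "0 < \<epsilon>"
  shows "eventually (\<lambda>S. sup_norm w' (truncate S x - x) < \<epsilon>) (finite_subsets_at_top UNIV)"
proof -
  obtain d where d: "0 < d" "ennreal d * sup_norm w x < \<epsilon>"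
    by (rule ennreal_small_multiple[OF x e])
  have "eventually (\<lambda>S. \<forall>i. i \<notin> S \<longrightarrow> h i < d) (finite_subsets_at_top UNIV)"
    using h(1) by (intro eventually_tail_less h(2) d(1)) (simp add: less_imp_le)
  then show ?thesis
    by (rule eventually_mono) (rule le_less_trans[OF wnorm_truncate_diff_le[OF h(3)] d(2)])
qed

context weight_system
begin

lemma coordinate_mem_nbhds:
  assumes e: "0 < e"
  shows "{x. norm (x i) < e} \<in> proj_ind_nbhds \<omega>" "{x. norm (x i) < e} \<in> ind_proj_nbhds \<omega>"
proof -
  obtain a where a: "a > 0" "\<And>b. 0 < b \<Longrightarrow> 0 < \<omega> b a i" using positive by blast
  have *: "0 < ennreal e * \<omega> b a i" if "0 < b" for b
    using a(2)[OF that] e by (simp add: ennreal_zero_less_mult_iff)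
  have **: "norm (x i) < e" if "sup_norm (\<omega> b a) x < ennreal e * \<omega> b a i" for x b
    using norm_coordinate_less[OF that] .
  have "{x. norm (x i) < e} \<in> ind_nbhds \<omega> a"
    unfolding ind_nbhds_def mem_Collect_eq
  proof (intro conjI allI impI)
    show "\<exists>\<epsilon>>0. \<forall>x. sup_norm (\<omega> b a) x < \<epsilon> \<longrightarrow> norm (x i) < e" if "0 < b" for b
      using *[OF that] ** by (intro exI[of _ "ennreal e * \<omega> b a i"]) simp
  qed (rule abs_convex_coordinate)
  then show "{x. norm (x i) < e} \<in> proj_ind_nbhds \<omega>"
    unfolding proj_ind_nbhds_def using a(1) by (intro UN_I[of a]) simp_all
  show "{x. norm (x i) < e} \<in> ind_proj_nbhds \<omega>"
    unfolding ind_proj_nbhds_def mem_Collect_eq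
  proof (intro conjI allI impI)
    show "\<exists>a>0. \<exists>\<epsilon>>0. \<forall>x. (\<forall>a'>0. sup_norm (\<omega> b a') x < \<infinity>) \<longrightarrow> sup_norm (\<omega> b a) x < \<epsilon> \<longrightarrow> norm (x i) < e"
      if "0 < b" for b
      using *[OF that] ** a(1) by (intro exI[of _ a] conjI exI[of _ "ennreal e * \<omega> b a i"]) simp_all
  qed (rule abs_convex_coordinate)
qed

lemma finite_support_mem_ind_proj_set:
  assumes "finite {i. K i \<noteq> 0}"
  shows "K \<in> ind_proj_set \<omega>"
proof -
  have "\<exists>b>0. \<forall>a>0. \<forall>i\<in>S. \<omega> b a i < \<infinity>" if "finite S" for S
    using that
  proof (induction S rule: finite_induct)
    case empty
    show ?case by (intro exI[of _ 1]) simp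
  next
    case (insert j S)
    obtain b where b: "b > 0" "\<forall>a>0. \<forall>i\<in>S. \<omega> b a i < \<infinity>" using insert.IH by blast
    obtain b' where b': "b' > 0" "\<forall>a>0. \<omega> b' a j < \<infinity>" using finite_weight by blast
    obtain b'' where b'': "b'' > 0" "\<forall>a>0. \<forall>i. \<omega> b'' a i \<le> \<omega> b a i \<and> \<omega> b'' a i \<le> \<omega> b' a i"
      using directed_b[OF b(1) b'(1)] by blast
    have "\<omega> b'' a i < \<infinity>" if "0 < a" "i \<in> insert j S" for a i
      using that b(2) b'(2) b''(2) by (metis insert_iff le_less_trans)
    then show ?case using b''(1) by blast
  qed
  then obtain b where b: "b > 0" "\<forall>a>0. \<forall>i\<in>{i. K i \<noteq> 0}. \<omega> b a i < \<infinity>" using assms by blast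
  have "sup_norm (\<omega> b a) K < \<infinity>" if "0 < a" for a
  proof -
    have "sup_norm (\<omega> b a) K \<le> (\<Sum>i\<in>{i. K i \<noteq> 0}. ennreal (norm (K i)) * \<omega> b a i)"
    proof (rule wnorm_sup_least)
      fix i
      show "ennreal (norm (K i)) * \<omega> b a i \<le> (\<Sum>i\<in>{i. K i \<noteq> 0}. ennreal (norm (K i)) * \<omega> b a i)"
        by (cases "K i = 0") (auto intro!: member_le_sum[of i] assms)
    qed
    also have "\<dots> < \<infinity>" using b(2) that by (simp add: ennreal_mult_less_top assms)
    finally show ?thesis .
  qed
  then show ?thesis using b(1) by (auto simp: ind_proj_set_def ell_set_def)
qed

lemma nuclear_summable:
  "\<exists>\<beta> \<alpha>. (\<forall>r>0. 0 < \<beta> r \<and> 0 < \<alpha> r) \<and> (\<forall>b>0. \<forall>a>0. \<exists>h. (\<forall>i. 0 < h i) \<and> h summable_on UNIV \<and>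
      (\<forall>i. \<omega> (\<beta> b) a i \<le> ennreal (h i) * \<omega> b (\<alpha> a) i))"
proof -
  obtain \<beta> \<alpha> where ba: "\<forall>r>0. 0 < \<beta> r \<and> 0 < \<alpha> r" "\<forall>b>0. \<forall>a>0. \<exists>h. (\<forall>i. 0 < h i) \<and>
      (\<lambda>i. h i powr 1) summable_on UNIV \<and> (\<forall>i. \<omega> (\<beta> b) a i \<le> ennreal (h i) * \<omega> b (\<alpha> a) i)"
    using nuclear[of 1] by auto
  have "\<exists>h. (\<forall>i. 0 < h i) \<and> h summable_on UNIV \<and> (\<forall>i. \<omega> (\<beta> b) a i \<le> ennreal (h i) * \<omega> b (\<alpha> a) i)"
    if ab: "0 < b" "0 < a" for b a
  proof -
    obtain h where h: "\<forall>i. 0 < h i" "(\<lambda>i. h i powr 1) summable_on UNIV"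
      "\<forall>i. \<omega> (\<beta> b) a i \<le> ennreal (h i) * \<omega> b (\<alpha> a) i"
      using ba(2)[rule_format, OF ab] by blast
    have "(\<lambda>i. h i powr 1) = h" using h(1) by (auto simp: less_imp_le)
    then show ?thesis using h by (intro exI[of _ h]) simp
  qed
  then show ?thesis using ba(1) by (intro exI[of _ \<beta>] exI[of _ \<alpha>]) simp
qed

lemma wnorm_sup_finite_nuclear:
  assumes h: "h summable_on UNIV" "\<And>i. (0::real) < h i" "\<And>i. w' i \<le> ennreal (h i) * w i"
    and x: "sup_norm w x < \<infinity>"
  shows "sup_norm w' x < \<infinity>"
proof -
  have "sup_norm w' (truncate {} x - x) \<le> ennreal (infsum h UNIV + 1) * sup_norm w x"
  proof (rule wnorm_truncate_diff_le[OF h(3)], intro allI impI)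
    fix i
    have "h i \<le> infsum h UNIV"
      using finite_sum_le_infsum[OF h(1), of "{i}"] h(2) by (simp add: less_imp_le)
    then show "h i < infsum h UNIV + 1" by simp
  qed
  also have "\<dots> < \<infinity>" using x by (simp add: ennreal_mult_less_top)
  finally have "sup_norm w' (truncate {} x - x) < \<infinity>" .
  moreover have "sup_norm w' x \<le> sup_norm w' (truncate {} x - x)"
    by (rule wnorm_sup_mono) (auto simp: truncate_def)
  ultimately show ?thesis by (rule le_less_trans[rotated])
qed

lemma limitin_truncate_proj_ind:
  assumes x: "x \<in> proj_ind_set \<omega>"
  shows "limitin (proj_ind \<infinity> \<omega>) (\<lambda>S. truncate S x) x (finite_subsets_at_top UNIV)"
  unfolding limitin_lin_top[OF lin_top_proj_ind]
proof (intro conjI ballI x)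
  fix V assume "V \<in> proj_ind_nbhds \<omega>"
  then obtain a where a: "0 < a" and V: "\<And>b. 0 < b \<Longrightarrow> \<exists>\<epsilon>>0. \<forall>x. sup_norm (\<omega> b a) x < \<epsilon> \<longrightarrow> x \<in> V"
    by (auto simp: proj_ind_nbhds_def ind_nbhds_def)
  obtain \<beta> \<alpha> where *: "\<forall>r>0. 0 < \<beta> r \<and> 0 < \<alpha> r" "\<forall>b>0. \<forall>a>0. \<exists>h. (\<forall>i. 0 < h i) \<and>
      h summable_on UNIV \<and> (\<forall>i. \<omega> (\<beta> b) a i \<le> ennreal (h i) * \<omega> b (\<alpha> a) i)"
    using nuclear_summable by (elim exE conjE)
  note ba = *(1)[rule_format, THEN conjunct1] *(1)[rule_format, THEN conjunct2] *(2)[rule_format]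
  obtain b where b: "0 < b" "sup_norm (\<omega> b (\<alpha> a)) x < \<infinity>"
    using x ba(2)[OF a] by (auto simp: proj_ind_set_def ell_set_def)
  obtain h where h: "\<And>i. 0 < h i" "h summable_on UNIV" "\<And>i. \<omega> (\<beta> b) a i \<le> ennreal (h i) * \<omega> b (\<alpha> a) i"
    using ba(3)[OF b(1) a] by auto
  obtain e where e: "0 < e" "\<And>y. sup_norm (\<omega> (\<beta> b) a) y < e \<Longrightarrow> y \<in> V" using V[OF ba(1)[OF b(1)]] by auto
  have mem: "truncate S x \<in> proj_ind_set \<omega>" for S
    unfolding proj_ind_set_def ell_set_def
  proof (intro INT_I)
    fix a :: real assume "a \<in> {0<..}"
    then obtain b where "0 < b" "sup_norm (\<omega> b a) x < \<infinity>"
      using x by (auto simp: proj_ind_set_def ell_set_def)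
    then show "truncate S x \<in> (\<Union>b\<in>{0<..}. {c. sup_norm (\<omega> b a) c < \<infinity>})"
      using le_less_trans[OF wnorm_truncate_le(1)] by (intro UN_I[of b]) simp_all
  qed
  have "eventually (\<lambda>S. sup_norm (\<omega> (\<beta> b) a) (truncate S x - x) < e) (finite_subsets_at_top UNIV)"
    by (rule eventually_truncate_small[OF h b(2) e(1)])
  then show "eventually (\<lambda>S. truncate S x \<in> proj_ind_set \<omega> \<and> truncate S x - x \<in> V) (finite_subsets_at_top UNIV)"
    by (rule eventually_mono) (use e(2) mem in blast)
qed

lemma limitin_truncate_ind_proj:
  assumes x: "x \<in> ind_proj_set \<omega>"
  shows "limitin (ind_proj \<infinity> \<omega>) (\<lambda>S. truncate S x) x (finite_subsets_at_top UNIV)"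
  unfolding limitin_lin_top[OF lin_top_ind_proj]
proof (intro conjI ballI x)
  fix V assume V: "V \<in> ind_proj_nbhds \<omega>"
  obtain \<beta> \<alpha> where *: "\<forall>r>0. 0 < \<beta> r \<and> 0 < \<alpha> r" "\<forall>b>0. \<forall>a>0. \<exists>h. (\<forall>i. 0 < h i) \<and>
      h summable_on UNIV \<and> (\<forall>i. \<omega> (\<beta> b) a i \<le> ennreal (h i) * \<omega> b (\<alpha> a) i)"
    using nuclear_summable by (elim exE conjE)
  note ba = *(1)[rule_format, THEN conjunct1] *(1)[rule_format, THEN conjunct2] *(2)[rule_format]
  obtain b where b: "0 < b" "\<And>a. 0 < a \<Longrightarrow> sup_norm (\<omega> b a) x < \<infinity>"
    using x by (auto simp: ind_proj_set_def ell_set_def)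
  obtain a e where a: "0 < a" and e: "0 < e" "\<And>y. (\<And>a'. 0 < a' \<Longrightarrow> sup_norm (\<omega> (\<beta> b) a') y < \<infinity>) \<Longrightarrow>
      sup_norm (\<omega> (\<beta> b) a) y < e \<Longrightarrow> y \<in> V"
    using V ba(1)[OF b(1)] unfolding ind_proj_nbhds_def by auto
  obtain h where h: "\<And>i. 0 < h i" "h summable_on UNIV" "\<And>i. \<omega> (\<beta> b) a i \<le> ennreal (h i) * \<omega> b (\<alpha> a) i"
    using ba(3)[OF b(1) a] by auto
  have fin: "sup_norm (\<omega> (\<beta> b) a') (truncate S x - x) < \<infinity>" if a': "0 < a'" for a' S
  proof -
    obtain h where h: "\<And>i. 0 < h i" "h summable_on UNIV" "\<And>i. \<omega> (\<beta> b) a' i \<le> ennreal (h i) * \<omega> b (\<alpha> a') i"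
      using ba(3)[OF b(1) a'] by auto
    have "sup_norm (\<omega> (\<beta> b) a') x < \<infinity>"
      by (rule wnorm_sup_finite_nuclear[OF h(2,1,3) b(2)[OF ba(2)[OF a']]])
    then show ?thesis using le_less_trans[OF wnorm_truncate_le(2)] by simp
  qed
  have mem: "truncate S x \<in> ind_proj_set \<omega>" for S
    using b(1) le_less_trans[OF wnorm_truncate_le(1) b(2)]
    unfolding ind_proj_set_def ell_set_def by (intro UN_I[of b]) auto
  have "eventually (\<lambda>S. sup_norm (\<omega> (\<beta> b) a) (truncate S x - x) < e) (finite_subsets_at_top UNIV)"
    by (rule eventually_truncate_small[OF h b(2)[OF ba(2)[OF a]] e(1)])
  then show "eventually (\<lambda>S. truncate S x \<in> ind_proj_set \<omega> \<and> truncate S x - x \<in> V) (finite_subsets_at_top UNIV)"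
    by (rule eventually_mono) (use e(2) mem fin in blast)
qed

end

section \<open>Convergent sequences and bicontinuity\<close>

lemma ennreal_uniform_scale:
  fixes S :: "ennreal set"
  assumes "finite S" "\<And>t. t \<in> S \<Longrightarrow> 0 < t"
  shows "\<exists>C::real. 0 < C \<and> (\<forall>t\<in>S. 1 < ennreal C * t)"
  using assms
proof (induction S rule: finite_induct)
  case empty
  show ?case by (intro exI[of _ 1]) simp
next
  case (insert t S)
  obtain C where C: "0 < C" "\<forall>t\<in>S. 1 < ennreal C * t" using insert.IH insert.prems by auto
  have "0 < t" using insert.prems by simp
  obtain D where D: "0 < D" "1 < ennreal D * t"
  proof (cases t)
    case (real r)
    then have "0 < r" using \<open>0 < t\<close> by simp
    then have "ennreal (2 / r) * t = 2" using real by (simp flip: ennreal_mult'')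
    then show ?thesis using that[of "2 / r"] \<open>0 < r\<close> by simp
  next
    case top
    then show ?thesis using that[of 1] by simp
  qed
  have "1 < ennreal (max C D) * s" if "s \<in> insert t S" for s
  proof (cases "s = t")
    case True
    have "ennreal D * t \<le> ennreal (max C D) * t" by (intro mult_right_mono ennreal_leI) auto
    then show ?thesis using True D(2) by (auto intro: less_le_trans)
  next
    case False
    then have "1 < ennreal C * s" using C(2) that by simp
    moreover have "ennreal C * s \<le> ennreal (max C D) * s" by (intro mult_right_mono ennreal_leI) auto
    ultimately show ?thesis by (rule less_le_trans)
  qed
  then show ?case using C(1) by (intro exI[of _ "max C D"]) auto
qed

lemma abs_convex_pointwise_bound: "abs_convex {x. \<forall>i. \<exists>k. ennreal (norm (x i)) * v k i \<le> 1}"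
  unfolding abs_convex_def
proof (intro ballI allI impI)
  fix x y :: "_ \<Rightarrow> complex" and a b :: complex
  assume x: "x \<in> {x. \<forall>i. \<exists>k. ennreal (norm (x i)) * v k i \<le> 1}"
    and y: "y \<in> {x. \<forall>i. \<exists>k. ennreal (norm (x i)) * v k i \<le> 1}" and ab: "norm a + norm b \<le> 1"
  have "\<exists>k. ennreal (norm (a * x i + b * y i)) * v k i \<le> 1" for i
  proof -
    obtain k k' where k: "ennreal (norm (x i)) * v k i \<le> 1" "ennreal (norm (y i)) * v k' i \<le> 1"
      using x y by blast
    obtain j where j: "ennreal (norm (x i)) * v j i \<le> 1" "ennreal (norm (y i)) * v j i \<le> 1"
    proof (cases "v k i \<le> v k' i")
      case True
      then have "ennreal (norm (y i)) * v k i \<le> ennreal (norm (y i)) * v k' i" by (intro mult_left_mono) auto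
      then show ?thesis using that k order_trans by blast
    next
      case False
      then have "ennreal (norm (x i)) * v k' i \<le> ennreal (norm (x i)) * v k i" by (intro mult_left_mono) auto
      then show ?thesis using that k order_trans by blast
    qed
    have "norm (a * x i + b * y i) \<le> norm a * norm (x i) + norm b * norm (y i)"
      by (metis norm_mult norm_triangle_ineq)
    then have "ennreal (norm (a * x i + b * y i)) * v j i \<le>
        ennreal (norm a * norm (x i) + norm b * norm (y i)) * v j i"
      by (intro mult_right_mono ennreal_leI) auto
    also have "\<dots> = ennreal (norm a) * (ennreal (norm (x i)) * v j i) + ennreal (norm b) * (ennreal (norm (y i)) * v j i)"
      by (simp add: ennreal_plus ennreal_mult distrib_right mult.assoc)
    also have "\<dots> \<le> ennreal (norm a) * 1 + ennreal (norm b) * 1"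
      by (intro add_mono mult_left_mono j) auto
    also have "\<dots> = ennreal (norm a + norm b)" by (simp add: ennreal_plus)
    also have "\<dots> \<le> 1" using ennreal_leI[OF ab] by simp
    finally show ?thesis by blast
  qed
  then show "(\<lambda>i. a * x i + b * y i) \<in> {x. \<forall>i. \<exists>k. ennreal (norm (x i)) * v k i \<le> 1}" by blast
qed

context weight_system
begin

text \<open>If the tails were unbounded in every step, one could pick indices \<open>n\<^sub>m\<close>, \<open>i\<^sub>m\<close> that witness this in
  step \<open>m\<close>; the constants \<open>C\<^sub>k\<close> below only have to handle the finitely many \<open>m < k\<close>, and produce a
  neighbourhood of zero missed by every chosen term.\<close>

lemma limitin_proj_ind_bounded_diff:
  assumes lim: "limitin (proj_ind \<infinity> \<omega>) x l sequentially" and a: "0 < a"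
  shows "\<exists>b>0. \<exists>n0. \<forall>n\<ge>n0. sup_norm (\<omega> b a) (x n - l) \<le> 1"
proof (rule ccontr)
  assume neg: "\<not> ?thesis"
  obtain s :: "nat \<Rightarrow> real" where s: "\<And>k. 0 < s k" "\<And>k a i. 0 < a \<Longrightarrow> \<omega> (s (Suc k)) a i \<le> \<omega> (s k) a i"
      "\<And>b. 0 < b \<Longrightarrow> \<exists>k. \<forall>a>0. \<forall>i. \<omega> (s k) a i \<le> \<omega> b a i"
    using cofinal by blast
  have dec: "\<omega> (s k) a i \<le> \<omega> (s j) a i" if "j \<le> k" for i j k
    using lift_Suc_antimono_le[of "\<lambda>k. \<omega> (s k) a i", OF s(2)[OF a] that] .
  define y where "y n = x n - l" for n
  have "\<exists>n i. m \<le> n \<and> 1 < ennreal (norm (y n i)) * \<omega> (s m) a i" for m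
  proof -
    obtain n where "m \<le> n" "1 < sup_norm (\<omega> (s m) a) (y n)"
      using neg s(1)[of m] unfolding y_def by (auto simp: not_le)
    then show ?thesis unfolding wnorm_sup less_SUP_iff by blast
  qed
  then obtain n i where ni: "\<And>m. m \<le> n m" "\<And>m. 1 < ennreal (norm (y (n m) (i m))) * \<omega> (s m) a (i m)"
    by metis
  define t where "t m k = ennreal (norm (y (n m) (i m))) * \<omega> (s k) a (i m)" for m k
  have t_pos: "0 < t m k" for m k
  proof -
    have "0 < ennreal (norm (y (n m) (i m))) * \<omega> (s m) a (i m)" using ni(2)[of m] by (rule less_trans[rotated]) simp
    then have "0 < ennreal (norm (y (n m) (i m)))" "0 < \<omega> (s m) a (i m)"
      by (simp_all add: ennreal_zero_less_mult_iff)
    then show ?thesis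
      unfolding t_def using positive_indep[OF s(1) s(1) a, of m "i m" k] by (simp add: ennreal_zero_less_mult_iff)
  qed
  have "\<exists>C::real. 0 < C \<and> (\<forall>m. 1 < ennreal C * t m k)" for k
  proof -
    obtain C :: real where C: "0 < C" "\<forall>u\<in>(\<lambda>m. t m k) ` {..<k}. 1 < ennreal C * u"
      using ennreal_uniform_scale[of "(\<lambda>m. t m k) ` {..<k}"] t_pos by auto
    have "1 < ennreal (max C 1) * t m k" for m
    proof (cases "m < k")
      case True
      then have "1 < ennreal C * t m k" using C(2) by simp
      also have "\<dots> \<le> ennreal (max C 1) * t m k" by (intro mult_right_mono ennreal_leI) auto
      finally show ?thesis .
    next
      case False
      then have "t m m \<le> t m k" unfolding t_def by (intro mult_left_mono dec) auto
      then have "1 < t m k" using ni(2)[of m] unfolding t_def by (rule less_le_trans[rotated])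
      also have "t m k = 1 * t m k" by simp
      also have "\<dots> \<le> ennreal (max C 1) * t m k"
        using ennreal_leI[of 1 "max C 1"] by (intro mult_right_mono) auto
      finally show ?thesis .
    qed
    then show ?thesis by (intro exI[of _ "max C 1"]) auto
  qed
  then obtain C :: "nat \<Rightarrow> real" where C: "\<And>k. 0 < C k" "\<And>k m. 1 < ennreal (C k) * t m k" by metis
  define V where "V = {x :: 'i \<Rightarrow> complex. \<forall>i. \<exists>k. ennreal (norm (x i)) * (ennreal (C k) * \<omega> (s k) a i) \<le> 1}"
  have "V \<in> ind_nbhds \<omega> a"
    unfolding ind_nbhds_def mem_Collect_eq
  proof (intro conjI allI impI)
    show "abs_convex V" unfolding V_def by (rule abs_convex_pointwise_bound)
    fix b :: real assume "0 < b"
    then obtain k where k: "\<And>i. \<omega> (s k) a i \<le> \<omega> b a i" using s(3) a by blast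
    have "x \<in> V" if x: "sup_norm (\<omega> b a) x < ennreal (1 / C k)" for x
    proof -
      have "ennreal (norm (x i)) * (ennreal (C k) * \<omega> (s k) a i) \<le> 1" for i
      proof -
        have "ennreal (norm (x i)) * (ennreal (C k) * \<omega> (s k) a i) = ennreal (C k) * (ennreal (norm (x i)) * \<omega> (s k) a i)"
          by (simp add: ac_simps)
        also have "\<dots> \<le> ennreal (C k) * (ennreal (norm (x i)) * \<omega> b a i)"
          by (intro mult_left_mono k) auto
        also have "\<dots> \<le> ennreal (C k) * ennreal (1 / C k)"
          using order_trans[OF wnorm_sup_upper less_imp_le[OF x]] by (intro mult_left_mono) auto
        also have "\<dots> = 1" using C(1)[of k] by (simp flip: ennreal_mult'')
        finally show ?thesis .
      qed
      then show ?thesis unfolding V_def by blast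
    qed
    then show "\<exists>\<epsilon>>0. \<forall>x. sup_norm (\<omega> b a) x < \<epsilon> \<longrightarrow> x \<in> V"
      using C(1)[of k] by (intro exI[of _ "ennreal (1 / C k)"]) auto
  qed
  then have "V \<in> proj_ind_nbhds \<omega>" unfolding proj_ind_nbhds_def using a by (intro UN_I[of a]) auto
  then have "eventually (\<lambda>n. x n \<in> proj_ind_set \<omega> \<and> x n - l \<in> V) sequentially"
    using lim unfolding limitin_lin_top[OF lin_top_proj_ind] by blast
  then obtain N where N: "\<And>m. N \<le> m \<Longrightarrow> y m \<in> V" unfolding eventually_sequentially y_def by blast
  then have "y (n N) \<in> V" using ni(1)[of N] by blast
  then obtain k where "ennreal (norm (y (n N) (i N))) * (ennreal (C k) * \<omega> (s k) a (i N)) \<le> 1"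
    unfolding V_def by blast
  then have "ennreal (C k) * t N k \<le> 1" unfolding t_def by (simp add: ac_simps)
  then show False using C(2)[of k N] by simp
qed

end

definition bicontinuous ::
  "'a topology \<Rightarrow> 'b topology \<Rightarrow> 'c topology \<Rightarrow> ('a \<Rightarrow> 'b \<Rightarrow> 'c) \<Rightarrow> bool" where
  "bicontinuous X Y Z \<Phi> \<longleftrightarrow>
     (\<forall>x\<in>topspace X. \<forall>y\<in>topspace Y. \<Phi> x y \<in> topspace Z) \<and>
     (\<forall>y\<in>topspace Y. continuous_map X Z (\<lambda>x. \<Phi> x y)) \<and>
     (\<forall>x\<in>topspace X. continuous_map Y Z (\<Phi> x)) \<and>
     (\<forall>x y l m. limitin X x l sequentially \<longrightarrow> limitin Y y m sequentially \<longrightarrow>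
        limitin Z (\<lambda>n. \<Phi> (x n) (y n)) (\<Phi> l m) sequentially)"

lemma bicontinuous_swap: "bicontinuous X Y Z \<Phi> \<Longrightarrow> bicontinuous Y X Z (\<lambda>y x. \<Phi> x y)"
  unfolding bicontinuous_def by simp

lemma bicontinuous_lin_top:
  assumes X: "lin_top X E1 \<V>1" and Y: "lin_top Y E2 \<V>2" and Z: "lin_top Z E3 \<V>3"
    and mem: "\<And>x y. x \<in> E1 \<Longrightarrow> y \<in> E2 \<Longrightarrow> \<Phi> x y \<in> E3"
    and diff_left: "\<And>x x' y. x \<in> E1 \<Longrightarrow> x' \<in> E1 \<Longrightarrow> y \<in> E2 \<Longrightarrow> \<Phi> (x - x') y = \<Phi> x y - \<Phi> x' y"
    and diff_right: "\<And>x y y'. x \<in> E1 \<Longrightarrow> y \<in> E2 \<Longrightarrow> y' \<in> E2 \<Longrightarrow> \<Phi> x (y - y') = \<Phi> x y - \<Phi> x y'"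
    and left: "\<And>y V. y \<in> E2 \<Longrightarrow> V \<in> \<V>3 \<Longrightarrow> \<exists>W\<in>\<V>1. \<forall>x\<in>W \<inter> E1. \<Phi> x y \<in> V"
    and equi: "\<And>x l V. limitin X x l sequentially \<Longrightarrow> V \<in> \<V>3 \<Longrightarrow>
      \<exists>n0. \<exists>W\<in>\<V>2. \<forall>n\<ge>n0. \<forall>y\<in>W \<inter> E2. \<Phi> (x n) y \<in> V"
  shows "bicontinuous X Y Z \<Phi>"
  unfolding bicontinuous_def topspace_lin_top[OF X] topspace_lin_top[OF Y] topspace_lin_top[OF Z]
proof (intro conjI ballI allI impI)
  show "\<Phi> x y \<in> E3" if "x \<in> E1" "y \<in> E2" for x y using mem that .
  show "continuous_map X Z (\<lambda>x. \<Phi> x y)" if y: "y \<in> E2" for y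
    by (rule continuous_map_lin_top[OF X Z]) (use mem diff_left left y in auto)
  show "continuous_map Y Z (\<Phi> x)" if x: "x \<in> E1" for x
  proof (rule continuous_map_lin_top[OF Y Z])
    fix V assume V: "V \<in> \<V>3"
    have "limitin X (\<lambda>n. x) x sequentially"
      using x by (simp add: limitin_def topspace_lin_top[OF X])
    from equi[OF this V] show "\<exists>W\<in>\<V>2. \<forall>y\<in>W \<inter> E2. \<Phi> x y \<in> V" by auto
  qed (use mem diff_right x in auto)
  fix x y l m assume x: "limitin X x l sequentially" and y: "limitin Y y m sequentially"
  have l: "l \<in> E1" and m: "m \<in> E2" using x y unfolding limitin_lin_top[OF X] limitin_lin_top[OF Y] by auto
  note E1 = lin_topD(1)[OF X] and E2 = lin_topD(1)[OF Y] and E3 = lin_topD(1)[OF Z]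
  show "limitin Z (\<lambda>n. \<Phi> (x n) (y n)) (\<Phi> l m) sequentially"
    unfolding limitin_lin_top[OF Z]
  proof (intro conjI ballI)
    show "\<Phi> l m \<in> E3" using mem l m .
    fix V assume V: "V \<in> \<V>3"
    obtain V' where V': "V' \<in> \<V>3" "\<forall>z\<in>V' \<inter> E3. \<forall>w\<in>V' \<inter> E3. (\<lambda>i. z i + w i) \<in> V"
      using lin_top_half[OF Z V] by blast
    obtain W1 where W1: "W1 \<in> \<V>1" "\<forall>x\<in>W1 \<inter> E1. \<Phi> x m \<in> V'" using left[OF m V'(1)] by blast
    obtain n0 W2 where W2: "W2 \<in> \<V>2" "\<forall>n\<ge>n0. \<forall>y\<in>W2 \<inter> E2. \<Phi> (x n) y \<in> V'" using equi[OF x V'(1)] by blast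
    have "eventually (\<lambda>n. x n \<in> E1 \<and> x n - l \<in> W1) sequentially"
      using x W1(1) unfolding limitin_lin_top[OF X] by blast
    moreover have "eventually (\<lambda>n. y n \<in> E2 \<and> y n - m \<in> W2) sequentially"
      using y W2(1) unfolding limitin_lin_top[OF Y] by blast
    ultimately show "eventually (\<lambda>n. \<Phi> (x n) (y n) \<in> E3 \<and> \<Phi> (x n) (y n) - \<Phi> l m \<in> V) sequentially"
      using eventually_ge_at_top[of n0]
    proof eventually_elim
      case (elim n)
      then have xn: "x n \<in> E1" and yn: "y n \<in> E2" by auto
      have "x n - l \<in> E1" "y n - m \<in> E2" using linear_set_diff E1 E2 xn yn l m by blast+
      then have "\<Phi> (x n) (y n - m) \<in> V' \<inter> E3" "\<Phi> (x n - l) m \<in> V' \<inter> E3"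
        using elim W1(2) W2(2) mem xn m by auto
      then have "(\<lambda>i. \<Phi> (x n) (y n - m) i + \<Phi> (x n - l) m i) \<in> V" using V'(2) by blast
      also have "(\<lambda>i. \<Phi> (x n) (y n - m) i + \<Phi> (x n - l) m i) = \<Phi> (x n) (y n) - \<Phi> l m"
        using diff_right[OF xn yn m] diff_left[OF xn l m] by (auto simp: fun_eq_iff)
      finally show ?case using mem[OF xn yn] by blast
    qed
  qed
qed

lemma ennreal_small_factor:
  fixes M \<epsilon> :: ennreal
  assumes "M < \<infinity>" "0 < \<epsilon>"
  shows "\<exists>\<delta>>0. \<forall>t<\<delta>. M * t < \<epsilon>"
proof -
  obtain d where d: "0 < d" "ennreal d * M < \<epsilon>" by (rule ennreal_small_multiple[OF assms])
  have "M * t < \<epsilon>" if "t < ennreal d" for t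
  proof -
    have "M * t \<le> ennreal d * M" using that by (subst mult.commute) (intro mult_left_mono, auto)
    then show ?thesis using d(2) by (rule le_less_trans)
  qed
  then show ?thesis using d(1) by (intro exI[of _ "ennreal d"]) auto
qed

context weight_system
begin

lemma ind_nbhds_saturated:
  assumes a: "0 < a" and V: "V \<in> ind_nbhds \<omega> a"
  shows "\<exists>W\<in>ind_nbhds \<omega> a. W \<subseteq> V \<and>
    (\<forall>z\<in>W. \<forall>w. (\<forall>i. (\<exists>b>0. 0 < \<omega> b a i) \<longrightarrow> w i = z i) \<longrightarrow> w \<in> W)"
proof -
  define W where "W = {w. \<exists>z. (\<lambda>i. 2 * z i) \<in> V \<and> (\<forall>i. (\<exists>b>0. 0 < \<omega> b a i) \<longrightarrow> w i = z i)}"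
  have V1: "abs_convex V" and V2: "\<And>b. 0 < b \<Longrightarrow> \<exists>\<epsilon>>0. \<forall>x. sup_norm (\<omega> b a) x < \<epsilon> \<longrightarrow> x \<in> V"
    using V by (simp_all add: ind_nbhds_def)
  have "abs_convex W"
    unfolding abs_convex_def
  proof (intro ballI allI impI)
    fix u v and \<kappa> \<mu> :: complex assume "u \<in> W" "v \<in> W" and ab: "norm \<kappa> + norm \<mu> \<le> 1"
    then obtain z z' where z: "(\<lambda>i. 2 * z i) \<in> V" "\<forall>i. (\<exists>b>0. 0 < \<omega> b a i) \<longrightarrow> u i = z i"
      "(\<lambda>i. 2 * z' i) \<in> V" "\<forall>i. (\<exists>b>0. 0 < \<omega> b a i) \<longrightarrow> v i = z' i"
      unfolding W_def by blast
    have "(\<lambda>i. 2 * (\<kappa> * z i + \<mu> * z' i)) \<in> V"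
      using abs_convex_combine[OF abs_convex_half[OF V1] _ _ ab, of z z'] z(1,3) by simp
    moreover have "\<forall>i. (\<exists>b>0. 0 < \<omega> b a i) \<longrightarrow> \<kappa> * u i + \<mu> * v i = \<kappa> * z i + \<mu> * z' i"
      using z(2,4) by auto
    ultimately show "(\<lambda>i. \<kappa> * u i + \<mu> * v i) \<in> W"
      unfolding W_def mem_Collect_eq by (intro exI[of _ "\<lambda>i. \<kappa> * z i + \<mu> * z' i"] conjI)
  qed
  moreover have "\<exists>\<epsilon>>0. \<forall>x. sup_norm (\<omega> b a) x < \<epsilon> \<longrightarrow> x \<in> W" if b: "0 < b" for b
  proof -
    obtain e where e: "0 < e" "\<forall>x. sup_norm (\<omega> b a) x < e \<longrightarrow> x \<in> V" using V2[OF b] by blast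
    have "x \<in> W" if "sup_norm (\<omega> b a) x < e / 2" for x
      using e(2) wnorm_sup_double[OF that] unfolding W_def by blast
    moreover have "0 < e / 2" using e(1) by (simp add: ennreal_zero_less_divide)
    ultimately show ?thesis by blast
  qed
  ultimately have "W \<in> ind_nbhds \<omega> a" unfolding ind_nbhds_def by blast
  moreover have "W \<subseteq> V"
  proof
    fix w assume "w \<in> W"
    then obtain z where z: "(\<lambda>i. 2 * z i) \<in> V" "\<And>i b. 0 < b \<Longrightarrow> 0 < \<omega> b a i \<Longrightarrow> w i = z i"
      unfolding W_def by blast
    obtain e where e: "0 < e" "\<forall>x. sup_norm (\<omega> 1 a) x < e \<longrightarrow> x \<in> V" using V2[of 1] by auto
    have "sup_norm (\<omega> 1 a) (\<lambda>i. 2 * (w i - z i)) = sup_norm (\<omega> 1 a) (\<lambda>i. 0)"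
      by (rule wnorm_sup_cong) (use z(2)[of 1] in simp)
    then have "(\<lambda>i. 2 * (w i - z i)) \<in> V" using e by simp
    then have "(\<lambda>i. 1 / 2 * (2 * z i) + 1 / 2 * (2 * (w i - z i))) \<in> V"
      by (rule abs_convex_combine[OF V1 z(1)]) simp
    then show "w \<in> V" by (simp add: diff_divide_distrib)
  qed
  moreover have "\<forall>z\<in>W. \<forall>w. (\<forall>i. (\<exists>b>0. 0 < \<omega> b a i) \<longrightarrow> w i = z i) \<longrightarrow> w \<in> W"
  proof (intro ballI allI impI)
    fix z w assume "z \<in> W" and eq: "\<forall>i. (\<exists>b>0. 0 < \<omega> b a i) \<longrightarrow> w i = z i"
    then obtain z' where "(\<lambda>i. 2 * z' i) \<in> V" "\<forall>i. (\<exists>b>0. 0 < \<omega> b a i) \<longrightarrow> z i = z' i"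
      unfolding W_def by blast
    then show "w \<in> W" using eq unfolding W_def mem_Collect_eq by (intro exI[of _ z']) simp
  qed
  ultimately show ?thesis by (intro bexI[of _ W] conjI)
qed

lemma directed_norms:
  assumes "0 < a" "0 < b" "0 < b'"
  shows "\<exists>k>0. \<forall>x. sup_norm (\<omega> k a) x \<le> sup_norm (\<omega> b a) x \<and> sup_norm (\<omega> k a) x \<le> sup_norm (\<omega> b' a) x"
proof -
  obtain k where "0 < k" "\<forall>a>0. \<forall>i. \<omega> k a i \<le> \<omega> b a i \<and> \<omega> k a i \<le> \<omega> b' a i"
    using directed_b[OF assms(2,3)] by blast
  then show ?thesis using assms(1) by (intro exI[of _ k] conjI allI wnorm_sup_mono) auto
qed

lemma common_step:
  assumes a: "0 < a" and x: "x \<in> ind_set \<omega> a" "x' \<in> ind_set \<omega> a"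
  shows "\<exists>b>0. sup_norm (\<omega> b a) x < \<infinity> \<and> sup_norm (\<omega> b a) x' < \<infinity>"
proof -
  obtain b b' where b: "0 < b" "sup_norm (\<omega> b a) x < \<infinity>" "0 < b'" "sup_norm (\<omega> b' a) x' < \<infinity>"
    using x by (auto simp: ell_set_def)
  show ?thesis using directed_norms[OF a b(1,3)] b(2,4) le_less_trans by blast
qed

lemma bounded_finite:
  assumes "finite F" "\<And>x. x \<in> F \<Longrightarrow> x \<in> proj_ind_set \<omega>" and a: "0 < a"
  shows "\<exists>b>0. \<exists>M<\<infinity>. \<forall>x\<in>F. sup_norm (\<omega> b a) x \<le> M"
  using assms(1,2)
proof (induction F rule: finite_induct)
  case empty
  show ?case by (intro exI[of _ 1] conjI exI[of _ 0]) simp_all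
next
  case (insert x F)
  obtain b M where b: "0 < b" "M < \<infinity>" "\<forall>x\<in>F. sup_norm (\<omega> b a) x \<le> M" using insert.IH insert.prems by blast
  obtain b' where b': "0 < b'" "sup_norm (\<omega> b' a) x < \<infinity>"
    using insert.prems[of x] a by (auto simp: proj_ind_set_def ell_set_def)
  obtain k where k: "0 < k" "\<forall>x. sup_norm (\<omega> k a) x \<le> sup_norm (\<omega> b a) x \<and> sup_norm (\<omega> k a) x \<le> sup_norm (\<omega> b' a) x"
    using directed_norms[OF a b(1) b'(1)] by blast
  have "\<forall>y\<in>insert x F. sup_norm (\<omega> k a) y \<le> max M (sup_norm (\<omega> b' a) x)"
    using b(3) k(2) by (auto simp: le_max_iff_disj intro: order_trans)
  moreover have "max M (sup_norm (\<omega> b' a) x) < \<infinity>" using b(2) b'(2) by simp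
  ultimately show ?case using k(1) by blast
qed

lemma limitin_proj_ind_bounded:
  assumes lim: "limitin (proj_ind \<infinity> \<omega>) x l sequentially"
  shows "\<exists>n0. (\<forall>n\<ge>n0. x n \<in> proj_ind_set \<omega>) \<and> (\<forall>a>0. \<exists>b>0. \<exists>M<\<infinity>. \<forall>n\<ge>n0. sup_norm (\<omega> b a) (x n) \<le> M)"
proof -
  have l: "l \<in> proj_ind_set \<omega>" and ev: "\<forall>V\<in>proj_ind_nbhds \<omega>. eventually (\<lambda>n. x n \<in> proj_ind_set \<omega> \<and> x n - l \<in> V) sequentially"
    using lim unfolding limitin_lin_top[OF lin_top_proj_ind] by blast+
  obtain V where "V \<in> proj_ind_nbhds \<omega>" using lin_topD(2)[OF lin_top_proj_ind] by blast
  then obtain n0 where n0: "\<And>n. n0 \<le> n \<Longrightarrow> x n \<in> proj_ind_set \<omega>"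
    using ev unfolding eventually_sequentially by blast
  have "\<exists>b>0. \<exists>M<\<infinity>. \<forall>n\<ge>n0. sup_norm (\<omega> b a) (x n) \<le> M" if a: "0 < a" for a
  proof -
    obtain b n1 where b: "0 < b" "\<And>n. n1 \<le> n \<Longrightarrow> sup_norm (\<omega> b a) (x n - l) \<le> 1"
      using limitin_proj_ind_bounded_diff[OF lim a] by blast
    have "\<exists>b>0. \<exists>M<\<infinity>. \<forall>y\<in>insert l (x ` {n0..<n1}). sup_norm (\<omega> b a) y \<le> M"
      by (rule bounded_finite[OF _ _ a]) (use n0 l in auto)
    then obtain b' M where b': "0 < b'" "M < \<infinity>" "\<forall>y\<in>insert l (x ` {n0..<n1}). sup_norm (\<omega> b' a) y \<le> M"
      by blast
    obtain k where k: "0 < k" "\<And>x. sup_norm (\<omega> k a) x \<le> sup_norm (\<omega> b a) x" "\<And>x. sup_norm (\<omega> k a) x \<le> sup_norm (\<omega> b' a) x"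
      using directed_norms[OF a b(1) b'(1)] by blast
    have "sup_norm (\<omega> k a) (x n) \<le> 1 + M" if n: "n0 \<le> n" for n
    proof (cases "n1 \<le> n")
      case True
      have "sup_norm (\<omega> k a) (x n) = sup_norm (\<omega> k a) (\<lambda>i. (x n - l) i + l i)" by simp
      also have "\<dots> \<le> sup_norm (\<omega> k a) (x n - l) + sup_norm (\<omega> k a) l" by (rule wnorm_sup_add)
      also have "\<dots> \<le> 1 + M"
        using order_trans[OF k(2) b(2)[OF True]] order_trans[OF k(3)] b'(3) by (intro add_mono) auto
      finally show ?thesis .
    next
      case False
      then have "sup_norm (\<omega> k a) (x n) \<le> M" using order_trans[OF k(3)] b'(3) n by simp
      also have "M \<le> 1 + M" by simp
      finally show ?thesis .
    qed
    moreover have "1 + M < \<infinity>" using b'(2) by simp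
    ultimately show ?thesis using k(1) by blast
  qed
  then show ?thesis using n0 by blast
qed

lemma ind_proj_setI: "0 < b \<Longrightarrow> (\<And>a. 0 < a \<Longrightarrow> sup_norm (\<omega> b a) x < \<infinity>) \<Longrightarrow> x \<in> ind_proj_set \<omega>"
  unfolding ind_proj_set_def ell_set_def by (intro UN_I[of b]) auto

lemma ind_proj_setE:
  assumes "x \<in> ind_proj_set \<omega>"
  obtains b where "0 < b" "\<And>a. 0 < a \<Longrightarrow> sup_norm (\<omega> b a) x < \<infinity>"
  using assms unfolding ind_proj_set_def ell_set_def by auto

lemma proj_ind_setE:
  assumes "x \<in> proj_ind_set \<omega>" "0 < a"
  obtains b where "0 < b" "sup_norm (\<omega> b a) x < \<infinity>"
  using assms unfolding proj_ind_set_def ell_set_def by auto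

lemma proj_ind_setI: "(\<And>a. 0 < a \<Longrightarrow> \<exists>b>0. sup_norm (\<omega> b a) x < \<infinity>) \<Longrightarrow> x \<in> proj_ind_set \<omega>"
  unfolding proj_ind_set_def ell_set_def by auto

lemma ind_set_Collect_mem_proj_ind_nbhds:
  assumes a: "0 < a"
    and combine: "\<And>x x' \<kappa> \<mu>. x \<in> ind_set \<omega> a \<Longrightarrow> x' \<in> ind_set \<omega> a \<Longrightarrow> P x \<Longrightarrow> P x' \<Longrightarrow>
      norm \<kappa> + norm \<mu> \<le> 1 \<Longrightarrow> P (\<lambda>i. \<kappa> * x i + \<mu> * x' i)"
    and small: "\<And>b. 0 < b \<Longrightarrow> \<exists>\<epsilon>>0. \<forall>x. sup_norm (\<omega> b a) x < \<epsilon> \<longrightarrow> P x"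
  shows "{x \<in> ind_set \<omega> a. P x} \<in> proj_ind_nbhds \<omega>"
proof -
  have "{x \<in> ind_set \<omega> a. P x} \<in> ind_nbhds \<omega> a"
  proof (rule ind_nbhdsI)
    show "abs_convex {x \<in> ind_set \<omega> a. P x}"
      unfolding abs_convex_def
      using combine linear_set_combine[OF lin_topD(1)[OF lin_top_ind[OF a]]] by simp
    fix b :: real assume b: "0 < b"
    then obtain e where e: "0 < e" "\<forall>x. sup_norm (\<omega> b a) x < e \<longrightarrow> P x" using small by blast
    have "x \<in> ind_set \<omega> a" if "sup_norm (\<omega> b a) x < e" for x
      using b less_le_trans[OF that, of \<infinity>] by (auto simp: ell_set_def)
    then show "\<exists>\<epsilon>>0. \<forall>x. sup_norm (\<omega> b a) x < \<epsilon> \<longrightarrow> x \<in> {x \<in> ind_set \<omega> a. P x}"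
      using e by (intro exI[of _ e]) simp
  qed
  then show ?thesis unfolding proj_ind_nbhds_def using a by (intro UN_I) auto
qed

lemma Collect_mem_ind_proj_nbhds:
  assumes combine: "\<And>x x' \<kappa> \<mu>. x \<in> ind_proj_set \<omega> \<Longrightarrow> x' \<in> ind_proj_set \<omega> \<Longrightarrow> P x \<Longrightarrow> P x' \<Longrightarrow>
      norm \<kappa> + norm \<mu> \<le> 1 \<Longrightarrow> P (\<lambda>i. \<kappa> * x i + \<mu> * x' i)"
    and small: "\<And>b. 0 < b \<Longrightarrow> \<exists>a>0. \<exists>\<epsilon>>0. \<forall>x.
      (\<forall>a'>0. sup_norm (\<omega> b a') x < \<infinity>) \<longrightarrow> sup_norm (\<omega> b a) x < \<epsilon> \<longrightarrow> P x"
  shows "{x \<in> ind_proj_set \<omega>. P x} \<in> ind_proj_nbhds \<omega>"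
proof (rule ind_proj_nbhdsI)
  show "abs_convex {x \<in> ind_proj_set \<omega>. P x}"
    unfolding abs_convex_def
    using combine linear_set_combine[OF lin_topD(1)[OF lin_top_ind_proj]] by simp
  fix b :: real assume b: "0 < b"
  then obtain a e where e: "0 < a" "0 < e" "\<forall>x. (\<forall>a'>0. sup_norm (\<omega> b a') x < \<infinity>) \<longrightarrow> sup_norm (\<omega> b a) x < e \<longrightarrow> P x"
    using small by blast
  then show "\<exists>a>0. \<exists>\<epsilon>>0. \<forall>x. (\<forall>a'>0. sup_norm (\<omega> b a') x < \<infinity>) \<longrightarrow> sup_norm (\<omega> b a) x < \<epsilon> \<longrightarrow>
      x \<in> {x \<in> ind_proj_set \<omega>. P x}"
    using ind_proj_setI[OF b] by (intro exI[of _ a] exI[of _ e] conjI) simp_all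
qed

lemma ind_nbhdsD: "V \<in> ind_nbhds \<omega> a \<Longrightarrow> 0 < b \<Longrightarrow> \<exists>\<epsilon>>0. \<forall>x. sup_norm (\<omega> b a) x < \<epsilon> \<longrightarrow> x \<in> V"
  by (simp add: ind_nbhds_def)

lemma ind_proj_nbhdsD: "V \<in> ind_proj_nbhds \<omega> \<Longrightarrow> 0 < b \<Longrightarrow> \<exists>a>0. \<exists>\<epsilon>>0. \<forall>x.
     (\<forall>a'>0. sup_norm (\<omega> b a') x < \<infinity>) \<longrightarrow> sup_norm (\<omega> b a) x < \<epsilon> \<longrightarrow> x \<in> V"
  by (simp add: ind_proj_nbhds_def)

end

section \<open>Bilinear maps bounded with respect to weights\<close>

text \<open>\<open>\<Phi>\<close> models a composition \<open>\<Sum>\<^sub>\<beta> x(\<alpha>, \<beta>) y(\<beta>, \<gamma>)\<close> that need not converge for all \<open>x\<close>, \<open>y\<close>; so it is only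
  assumed linear at those coordinates that the target weight does not annihilate.\<close>

locale bilinear_weights =
  A: weight_system A + B: weight_system B + G: weight_system G
  for A :: "real \<Rightarrow> real \<Rightarrow> 'i \<Rightarrow> ennreal" and B :: "real \<Rightarrow> real \<Rightarrow> 'j \<Rightarrow> ennreal"
    and G :: "real \<Rightarrow> real \<Rightarrow> 'k \<Rightarrow> ennreal" +
  fixes \<Phi> :: "('i \<Rightarrow> complex) \<Rightarrow> ('j \<Rightarrow> complex) \<Rightarrow> 'k \<Rightarrow> complex"
    and \<rho> :: "real \<Rightarrow> real" and C :: "real \<Rightarrow> real"
  assumes rho_pos: "0 < r2 \<Longrightarrow> 0 < \<rho> r2"
    and bound: "\<lbrakk>0 < r1; 0 < r2; 0 < r3; sup_norm (A r3 (\<rho> r2)) x < \<infinity>; sup_norm (B r2 r1) y < \<infinity>\<rbrakk> \<Longrightarrow>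
      sup_norm (G r3 r1) (\<Phi> x y) \<le> ennreal (C r2) * (sup_norm (A r3 (\<rho> r2)) x * sup_norm (B r2 r1) y)"
    and combine_left_at: "\<lbrakk>0 < r1; 0 < r2; 0 < r3; sup_norm (A r3 (\<rho> r2)) x < \<infinity>; sup_norm (A r3 (\<rho> r2)) x' < \<infinity>;
      sup_norm (B r2 r1) y < \<infinity>; 0 < G r3 r1 k\<rbrakk> \<Longrightarrow>
      \<Phi> (\<lambda>i. \<kappa> * x i + \<mu> * x' i) y k = \<kappa> * \<Phi> x y k + \<mu> * \<Phi> x' y k"
    and combine_right_at: "\<lbrakk>0 < r1; 0 < r2; 0 < r3; sup_norm (A r3 (\<rho> r2)) x < \<infinity>; sup_norm (B r2 r1) y < \<infinity>;
      sup_norm (B r2 r1) y' < \<infinity>; 0 < G r3 r1 k\<rbrakk> \<Longrightarrow>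
      \<Phi> x (\<lambda>j. \<kappa> * y j + \<mu> * y' j) k = \<kappa> * \<Phi> x y k + \<mu> * \<Phi> x y' k"
begin

abbreviation "normA r3 r2 \<equiv> sup_norm (A r3 (\<rho> r2))"
abbreviation "normB r2 r1 \<equiv> sup_norm (B r2 r1)"
abbreviation "normG r3 r1 \<equiv> sup_norm (G r3 r1)"

lemma bound_finite:
  assumes "0 < r1" "0 < r2" "0 < r3" "normA r3 r2 x < \<infinity>" "normB r2 r1 y < \<infinity>"
  shows "normG r3 r1 (\<Phi> x y) < \<infinity>"
proof -
  have "ennreal (C r2) * (normA r3 r2 x * normB r2 r1 y) < \<infinity>"
    using assms(4,5) by (simp add: ennreal_mult_less_top)
  with bound[OF assms] show ?thesis by (rule le_less_trans)
qed

lemma small_right: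
  assumes r: "0 < r1" "0 < r2" "0 < r3" and M: "M < \<infinity>" and e: "0 < \<epsilon>"
  shows "\<exists>\<delta>>0. \<forall>x y. normA r3 r2 x \<le> M \<longrightarrow> normB r2 r1 y < \<delta> \<longrightarrow> normG r3 r1 (\<Phi> x y) < \<epsilon>"
proof -
  have "ennreal (C r2) * M < \<infinity>" using M by (simp add: ennreal_mult_less_top)
  then obtain d where d: "0 < d" "\<forall>t<d. ennreal (C r2) * M * t < \<epsilon>" using ennreal_small_factor e by blast
  have "normG r3 r1 (\<Phi> x y) < \<epsilon>"
    if x: "normA r3 r2 x \<le> M" and y: "normB r2 r1 y < d" for x y
  proof -
    have "normG r3 r1 (\<Phi> x y) \<le> ennreal (C r2) * (normA r3 r2 x * normB r2 r1 y)"
      by (rule bound[OF r le_less_trans[OF x M] less_le_trans[OF y]]) simp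
    also have "\<dots> \<le> ennreal (C r2) * (M * normB r2 r1 y)"
      by (intro mult_left_mono mult_right_mono x) auto
    also have "\<dots> < \<epsilon>" using d(2) y by (simp add: mult.assoc)
    finally show ?thesis .
  qed
  then show ?thesis using d(1) by blast
qed

lemma small_left:
  assumes r: "0 < r1" "0 < r2" "0 < r3" and M: "M < \<infinity>" and e: "0 < \<epsilon>"
  shows "\<exists>\<delta>>0. \<forall>x y. normB r2 r1 y \<le> M \<longrightarrow> normA r3 r2 x < \<delta> \<longrightarrow> normG r3 r1 (\<Phi> x y) < \<epsilon>"
proof -
  have "ennreal (C r2) * M < \<infinity>" using M by (simp add: ennreal_mult_less_top)
  then obtain d where d: "0 < d" "\<forall>t<d. ennreal (C r2) * M * t < \<epsilon>" using ennreal_small_factor e by blast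
  have "normG r3 r1 (\<Phi> x y) < \<epsilon>"
    if y: "normB r2 r1 y \<le> M" and x: "normA r3 r2 x < d" for x y
  proof -
    have "normG r3 r1 (\<Phi> x y) \<le> ennreal (C r2) * (normA r3 r2 x * normB r2 r1 y)"
      by (rule bound[OF r less_le_trans[OF x] le_less_trans[OF y M]]) simp
    also have "\<dots> \<le> ennreal (C r2) * (normA r3 r2 x * M)"
      by (intro mult_left_mono y) auto
    also have "\<dots> = ennreal (C r2) * M * normA r3 r2 x" by (simp add: ac_simps)
    also have "\<dots> < \<epsilon>" using d(2) x by simp
    finally show ?thesis .
  qed
  then show ?thesis using d(1) by blast
qed

lemma combine_left:
  assumes x: "x \<in> proj_ind_set A" "x' \<in> proj_ind_set A" and y: "y \<in> proj_ind_set B"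
  shows "\<Phi> (\<lambda>i. \<kappa> * x i + \<mu> * x' i) y = (\<lambda>k. \<kappa> * \<Phi> x y k + \<mu> * \<Phi> x' y k)"
proof
  fix k
  obtain r1 where r1: "0 < r1" "\<And>r3. 0 < r3 \<Longrightarrow> 0 < G r3 r1 k" using G.positive by blast
  obtain r2 where r2: "0 < r2" "normB r2 r1 y < \<infinity>" using B.proj_ind_setE[OF y r1(1)] .
  have "x \<in> ind_set A (\<rho> r2)" "x' \<in> ind_set A (\<rho> r2)"
    using x rho_pos[OF r2(1)] unfolding proj_ind_set_def by blast+
  then obtain r3 where "0 < r3" "normA r3 r2 x < \<infinity>" "normA r3 r2 x' < \<infinity>"
    using A.common_step[OF rho_pos[OF r2(1)]] by blast
  then show "\<Phi> (\<lambda>i. \<kappa> * x i + \<mu> * x' i) y k = \<kappa> * \<Phi> x y k + \<mu> * \<Phi> x' y k"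
    using combine_left_at r1 r2 by blast
qed

lemma combine_right:
  assumes x: "x \<in> proj_ind_set A" and y: "y \<in> proj_ind_set B" "y' \<in> proj_ind_set B"
  shows "\<Phi> x (\<lambda>j. \<kappa> * y j + \<mu> * y' j) = (\<lambda>k. \<kappa> * \<Phi> x y k + \<mu> * \<Phi> x y' k)"
proof
  fix k
  obtain r1 where r1: "0 < r1" "\<And>r3. 0 < r3 \<Longrightarrow> 0 < G r3 r1 k" using G.positive by blast
  have "y \<in> ind_set B r1" "y' \<in> ind_set B r1"
    using y r1(1) unfolding proj_ind_set_def by blast+
  then obtain r2 where r2: "0 < r2" "normB r2 r1 y < \<infinity>" "normB r2 r1 y' < \<infinity>"
    using B.common_step[OF r1(1)] by blast
  obtain r3 where "0 < r3" "normA r3 r2 x < \<infinity>" using A.proj_ind_setE[OF x rho_pos[OF r2(1)]] .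
  then show "\<Phi> x (\<lambda>j. \<kappa> * y j + \<mu> * y' j) k = \<kappa> * \<Phi> x y k + \<mu> * \<Phi> x y' k"
    using combine_right_at r1 r2 by blast
qed

lemma diff_left:
  "x \<in> proj_ind_set A \<Longrightarrow> x' \<in> proj_ind_set A \<Longrightarrow> y \<in> proj_ind_set B \<Longrightarrow> \<Phi> (x - x') y = \<Phi> x y - \<Phi> x' y"
  using combine_left[of x x' y 1 "-1"] by (simp add: fun_diff_def)

lemma diff_right:
  "x \<in> proj_ind_set A \<Longrightarrow> y \<in> proj_ind_set B \<Longrightarrow> y' \<in> proj_ind_set B \<Longrightarrow> \<Phi> x (y - y') = \<Phi> x y - \<Phi> x y'"
  using combine_right[of x y y' 1 "-1"] by (simp add: fun_diff_def)

lemma bicontinuous_proj_ind_ind_proj: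
  "bicontinuous (proj_ind \<infinity> A) (ind_proj \<infinity> B) (ind_proj \<infinity> G) \<Phi>"
proof (rule bicontinuous_lin_top[OF A.lin_top_proj_ind B.lin_top_ind_proj G.lin_top_ind_proj])
  note sub = subsetD[OF B.ind_proj_set_subset]
  show "\<Phi> x y \<in> ind_proj_set G" if x: "x \<in> proj_ind_set A" and y: "y \<in> ind_proj_set B" for x y
  proof -
    obtain r2 where r2: "0 < r2" "\<And>r1. 0 < r1 \<Longrightarrow> normB r2 r1 y < \<infinity>" using B.ind_proj_setE[OF y] by blast
    obtain r3 where r3: "0 < r3" "normA r3 r2 x < \<infinity>" using A.proj_ind_setE[OF x rho_pos[OF r2(1)]] .
    show ?thesis by (rule G.ind_proj_setI[OF r3(1)]) (rule bound_finite[OF _ r2(1) r3 r2(2)])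
  qed
  show "\<Phi> (x - x') y = \<Phi> x y - \<Phi> x' y" if "x \<in> proj_ind_set A" "x' \<in> proj_ind_set A" "y \<in> ind_proj_set B" for x x' y
    using diff_left that sub by blast
  show "\<Phi> x (y - y') = \<Phi> x y - \<Phi> x y'" if "x \<in> proj_ind_set A" "y \<in> ind_proj_set B" "y' \<in> ind_proj_set B" for x y y'
    using diff_right that sub by blast
next
  fix y V assume y: "y \<in> ind_proj_set B" and V: "V \<in> ind_proj_nbhds G"
  obtain r2 where r2: "0 < r2" "\<And>r1. 0 < r1 \<Longrightarrow> normB r2 r1 y < \<infinity>" using B.ind_proj_setE[OF y] by blast
  note rho = rho_pos[OF r2(1)]
  have "{x \<in> ind_set A (\<rho> r2). \<Phi> x y \<in> V} \<in> proj_ind_nbhds A"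
  proof (rule A.ind_set_Collect_mem_proj_ind_nbhds[OF rho])
    fix x x' and \<kappa> \<mu> :: complex
    assume x: "x \<in> ind_set A (\<rho> r2)" "x' \<in> ind_set A (\<rho> r2)" "\<Phi> x y \<in> V" "\<Phi> x' y \<in> V" and 1: "norm \<kappa> + norm \<mu> \<le> 1"
    have "\<Phi> (\<lambda>i. \<kappa> * x i + \<mu> * x' i) y = (\<lambda>k. \<kappa> * \<Phi> x y k + \<mu> * \<Phi> x' y k)"
    proof
      fix k
      obtain r1 where r1: "0 < r1" "\<And>r3. 0 < r3 \<Longrightarrow> 0 < G r3 r1 k" using G.positive by blast
      obtain r3 where "0 < r3" "normA r3 r2 x < \<infinity>" "normA r3 r2 x' < \<infinity>"
        using A.common_step[OF rho x(1,2)] by blast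
      then show "\<Phi> (\<lambda>i. \<kappa> * x i + \<mu> * x' i) y k = \<kappa> * \<Phi> x y k + \<mu> * \<Phi> x' y k"
        using combine_left_at r1 r2 by blast
    qed
    then show "\<Phi> (\<lambda>i. \<kappa> * x i + \<mu> * x' i) y \<in> V"
      using abs_convex_combine[OF lin_topD(3)[OF G.lin_top_ind_proj V] x(3,4) 1] by simp
  next
    fix r3 :: real assume r3: "0 < r3"
    obtain r1 e where r1: "0 < r1" and e: "0 < e" "\<And>z. (\<forall>a'>0. sup_norm (G r3 a') z < \<infinity>) \<Longrightarrow> normG r3 r1 z < e \<Longrightarrow> z \<in> V"
      using G.ind_proj_nbhdsD[OF V r3] by blast
    obtain d where d: "0 < d" "\<And>x. normA r3 r2 x < d \<Longrightarrow> normG r3 r1 (\<Phi> x y) < e"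
      using small_left[OF r1 r2(1) r3 r2(2)[OF r1] e(1)] by blast
    have "\<Phi> x y \<in> V" if x: "normA r3 r2 x < d" for x
      using d(2)[OF x] bound_finite[OF _ r2(1) r3 less_le_trans[OF x] r2(2)] by (intro e(2)) auto
    then show "\<exists>\<epsilon>>0. \<forall>x. normA r3 r2 x < \<epsilon> \<longrightarrow> \<Phi> x y \<in> V" using d(1) by blast
  qed
  then show "\<exists>W\<in>proj_ind_nbhds A. \<forall>x\<in>W \<inter> proj_ind_set A. \<Phi> x y \<in> V" by (rule bexI[rotated]) simp
next
  note sub = subsetD[OF B.ind_proj_set_subset]
  fix x l V assume lim: "limitin (proj_ind \<infinity> A) x l sequentially" and V: "V \<in> ind_proj_nbhds G"
  obtain n0 where n0: "\<And>n. n0 \<le> n \<Longrightarrow> x n \<in> proj_ind_set A"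
    "\<And>a. 0 < a \<Longrightarrow> \<exists>b>0. \<exists>M<\<infinity>. \<forall>n\<ge>n0. sup_norm (A b a) (x n) \<le> M"
    using A.limitin_proj_ind_bounded[OF lim] by blast
  have "{y \<in> ind_proj_set B. \<forall>n\<ge>n0. \<Phi> (x n) y \<in> V} \<in> ind_proj_nbhds B"
  proof (rule B.Collect_mem_ind_proj_nbhds, intro allI impI)
    fix y y' n and \<kappa> \<mu> :: complex
    assume y: "y \<in> ind_proj_set B" "y' \<in> ind_proj_set B" "\<forall>n\<ge>n0. \<Phi> (x n) y \<in> V" "\<forall>n\<ge>n0. \<Phi> (x n) y' \<in> V"
      and 1: "norm \<kappa> + norm \<mu> \<le> 1" and n: "n0 \<le> n"
    show "\<Phi> (x n) (\<lambda>j. \<kappa> * y j + \<mu> * y' j) \<in> V"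
      unfolding combine_right[OF n0(1)[OF n] sub[OF y(1)] sub[OF y(2)]]
      using lin_topD(3)[OF G.lin_top_ind_proj V] y 1 n by (intro abs_convex_combine) auto
  next
    fix r2 :: real assume r2: "0 < r2"
    obtain r3 M where r3: "0 < r3" and M: "M < \<infinity>" "\<And>n. n0 \<le> n \<Longrightarrow> normA r3 r2 (x n) \<le> M"
      using n0(2)[OF rho_pos[OF r2]] by blast
    obtain r1 e where r1: "0 < r1" and e: "0 < e" "\<And>z. (\<forall>a'>0. sup_norm (G r3 a') z < \<infinity>) \<Longrightarrow> normG r3 r1 z < e \<Longrightarrow> z \<in> V"
      using G.ind_proj_nbhdsD[OF V r3] by blast
    obtain d where d: "0 < d" "\<And>x y. normA r3 r2 x \<le> M \<Longrightarrow> normB r2 r1 y < d \<Longrightarrow> normG r3 r1 (\<Phi> x y) < e"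
      using small_right[OF r1 r2 r3 M(1) e(1)] by blast
    have "\<Phi> (x n) y \<in> V" if y: "\<forall>a'>0. sup_norm (B r2 a') y < \<infinity>" "normB r2 r1 y < d" and n: "n0 \<le> n" for y n
    proof (rule e(2))
      show "normG r3 r1 (\<Phi> (x n) y) < e" using d(2)[OF M(2)[OF n] y(2)] .
      show "\<forall>a'>0. sup_norm (G r3 a') (\<Phi> (x n) y) < \<infinity>"
        using bound_finite[OF _ r2 r3 le_less_trans[OF M(2)[OF n] M(1)]] y(1) by blast
    qed
    then show "\<exists>a>0. \<exists>\<epsilon>>0. \<forall>y. (\<forall>a'>0. sup_norm (B r2 a') y < \<infinity>) \<longrightarrow> sup_norm (B r2 a) y < \<epsilon> \<longrightarrow> (\<forall>n\<ge>n0. \<Phi> (x n) y \<in> V)"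
      using r1 d(1) by blast
  qed
  then show "\<exists>n0. \<exists>W\<in>ind_proj_nbhds B. \<forall>n\<ge>n0. \<forall>y\<in>W \<inter> ind_proj_set B. \<Phi> (x n) y \<in> V"
    by (intro exI[of _ n0]) (rule bexI[rotated], auto)
qed

lemma bicontinuous_ind_proj_proj_ind:
  "bicontinuous (ind_proj \<infinity> A) (proj_ind \<infinity> B) (ind_proj \<infinity> G) \<Phi>"
proof -
  note sub = subsetD[OF A.ind_proj_set_subset]
  have "bicontinuous (proj_ind \<infinity> B) (ind_proj \<infinity> A) (ind_proj \<infinity> G) (\<lambda>y x. \<Phi> x y)"
  proof (rule bicontinuous_lin_top[OF B.lin_top_proj_ind A.lin_top_ind_proj G.lin_top_ind_proj])
    show mem: "\<Phi> x y \<in> ind_proj_set G" if y: "y \<in> proj_ind_set B" and x: "x \<in> ind_proj_set A" for x y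
    proof -
      obtain r3 where r3: "0 < r3" "\<And>a. 0 < a \<Longrightarrow> sup_norm (A r3 a) x < \<infinity>" using A.ind_proj_setE[OF x] by blast
      show ?thesis
      proof (rule G.ind_proj_setI[OF r3(1)])
        fix r1 :: real assume r1: "0 < r1"
        obtain r2 where r2: "0 < r2" "normB r2 r1 y < \<infinity>" using B.proj_ind_setE[OF y r1] .
        show "normG r3 r1 (\<Phi> x y) < \<infinity>"
          by (rule bound_finite[OF r1 r2(1) r3(1) r3(2)[OF rho_pos[OF r2(1)]] r2(2)])
      qed
    qed
    show "\<Phi> x (y - y') = \<Phi> x y - \<Phi> x y'" if "y \<in> proj_ind_set B" "y' \<in> proj_ind_set B" "x \<in> ind_proj_set A" for x y y'
      using diff_right that sub by blast
    show "\<Phi> (x - x') y = \<Phi> x y - \<Phi> x' y" if "y \<in> proj_ind_set B" "x \<in> ind_proj_set A" "x' \<in> ind_proj_set A" for x x' y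
      using diff_left that sub by blast
  next
    fix x V assume x: "x \<in> ind_proj_set A" and V: "V \<in> ind_proj_nbhds G"
    obtain r3 where r3: "0 < r3" "\<And>a. 0 < a \<Longrightarrow> sup_norm (A r3 a) x < \<infinity>" using A.ind_proj_setE[OF x] by blast
    obtain r1 e where r1: "0 < r1" and e: "0 < e" "\<And>z. (\<forall>a'>0. sup_norm (G r3 a') z < \<infinity>) \<Longrightarrow> normG r3 r1 z < e \<Longrightarrow> z \<in> V"
      using G.ind_proj_nbhdsD[OF V r3(1)] by blast
    let ?W = "{y \<in> ind_set B r1. normG r3 r1 (\<Phi> x y) < e}"
    have "?W \<in> proj_ind_nbhds B"
    proof (rule B.ind_set_Collect_mem_proj_ind_nbhds[OF r1])
      fix y y' and \<kappa> \<mu> :: complex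
      assume y: "y \<in> ind_set B r1" "y' \<in> ind_set B r1" "normG r3 r1 (\<Phi> x y) < e" "normG r3 r1 (\<Phi> x y') < e"
        and 1: "norm \<kappa> + norm \<mu> \<le> 1"
      obtain r2 where r2: "0 < r2" "normB r2 r1 y < \<infinity>" "normB r2 r1 y' < \<infinity>"
        using B.common_step[OF r1 y(1,2)] by blast
      have "normG r3 r1 (\<Phi> x (\<lambda>j. \<kappa> * y j + \<mu> * y' j)) =
          normG r3 r1 (\<lambda>k. \<kappa> * \<Phi> x y k + \<mu> * \<Phi> x y' k)"
        by (rule wnorm_sup_cong) (rule combine_right_at[OF r1 r2(1) r3(1) r3(2)[OF rho_pos[OF r2(1)]] r2(2,3)])
      also have "\<dots> < e"
        using abs_convex_combine[OF abs_convex_sup_ball _ _ 1, of "\<Phi> x y" "G r3 r1" e "\<Phi> x y'"] y(3,4) by simp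
      finally show "normG r3 r1 (\<Phi> x (\<lambda>j. \<kappa> * y j + \<mu> * y' j)) < e" .
    next
      fix r2 :: real assume r2: "0 < r2"
      show "\<exists>\<epsilon>>0. \<forall>y. normB r2 r1 y < \<epsilon> \<longrightarrow> normG r3 r1 (\<Phi> x y) < e"
        using small_right[OF r1 r2 r3(1) r3(2)[OF rho_pos[OF r2]] e(1)] by blast
    qed
    moreover have "\<Phi> x y \<in> V" if y: "y \<in> ?W" "y \<in> proj_ind_set B" for y
    proof (rule e(2))
      show "normG r3 r1 (\<Phi> x y) < e" using y(1) by simp
      show "\<forall>a'>0. sup_norm (G r3 a') (\<Phi> x y) < \<infinity>"
      proof (intro allI impI)
        fix a :: real assume a: "0 < a"
        obtain r2 where r2: "0 < r2" "sup_norm (B r2 a) y < \<infinity>" using B.proj_ind_setE[OF y(2) a] .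
        show "sup_norm (G r3 a) (\<Phi> x y) < \<infinity>"
          by (rule bound_finite[OF a r2(1) r3(1) r3(2)[OF rho_pos[OF r2(1)]] r2(2)])
      qed
    qed
    ultimately show "\<exists>W\<in>proj_ind_nbhds B. \<forall>y\<in>W \<inter> proj_ind_set B. \<Phi> x y \<in> V"
      by (intro bexI[of _ ?W]) blast+
  next
    fix y l V assume lim: "limitin (proj_ind \<infinity> B) y l sequentially" and V: "V \<in> ind_proj_nbhds G"
    obtain n0 where n0: "\<And>n. n0 \<le> n \<Longrightarrow> y n \<in> proj_ind_set B"
      "\<And>a. 0 < a \<Longrightarrow> \<exists>b>0. \<exists>M<\<infinity>. \<forall>n\<ge>n0. sup_norm (B b a) (y n) \<le> M"
      using B.limitin_proj_ind_bounded[OF lim] by blast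
    have "{x \<in> ind_proj_set A. \<forall>n\<ge>n0. \<Phi> x (y n) \<in> V} \<in> ind_proj_nbhds A"
    proof (rule A.Collect_mem_ind_proj_nbhds, intro allI impI)
      fix x x' n and \<kappa> \<mu> :: complex
      assume x: "x \<in> ind_proj_set A" "x' \<in> ind_proj_set A" "\<forall>n\<ge>n0. \<Phi> x (y n) \<in> V" "\<forall>n\<ge>n0. \<Phi> x' (y n) \<in> V"
        and 1: "norm \<kappa> + norm \<mu> \<le> 1" and n: "n0 \<le> n"
      show "\<Phi> (\<lambda>i. \<kappa> * x i + \<mu> * x' i) (y n) \<in> V"
        unfolding combine_left[OF sub[OF x(1)] sub[OF x(2)] n0(1)[OF n]]
        using lin_topD(3)[OF G.lin_top_ind_proj V] x 1 n by (intro abs_convex_combine) auto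
    next
      fix r3 :: real assume r3: "0 < r3"
      obtain r1 e where r1: "0 < r1" and e: "0 < e" "\<And>z. (\<forall>a'>0. sup_norm (G r3 a') z < \<infinity>) \<Longrightarrow> normG r3 r1 z < e \<Longrightarrow> z \<in> V"
        using G.ind_proj_nbhdsD[OF V r3] by blast
      obtain r2 M where r2: "0 < r2" and M: "M < \<infinity>" "\<And>n. n0 \<le> n \<Longrightarrow> normB r2 r1 (y n) \<le> M"
        using n0(2)[OF r1] by blast
      obtain d where d: "0 < d" "\<And>x y. normB r2 r1 y \<le> M \<Longrightarrow> normA r3 r2 x < d \<Longrightarrow> normG r3 r1 (\<Phi> x y) < e"
        using small_left[OF r1 r2 r3 M(1) e(1)] by blast
      have "\<Phi> x (y n) \<in> V" if x: "\<forall>a'>0. sup_norm (A r3 a') x < \<infinity>" "normA r3 r2 x < d" and n: "n0 \<le> n" for x n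
      proof (rule e(2))
        show "normG r3 r1 (\<Phi> x (y n)) < e" using d(2)[OF M(2)[OF n] x(2)] .
        show "\<forall>a'>0. sup_norm (G r3 a') (\<Phi> x (y n)) < \<infinity>"
        proof (intro allI impI)
          fix a :: real assume a: "0 < a"
          obtain r2 where r2: "0 < r2" "sup_norm (B r2 a) (y n) < \<infinity>" using B.proj_ind_setE[OF n0(1)[OF n] a] .
          show "sup_norm (G r3 a) (\<Phi> x (y n)) < \<infinity>"
            using bound_finite[OF a r2(1) r3 _ r2(2)] x(1) rho_pos[OF r2(1)] by blast
        qed
      qed
      then show "\<exists>a>0. \<exists>\<epsilon>>0. \<forall>x. (\<forall>a'>0. sup_norm (A r3 a') x < \<infinity>) \<longrightarrow> sup_norm (A r3 a) x < \<epsilon> \<longrightarrow> (\<forall>n\<ge>n0. \<Phi> x (y n) \<in> V)"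
        using rho_pos[OF r2] d(1) by blast
    qed
    then show "\<exists>n0. \<exists>W\<in>ind_proj_nbhds A. \<forall>n\<ge>n0. \<forall>x\<in>W \<inter> ind_proj_set A. \<Phi> x (y n) \<in> V"
      by (intro exI[of _ n0]) (rule bexI[rotated], auto)
  qed
  then show ?thesis by (rule bicontinuous_swap)
qed

lemma bicontinuous_proj_ind_proj_ind:
  "bicontinuous (proj_ind \<infinity> A) (proj_ind \<infinity> B) (proj_ind \<infinity> G) \<Phi>"
proof (rule bicontinuous_lin_top[OF A.lin_top_proj_ind B.lin_top_proj_ind G.lin_top_proj_ind])
  show "\<Phi> x y \<in> proj_ind_set G" if x: "x \<in> proj_ind_set A" and y: "y \<in> proj_ind_set B" for x y
  proof (rule G.proj_ind_setI)
    fix r1 :: real assume r1: "0 < r1"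
    obtain r2 where r2: "0 < r2" "normB r2 r1 y < \<infinity>" using B.proj_ind_setE[OF y r1] .
    obtain r3 where r3: "0 < r3" "normA r3 r2 x < \<infinity>" using A.proj_ind_setE[OF x rho_pos[OF r2(1)]] .
    show "\<exists>r3>0. normG r3 r1 (\<Phi> x y) < \<infinity>"
      using bound_finite[OF r1 r2(1) r3 r2(2)] r3(1) by blast
  qed
  show "\<Phi> (x - x') y = \<Phi> x y - \<Phi> x' y" if "x \<in> proj_ind_set A" "x' \<in> proj_ind_set A" "y \<in> proj_ind_set B" for x x' y
    using diff_left that .
  show "\<Phi> x (y - y') = \<Phi> x y - \<Phi> x y'" if "x \<in> proj_ind_set A" "y \<in> proj_ind_set B" "y' \<in> proj_ind_set B" for x y y'
    using diff_right that .
next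
  fix y V assume y: "y \<in> proj_ind_set B" and "V \<in> proj_ind_nbhds G"
  then obtain r1 where r1: "0 < r1" "V \<in> ind_nbhds G r1" unfolding proj_ind_nbhds_def by blast
  obtain V' where V': "V' \<in> ind_nbhds G r1" "V' \<subseteq> V"
    "\<forall>z\<in>V'. \<forall>w. (\<forall>i. (\<exists>b>0. 0 < G b r1 i) \<longrightarrow> w i = z i) \<longrightarrow> w \<in> V'"
    using G.ind_nbhds_saturated[OF r1] by (elim bexE conjE)
  have sat: "w \<in> V'" if "z \<in> V'" "\<And>i. \<exists>b>0. 0 < G b r1 i \<Longrightarrow> w i = z i" for w z
    using V'(3) that by simp
  obtain r2 where r2: "0 < r2" "normB r2 r1 y < \<infinity>" using B.proj_ind_setE[OF y r1(1)] .
  note rho = rho_pos[OF r2(1)]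
  have "{x \<in> ind_set A (\<rho> r2). \<Phi> x y \<in> V'} \<in> proj_ind_nbhds A"
  proof (rule A.ind_set_Collect_mem_proj_ind_nbhds[OF rho])
    fix x x' and \<kappa> \<mu> :: complex
    assume x: "x \<in> ind_set A (\<rho> r2)" "x' \<in> ind_set A (\<rho> r2)" "\<Phi> x y \<in> V'" "\<Phi> x' y \<in> V'" and 1: "norm \<kappa> + norm \<mu> \<le> 1"
    obtain r3 where r3: "0 < r3" "normA r3 r2 x < \<infinity>" "normA r3 r2 x' < \<infinity>"
      using A.common_step[OF rho x(1,2)] by blast
    have eq: "\<Phi> (\<lambda>i. \<kappa> * x i + \<mu> * x' i) y k = \<kappa> * \<Phi> x y k + \<mu> * \<Phi> x' y k" if "\<exists>b>0. 0 < G b r1 k" for k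
      using combine_left_at[OF r1(1) r2(1) r3 r2(2)] G.positive_indep[OF _ r3(1) r1(1)] that by blast
    have mem: "(\<lambda>k. \<kappa> * \<Phi> x y k + \<mu> * \<Phi> x' y k) \<in> V'"
      using V'(1) x 1 by (intro abs_convex_combine) (auto simp: ind_nbhds_def)
    show "\<Phi> (\<lambda>i. \<kappa> * x i + \<mu> * x' i) y \<in> V'" by (rule sat[OF mem]) (rule eq)
  next
    fix r3 :: real assume r3: "0 < r3"
    obtain e where e: "0 < e" "\<And>z. normG r3 r1 z < e \<Longrightarrow> z \<in> V'"
      using G.ind_nbhdsD[OF V'(1) r3] by blast
    then show "\<exists>\<epsilon>>0. \<forall>x. normA r3 r2 x < \<epsilon> \<longrightarrow> \<Phi> x y \<in> V'"
      using small_left[OF r1(1) r2(1) r3 r2(2) e(1)] by blast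
  qed
  then show "\<exists>W\<in>proj_ind_nbhds A. \<forall>x\<in>W \<inter> proj_ind_set A. \<Phi> x y \<in> V"
    by (rule bexI[rotated]) (use V'(2) in auto)
next
  fix x l V assume lim: "limitin (proj_ind \<infinity> A) x l sequentially" and "V \<in> proj_ind_nbhds G"
  then obtain r1 where r1: "0 < r1" "V \<in> ind_nbhds G r1" unfolding proj_ind_nbhds_def by blast
  obtain V' where V': "V' \<in> ind_nbhds G r1" "V' \<subseteq> V"
    "\<forall>z\<in>V'. \<forall>w. (\<forall>i. (\<exists>b>0. 0 < G b r1 i) \<longrightarrow> w i = z i) \<longrightarrow> w \<in> V'"
    using G.ind_nbhds_saturated[OF r1] by (elim bexE conjE)
  have sat: "w \<in> V'" if "z \<in> V'" "\<And>i. \<exists>b>0. 0 < G b r1 i \<Longrightarrow> w i = z i" for w z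
    using V'(3) that by simp
  obtain n0 where n0: "\<And>n. n0 \<le> n \<Longrightarrow> x n \<in> proj_ind_set A"
    "\<And>a. 0 < a \<Longrightarrow> \<exists>b>0. \<exists>M<\<infinity>. \<forall>n\<ge>n0. sup_norm (A b a) (x n) \<le> M"
    using A.limitin_proj_ind_bounded[OF lim] by blast
  have "{y \<in> ind_set B r1. \<forall>n\<ge>n0. \<Phi> (x n) y \<in> V'} \<in> proj_ind_nbhds B"
  proof (rule B.ind_set_Collect_mem_proj_ind_nbhds[OF r1(1)], intro allI impI)
    fix y y' n and \<kappa> \<mu> :: complex
    assume y: "y \<in> ind_set B r1" "y' \<in> ind_set B r1" "\<forall>n\<ge>n0. \<Phi> (x n) y \<in> V'" "\<forall>n\<ge>n0. \<Phi> (x n) y' \<in> V'"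
      and 1: "norm \<kappa> + norm \<mu> \<le> 1" and n: "n0 \<le> n"
    obtain r2 where r2: "0 < r2" "normB r2 r1 y < \<infinity>" "normB r2 r1 y' < \<infinity>"
      using B.common_step[OF r1(1) y(1,2)] by blast
    obtain r3 where r3: "0 < r3" "normA r3 r2 (x n) < \<infinity>"
      using A.proj_ind_setE[OF n0(1)[OF n] rho_pos[OF r2(1)]] .
    have eq: "\<Phi> (x n) (\<lambda>j. \<kappa> * y j + \<mu> * y' j) k = \<kappa> * \<Phi> (x n) y k + \<mu> * \<Phi> (x n) y' k" if "\<exists>b>0. 0 < G b r1 k" for k
      using combine_right_at[OF r1(1) r2(1) r3 r2(2,3)] G.positive_indep[OF _ r3(1) r1(1)] that by blast
    have mem: "(\<lambda>k. \<kappa> * \<Phi> (x n) y k + \<mu> * \<Phi> (x n) y' k) \<in> V'"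
      using V'(1) y 1 n by (intro abs_convex_combine) (auto simp: ind_nbhds_def)
    show "\<Phi> (x n) (\<lambda>j. \<kappa> * y j + \<mu> * y' j) \<in> V'" by (rule sat[OF mem]) (rule eq)
  next
    fix r2 :: real assume r2: "0 < r2"
    obtain r3 M where r3: "0 < r3" and M: "M < \<infinity>" "\<And>n. n0 \<le> n \<Longrightarrow> normA r3 r2 (x n) \<le> M"
      using n0(2)[OF rho_pos[OF r2]] by blast
    obtain e where e: "0 < e" "\<And>z. normG r3 r1 z < e \<Longrightarrow> z \<in> V'"
      using G.ind_nbhdsD[OF V'(1) r3] by blast
    obtain d where d: "0 < d" "\<And>x y. normA r3 r2 x \<le> M \<Longrightarrow> normB r2 r1 y < d \<Longrightarrow> normG r3 r1 (\<Phi> x y) < e"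
      using small_right[OF r1(1) r2 r3 M(1) e(1)] by blast
    show "\<exists>\<epsilon>>0. \<forall>y. normB r2 r1 y < \<epsilon> \<longrightarrow> (\<forall>n\<ge>n0. \<Phi> (x n) y \<in> V')"
      using e(2) d M(2) by blast
  qed
  then show "\<exists>n0. \<exists>W\<in>proj_ind_nbhds B. \<forall>n\<ge>n0. \<forall>y\<in>W \<inter> proj_ind_set B. \<Phi> (x n) y \<in> V"
    using V'(2) by (intro exI[of _ n0]) (rule bexI[rotated], auto)
qed

end

section \<open>Nuclear families of weights\<close>

abbreviation summable_gain :: "(real \<Rightarrow> 'm \<Rightarrow> ennreal) \<Rightarrow> real \<Rightarrow> real \<Rightarrow> bool" where
  "summable_gain w q r \<equiv> \<exists>r'>0. \<exists>h. (\<forall>m. 0 < h m) \<and> (\<lambda>m. h m powr q) summable_on UNIV \<and>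
     (\<forall>m. w r' m \<le> ennreal (h m) * w r m)"

definition nuclear_family :: "(real \<Rightarrow> 'm \<Rightarrow> ennreal) \<Rightarrow> bool" where
  "nuclear_family w \<longleftrightarrow>
     (\<exists>s::nat \<Rightarrow> real. (\<forall>k. 0 < s k) \<and> (\<forall>k m. w (s (Suc k)) m \<le> w (s k) m) \<and> (\<forall>r>0. \<exists>k. \<forall>m. w (s k) m \<le> w r m)) \<and>
     (\<forall>r>0. \<forall>m. 0 < w r m) \<and> (\<forall>m. \<exists>r>0. w r m < \<infinity>) \<and>
     (\<forall>q>0. \<forall>r>0. summable_gain w q r)"

definition quotient_weight ::
  "(real \<Rightarrow> 'm \<Rightarrow> ennreal) \<Rightarrow> (real \<Rightarrow> 'n \<Rightarrow> ennreal) \<Rightarrow> ('i \<Rightarrow> 'm) \<Rightarrow> ('i \<Rightarrow> 'n) \<Rightarrow> real \<Rightarrow> real \<Rightarrow> 'i \<Rightarrow> ennreal" where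
  "quotient_weight u v f g b a i = u b (f i) / v a (g i)"

lemma ennreal_inverse_antimono:
  fixes x y :: ennreal
  assumes "x \<le> y"
  shows "inverse y \<le> inverse x"
proof (cases "x = 0 \<or> y = top")
  case False
  then obtain r t where "x = ennreal r" "0 < r" "y = ennreal t" "0 \<le> t"
    using assms by (cases x; cases y) (auto simp: top_unique)
  with assms show ?thesis by (simp add: inverse_ennreal le_imp_inverse_le)
qed auto

lemma ennreal_inverse_le_scale:
  assumes h: "0 < h" and le: "x \<le> ennreal h * y"
  shows "inverse y \<le> ennreal h * inverse x"
proof -
  have "inverse y = ennreal h * (inverse (ennreal h) * inverse y)"
    using h by (simp add: inverse_ennreal flip: mult.assoc ennreal_mult'')
  also have "\<dots> = ennreal h * inverse (ennreal h * y)"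
    using h by (subst ennreal_inverse_mult') auto
  also have "\<dots> \<le> ennreal h * inverse x"
    by (intro mult_left_mono ennreal_inverse_antimono le) simp
  finally show ?thesis .
qed

lemma summable_on_times_inj:
  fixes F :: "'m \<Rightarrow> real" and H :: "'n \<Rightarrow> real" and f :: "'i \<Rightarrow> 'm" and g :: "'i \<Rightarrow> 'n"
  assumes inj: "inj (\<lambda>i. (f i, g i))"
    and F: "F summable_on UNIV" "\<And>m. 0 \<le> F m" and H: "H summable_on UNIV" "\<And>n. 0 \<le> H n"
  shows "(\<lambda>i. F (f i) * H (g i)) summable_on UNIV"
proof (rule nonneg_bdd_above_summable_on)
  show "bdd_above (sum (\<lambda>i. F (f i) * H (g i)) ` {S. S \<subseteq> UNIV \<and> finite S})"
  proof (rule bdd_aboveI2)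
    fix S :: "'i set" assume "S \<in> {S. S \<subseteq> UNIV \<and> finite S}"
    then have S: "finite S" by simp
    have "(\<Sum>i\<in>S. F (f i) * H (g i)) = (\<Sum>(m, n)\<in>(\<lambda>i. (f i, g i)) ` S. F m * H n)"
      using inj by (subst sum.reindex) (auto intro: inj_on_subset)
    also have "\<dots> \<le> (\<Sum>(m, n)\<in>f ` S \<times> g ` S. F m * H n)"
      using S F(2) H(2) by (intro sum_mono2) auto
    also have "\<dots> = (\<Sum>m\<in>f ` S. F m) * (\<Sum>n\<in>g ` S. H n)"
      by (simp add: sum_product sum.cartesian_product)
    also have "\<dots> \<le> infsum F UNIV * infsum H UNIV"
      using S F H by (intro mult_mono finite_sum_le_infsum sum_nonneg infsum_nonneg) auto
    finally show "(\<Sum>i\<in>S. F (f i) * H (g i)) \<le> infsum F UNIV * infsum H UNIV" .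
  qed
qed (use F(2) H(2) in simp)

lemma nuclear_familyD:
  assumes "nuclear_family w"
  shows "\<exists>s::nat \<Rightarrow> real. (\<forall>k. 0 < s k) \<and> (\<forall>k m. w (s (Suc k)) m \<le> w (s k) m) \<and> (\<forall>r>0. \<exists>k. \<forall>m. w (s k) m \<le> w r m)"
    and "\<And>r m. 0 < r \<Longrightarrow> 0 < w r m" and "\<And>m. \<exists>r>0. w r m < \<infinity>"
    and "\<And>q r. 0 < q \<Longrightarrow> 0 < r \<Longrightarrow> summable_gain w q r"
  using assms unfolding nuclear_family_def by simp_all

lemma weight_system_quotient:
  assumes u: "nuclear_family u" and v: "nuclear_family v" and inj: "inj (\<lambda>i. (f i, g i))"
  shows "weight_system (quotient_weight u v f g)"
proof
  obtain s :: "nat \<Rightarrow> real" where s: "\<And>k. 0 < s k" "\<And>k m. u (s (Suc k)) m \<le> u (s k) m"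
      "\<And>r. 0 < r \<Longrightarrow> \<exists>k. \<forall>m. u (s k) m \<le> u r m"
    using nuclear_familyD(1)[OF u] by blast
  have "\<exists>k. \<forall>a>0. \<forall>i. quotient_weight u v f g (s k) a i \<le> quotient_weight u v f g b a i" if "0 < b" for b
    using s(3)[OF that] unfolding quotient_weight_def by (meson divide_right_mono_ennreal)
  then show "\<exists>s::nat \<Rightarrow> real. (\<forall>k. 0 < s k) \<and>
      (\<forall>k. \<forall>a>0. \<forall>i. quotient_weight u v f g (s (Suc k)) a i \<le> quotient_weight u v f g (s k) a i) \<and>
      (\<forall>b>0. \<exists>k. \<forall>a>0. \<forall>i. quotient_weight u v f g (s k) a i \<le> quotient_weight u v f g b a i)"
    using s(1,2) by (intro exI[of _ s]) (simp add: quotient_weight_def divide_right_mono_ennreal)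
next
  fix a a' :: real assume "0 < a" "0 < a'"
  then obtain c where c: "0 < c" "\<forall>m. v c m \<le> v a m \<and> v c m \<le> v a' m"
    using decreasing_chain_directed[of UNIV v a a'] nuclear_familyD(1)[OF v] by auto
  then show "\<exists>a''>0. \<forall>b>0. \<forall>i. quotient_weight u v f g b a i \<le> quotient_weight u v f g b a'' i \<and>
      quotient_weight u v f g b a' i \<le> quotient_weight u v f g b a'' i"
    unfolding quotient_weight_def divide_ennreal_def
    by (intro exI[of _ c]) (auto intro!: mult_left_mono ennreal_inverse_antimono)
next
  fix i
  obtain a where "0 < a" "v a (g i) < \<infinity>" using nuclear_familyD(3)[OF v] by blast
  then show "\<exists>a>0. \<forall>b>0. 0 < quotient_weight u v f g b a i"
    using nuclear_familyD(2)[OF u] unfolding quotient_weight_def ennreal_zero_less_divide by auto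
  obtain b where "0 < b" "u b (f i) < \<infinity>" using nuclear_familyD(3)[OF u] by blast
  then have "\<forall>a>0. quotient_weight u v f g b a i < \<infinity>"
    using nuclear_familyD(2)[OF v] unfolding quotient_weight_def divide_ennreal_def
    by (auto simp: ennreal_mult_less_top less_top[symmetric] ennreal_mult_eq_top_iff zero_less_iff_neq_zero)
  then show "\<exists>b>0. \<forall>a>0. quotient_weight u v f g b a i < \<infinity>" using \<open>0 < b\<close> by blast
next
  fix b b' a :: real and i assume "0 < b" "0 < b'" "0 < a" "0 < quotient_weight u v f g b a i"
  then show "0 < quotient_weight u v f g b' a i"
    using nuclear_familyD(2)[OF u] unfolding quotient_weight_def ennreal_zero_less_divide by auto
next
  fix q :: real assume q: "0 < q"
  obtain \<beta> hu where b: "\<forall>r>0. 0 < \<beta> r \<and> (\<forall>m. 0 < hu r m) \<and> (\<lambda>m. hu r m powr q) summable_on UNIV \<and>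
      (\<forall>m. u (\<beta> r) m \<le> ennreal (hu r m) * u r m)"
    using nuclear_familyD(4)[OF u q] by metis
  obtain \<alpha> hv where a: "\<forall>r>0. 0 < \<alpha> r \<and> (\<forall>m. 0 < hv r m) \<and> (\<lambda>m. hv r m powr q) summable_on UNIV \<and>
      (\<forall>m. v (\<alpha> r) m \<le> ennreal (hv r m) * v r m)"
    using nuclear_familyD(4)[OF v q] by metis
  have "\<exists>h. (\<forall>i. 0 < h i) \<and> (\<lambda>i. h i powr q) summable_on UNIV \<and>
      (\<forall>i. quotient_weight u v f g (\<beta> r) r' i \<le> ennreal (h i) * quotient_weight u v f g r (\<alpha> r') i)"
    if r: "0 < r" "0 < r'" for r r'
  proof (intro exI[of _ "\<lambda>i. hu r (f i) * hv r' (g i)"] conjI allI)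
    show "0 < hu r (f i) * hv r' (g i)" for i using a b r by simp
    have "(\<lambda>i. hu r (f i) powr q * hv r' (g i) powr q) summable_on UNIV"
      using a b r by (intro summable_on_times_inj[OF inj]) auto
    moreover have "(hu r (f i) * hv r' (g i)) powr q = hu r (f i) powr q * hv r' (g i) powr q" for i
      using a b r by (simp add: powr_mult less_imp_le)
    ultimately show "(\<lambda>i. (hu r (f i) * hv r' (g i)) powr q) summable_on UNIV" by simp
    fix i
    have "u (\<beta> r) (f i) * inverse (v r' (g i)) \<le>
        (ennreal (hu r (f i)) * u r (f i)) * (ennreal (hv r' (g i)) * inverse (v (\<alpha> r') (g i)))"
      using a b r by (intro mult_mono ennreal_inverse_le_scale) auto
    also have "\<dots> = ennreal (hu r (f i) * hv r' (g i)) * (u r (f i) * inverse (v (\<alpha> r') (g i)))"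
      using a b r by (simp add: ennreal_mult less_imp_le ac_simps)
    finally show "quotient_weight u v f g (\<beta> r) r' i \<le>
        ennreal (hu r (f i) * hv r' (g i)) * quotient_weight u v f g r (\<alpha> r') i"
      by (simp add: quotient_weight_def divide_ennreal_def)
  qed
  then show "\<exists>\<beta> \<alpha>. (\<forall>r>0. 0 < \<beta> r \<and> 0 < \<alpha> r) \<and> (\<forall>b>0. \<forall>a>0. \<exists>h. (\<forall>i. 0 < h i) \<and>
      (\<lambda>i. h i powr q) summable_on UNIV \<and>
      (\<forall>i. quotient_weight u v f g (\<beta> b) a i \<le> ennreal (h i) * quotient_weight u v f g b (\<alpha> a) i))"
    using a b by (intro exI[of _ \<beta>] exI[of _ \<alpha>]) simp
qed

text \<open>If \<open>a = \<infinity>\<close> then \<open>b = \<infinity>\<close> as well, and the finiteness of \<open>Q * (b / V)\<close> forces the left-hand side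
  to vanish.\<close>

lemma weight_cancel:
  fixes P Q U V a b :: ennreal
  assumes a: "0 < a" "a \<le> ennreal h * b" and Q: "Q * (b / V) < \<infinity>"
  shows "P * Q * (U / V) \<le> ennreal h * ((P * (U / a)) * (Q * (b / V)))"
proof (cases "a = \<infinity>")
  case True
  then have "b = \<infinity>" using a(2) by (auto simp: top_unique ennreal_mult_eq_top_iff)
  then have "Q = 0 \<or> V = \<infinity>" using Q by (auto simp: ennreal_top_divide ennreal_mult_top split: if_splits)
  then show ?thesis by auto
next
  case False
  have "1 = a * inverse a" using False a(1)
    by (metis divide_ennreal_def ennreal_divide_self infinity_ennreal_def less_top not_gr_zero)
  also have "\<dots> \<le> ennreal h * b * inverse a" by (intro mult_right_mono a(2)) simp
  finally have "1 * (P * Q * (U / V)) \<le> (ennreal h * b * inverse a) * (P * Q * (U / V))" by (rule mult_right_mono) simp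
  then show ?thesis by (simp add: divide_ennreal_def ac_simps)
qed

lemma weighted_infsum_bound:
  fixes f :: "'j \<Rightarrow> complex" and W M :: ennreal
  assumes le: "\<And>j. ennreal (norm (f j)) * W \<le> ennreal (h j) * M"
    and h: "h summable_on UNIV" "\<And>j. 0 < h j" and M: "M < \<infinity>"
  shows "ennreal (norm (infsum f UNIV)) * W \<le> ennreal (infsum h UNIV) * M"
    and "0 < W \<Longrightarrow> f summable_on UNIV"
proof -
  have fin: "ennreal (h j) * M < \<infinity>" for j using M by (simp add: ennreal_mult_less_top)
  obtain m where m: "M = ennreal m" "0 \<le> m" using M by (cases M) auto
  have *: "ennreal (norm (infsum f UNIV)) * W \<le> ennreal (infsum h UNIV) * M \<and> f summable_on UNIV" if "0 < W"
  proof (cases W)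
    case (real w)
    then have w: "0 < w" using that by simp
    have fj: "norm (f j) \<le> norm (h j * (m / w))" for j
    proof -
      have "ennreal (norm (f j) * w) \<le> ennreal (h j * m)"
        using le[of j] m h(2)[of j] w unfolding real(2) m(1) by (simp add: ennreal_mult less_imp_le)
      then have "norm (f j) * w \<le> h j * m" using m h(2)[of j] by (simp add: less_imp_le)
      then show ?thesis using w m h(2)[of j] by (simp add: field_simps)
    qed
    have hs: "(\<lambda>j. h j * (m / w)) summable_on UNIV" by (intro summable_on_cmult_left h(1))
    moreover have "norm (h j * (m / w)) = h j * (m / w)" for j
      using m w h(2)[of j] by simp
    ultimately have "(\<lambda>j. norm (h j * (m / w))) summable_on UNIV" by simp
    then have fs: "(\<lambda>j. norm (f j)) summable_on UNIV"
      by (rule Infinite_Sum.abs_summable_on_comparison_test) (rule fj)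
    have "norm (infsum f UNIV) \<le> infsum (\<lambda>j. h j * (m / w)) UNIV"
      using has_sum_infsum[OF abs_summable_summable[OF fs]] has_sum_infsum[OF hs]
      by (rule norm_infsum_le) (use fj m w h(2) in \<open>simp add: less_imp_le\<close>)
    also have "\<dots> = infsum h UNIV * (m / w)" by (intro infsum_cmult_left) (simp add: h(1))
    finally have "norm (infsum f UNIV) * w \<le> infsum h UNIV * m" using w by (simp add: field_simps)
    then have "ennreal (norm (infsum f UNIV) * w) \<le> ennreal (infsum h UNIV * m)" by (rule ennreal_leI)
    then show ?thesis
      unfolding real(2) m(1) using m w h(2) abs_summable_summable[OF fs]
      by (simp add: ennreal_mult infsum_nonneg less_imp_le)
  next
    case top
    have "f j = 0" for j
    proof (rule ccontr)
      assume "f j \<noteq> 0"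
      then have "ennreal (norm (f j)) * W = \<infinity>" using top by (simp add: ennreal_mult_top)
      then show False using le[of j] fin[of j] by simp
    qed
    then have "f = (\<lambda>j. 0)" by blast
    then show ?thesis by simp
  qed
  then show "0 < W \<Longrightarrow> f summable_on UNIV" by blast
  show "ennreal (norm (infsum f UNIV)) * W \<le> ennreal (infsum h UNIV) * M"
    using * by (cases "W = 0") (auto simp: zero_less_iff_neq_zero)
qed

section \<open>Composition of kernels\<close>

lemma nuclear_family_summable:
  assumes w: "nuclear_family w"
  shows "\<exists>\<rho> h. \<forall>r>0. 0 < \<rho> r \<and> (\<forall>m. 0 < h r m) \<and> h r summable_on UNIV \<and> (\<forall>m. w (\<rho> r) m \<le> ennreal (h r m) * w r m)"
proof -
  obtain \<rho> h where a: "\<forall>r>0. 0 < \<rho> r \<and> (\<forall>m. 0 < h r m) \<and> (\<lambda>m. h r m powr 1) summable_on UNIV \<and>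
      (\<forall>m. w (\<rho> r) m \<le> ennreal (h r m) * w r m)"
    using nuclear_familyD(4)[OF w zero_less_one] by metis
  have "(\<lambda>m. h r m powr 1) = h r" if "0 < r" for r
    using a that by (auto simp: less_imp_le)
  then show ?thesis using a by (intro exI[of _ \<rho>] exI[of _ h]) metis
qed

lemma kernel_comp_term_bound:
  fixes \<xi> \<eta> :: complex
  assumes u: "0 < a" "a \<le> ennreal h * b" and fin: "M < \<infinity>" "N < \<infinity>"
    and x: "ennreal (norm \<xi>) * (U / a) \<le> M" and y: "ennreal (norm \<eta>) * (b / V) \<le> N"
  shows "ennreal (norm (\<xi> * \<eta>)) * (U / V) \<le> ennreal h * (M * N)"
proof -
  have "ennreal (norm (\<xi> * \<eta>)) * (U / V) = ennreal (norm \<xi>) * ennreal (norm \<eta>) * (U / V)"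
    by (simp add: norm_mult ennreal_mult)
  also have "\<dots> \<le> ennreal h * ((ennreal (norm \<xi>) * (U / a)) * (ennreal (norm \<eta>) * (b / V)))"
    by (rule weight_cancel[OF u le_less_trans[OF y fin(2)]])
  also have "\<dots> \<le> ennreal h * (M * N)" by (intro mult_mono x y) auto
  finally show ?thesis .
qed

lemma infsum_combine:
  fixes f g :: "'j \<Rightarrow> complex"
  assumes "f summable_on UNIV" "g summable_on UNIV"
  shows "infsum (\<lambda>j. \<kappa> * f j + \<mu> * g j) UNIV = \<kappa> * infsum f UNIV + \<mu> * infsum g UNIV"
  using assms by (simp add: infsum_add summable_on_cmult_right infsum_cmult_right)

text \<open>One statement for both orders of the arguments: \<open>x\<close> is evaluated at \<open>\<phi> k j\<close> and \<open>y\<close> at \<open>\<psi> k j\<close>, where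
  \<open>j\<close> is the summation index.\<close>

lemma bilinear_weights_infsum:
  fixes w3 :: "real \<Rightarrow> 'm3 \<Rightarrow> ennreal" and w2 :: "real \<Rightarrow> 'm2 \<Rightarrow> ennreal" and w1 :: "real \<Rightarrow> 'm1 \<Rightarrow> ennreal"
    and \<phi> :: "'k \<Rightarrow> 'm2 \<Rightarrow> 'i" and \<psi> :: "'k \<Rightarrow> 'm2 \<Rightarrow> 'l"
  assumes w: "nuclear_family w3" "nuclear_family w2" "nuclear_family w1"
    and inj: "inj (\<lambda>i. (fA i, gA i))" "inj (\<lambda>l. (fB l, gB l))" "inj (\<lambda>k. (fG k, gG k))"
    and index: "\<And>k j. fA (\<phi> k j) = fG k" "\<And>k j. gA (\<phi> k j) = j" "\<And>k j. fB (\<psi> k j) = j" "\<And>k j. gB (\<psi> k j) = gG k"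
  shows "\<exists>\<rho> C. bilinear_weights (quotient_weight w3 w2 fA gA) (quotient_weight w2 w1 fB gB)
    (quotient_weight w3 w1 fG gG) (\<lambda>x y k. infsum (\<lambda>j. x (\<phi> k j) * y (\<psi> k j)) UNIV) \<rho> C"
proof -
  obtain \<rho> h where h: "\<And>r. 0 < r \<Longrightarrow> 0 < \<rho> r" "\<And>r m. 0 < r \<Longrightarrow> 0 < h r m" "\<And>r. 0 < r \<Longrightarrow> h r summable_on UNIV"
      "\<And>r m. 0 < r \<Longrightarrow> w2 (\<rho> r) m \<le> ennreal (h r m) * w2 r m"
    using nuclear_family_summable[OF w(2)] by metis
  let ?A = "quotient_weight w3 w2 fA gA" and ?B = "quotient_weight w2 w1 fB gB" and ?G = "quotient_weight w3 w1 fG gG"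
  let ?\<Phi> = "\<lambda>x y k. infsum (\<lambda>j. x (\<phi> k j) * y (\<psi> k j)) UNIV"
  have le: "ennreal (norm (x (\<phi> k j) * y (\<psi> k j))) * ?G r3 r1 k \<le>
      ennreal (h r2 j) * (sup_norm (?A r3 (\<rho> r2)) x * sup_norm (?B r2 r1) y)"
    if r: "0 < r1" "0 < r2" "0 < r3" and fin: "sup_norm (?A r3 (\<rho> r2)) x < \<infinity>" "sup_norm (?B r2 r1) y < \<infinity>"
    for r1 r2 r3 x y k j
    unfolding quotient_weight_def[of _ _ _ _ _ _ k]
    using wnorm_sup_upper[of x "\<phi> k j" "?A r3 (\<rho> r2)"] wnorm_sup_upper[of y "\<psi> k j" "?B r2 r1"]
      nuclear_familyD(2)[OF w(2) h(1)[OF r(2)]]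
    by (intro kernel_comp_term_bound[OF _ h(4)[OF r(2)] fin]) (simp_all add: quotient_weight_def index)
  have summ: "(\<lambda>j. x (\<phi> k j) * y (\<psi> k j)) summable_on UNIV"
    if r: "0 < r1" "0 < r2" "0 < r3" and fin: "sup_norm (?A r3 (\<rho> r2)) x < \<infinity>" "sup_norm (?B r2 r1) y < \<infinity>"
      and pos: "0 < ?G r3 r1 k" for r1 r2 r3 x y k
    by (rule weighted_infsum_bound(2)[OF le[OF r fin] h(3)[OF r(2)] h(2)[OF r(2)] _ pos])
      (use fin in \<open>simp add: ennreal_mult_less_top\<close>)
  interpret A: weight_system ?A by (intro weight_system_quotient w inj)
  interpret B: weight_system ?B by (intro weight_system_quotient w inj)
  interpret G: weight_system ?G by (intro weight_system_quotient w inj)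
  have "bilinear_weights ?A ?B ?G ?\<Phi> \<rho> (\<lambda>r. infsum (h r) UNIV)"
  proof
    show "0 < \<rho> r" if "0 < r" for r using h(1) that .
  next
    fix r1 r2 r3 :: real and x y
    assume r: "0 < r1" "0 < r2" "0 < r3" and fin: "sup_norm (?A r3 (\<rho> r2)) x < \<infinity>" "sup_norm (?B r2 r1) y < \<infinity>"
    show "sup_norm (?G r3 r1) (?\<Phi> x y) \<le>
        ennreal (infsum (h r2) UNIV) * (sup_norm (?A r3 (\<rho> r2)) x * sup_norm (?B r2 r1) y)"
      by (rule wnorm_sup_least, rule weighted_infsum_bound(1)[OF le[OF r fin] h(3)[OF r(2)] h(2)[OF r(2)]])
        (use fin in \<open>simp add: ennreal_mult_less_top\<close>)
  next
    fix r1 r2 r3 \<kappa> \<mu> x x' y k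
    assume r: "0 < r1" "0 < r2" "0 < r3" and fin: "sup_norm (?A r3 (\<rho> r2)) x < \<infinity>"
      "sup_norm (?A r3 (\<rho> r2)) x' < \<infinity>" "sup_norm (?B r2 r1) y < \<infinity>" and pos: "0 < ?G r3 r1 k"
    show "?\<Phi> (\<lambda>i. \<kappa> * x i + \<mu> * x' i) y k = \<kappa> * ?\<Phi> x y k + \<mu> * ?\<Phi> x' y k"
      using infsum_combine[OF summ[OF r fin(1,3) pos] summ[OF r fin(2,3) pos], of \<kappa> \<mu>]
      by (simp add: algebra_simps)
  next
    fix r1 r2 r3 \<kappa> \<mu> x y y' k
    assume r: "0 < r1" "0 < r2" "0 < r3" and fin: "sup_norm (?A r3 (\<rho> r2)) x < \<infinity>"
      "sup_norm (?B r2 r1) y < \<infinity>" "sup_norm (?B r2 r1) y' < \<infinity>" and pos: "0 < ?G r3 r1 k"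
    show "?\<Phi> x (\<lambda>l. \<kappa> * y l + \<mu> * y' l) k = \<kappa> * ?\<Phi> x y k + \<mu> * ?\<Phi> x y' k"
      using infsum_combine[OF summ[OF r fin(1,2) pos] summ[OF r fin(1,3) pos], of \<kappa> \<mu>]
      by (simp add: algebra_simps)
  qed
  then show ?thesis by blast
qed

lemma bilinear_weights_kernel_comp:
  fixes w3 :: "real \<Rightarrow> nat ^ 'd3::finite \<Rightarrow> ennreal" and w2 :: "real \<Rightarrow> nat ^ 'd2::finite \<Rightarrow> ennreal"
    and w1 :: "real \<Rightarrow> nat ^ 'd1::finite \<Rightarrow> ennreal"
  assumes w: "nuclear_family w3" "nuclear_family w2" "nuclear_family w1"
  shows "\<exists>\<rho> C. bilinear_weights (quotient_weight w3 w2 fst snd) (quotient_weight w2 w1 fst snd)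
      (quotient_weight w3 w1 fst snd) kernel_comp \<rho> C" (is ?plain)
    and "\<exists>\<rho> C. bilinear_weights (quotient_weight w1 w2 snd fst) (quotient_weight w2 w3 snd fst)
      (quotient_weight w1 w3 snd fst) (\<lambda>y x. kernel_comp x y) \<rho> C" (is ?swapped)
proof -
  have "(kernel_comp :: ('d3, 'd2) kernel \<Rightarrow> ('d2, 'd1) kernel \<Rightarrow> _) = (\<lambda>x y k. infsum (\<lambda>j. x (fst k, j) * y (j, snd k)) UNIV :: complex)"
    by (auto simp: kernel_comp_def fun_eq_iff)
  then show ?plain
    using bilinear_weights_infsum[OF w, of fst snd fst snd fst snd "\<lambda>k j. (fst k, j)" "\<lambda>k j. (j, snd k)"]
    by (simp add: inj_def)
  have "(\<lambda>(y :: ('d2, 'd1) kernel) (x :: ('d3, 'd2) kernel). kernel_comp x y) = (\<lambda>y x k. infsum (\<lambda>j. y (j, snd k) * x (fst k, j)) UNIV :: complex)"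
    by (auto simp: kernel_comp_def fun_eq_iff mult.commute)
  then show ?swapped
    using bilinear_weights_infsum[OF w(3,2,1), of snd fst snd fst snd fst "\<lambda>k j. (j, snd k)" "\<lambda>k j. (fst k, j)"]
    by (simp add: inj_def)
qed

definition truncation_space :: "('i \<Rightarrow> complex) topology \<Rightarrow> bool" where
  "truncation_space X \<longleftrightarrow> {K. finite {i. K i \<noteq> 0}} \<subseteq> topspace X \<and>
     (\<forall>x\<in>topspace X. limitin X (\<lambda>S. truncate S x) x (finite_subsets_at_top UNIV)) \<and>
     (\<forall>i. continuous_map X euclidean (\<lambda>x. x i))"

lemma (in weight_system) truncation_space_proj_ind: "truncation_space (proj_ind \<infinity> \<omega>)"
  unfolding truncation_space_def topspace_lin_top[OF lin_top_proj_ind]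
proof (intro conjI ballI allI)
  show "{K. finite {i. K i \<noteq> 0}} \<subseteq> proj_ind_set \<omega>"
    using finite_support_mem_ind_proj_set ind_proj_set_subset by blast
  show "continuous_map (proj_ind \<infinity> \<omega>) euclidean (\<lambda>x. x i)" for i
    by (rule continuous_map_coordinate[OF lin_top_proj_ind coordinate_mem_nbhds(1)])
qed (rule limitin_truncate_proj_ind)

lemma (in weight_system) truncation_space_ind_proj: "truncation_space (ind_proj \<infinity> \<omega>)"
  unfolding truncation_space_def topspace_lin_top[OF lin_top_ind_proj]
proof (intro conjI ballI allI)
  show "{K. finite {i. K i \<noteq> 0}} \<subseteq> ind_proj_set \<omega>"
    using finite_support_mem_ind_proj_set by blast
  show "continuous_map (ind_proj \<infinity> \<omega>) euclidean (\<lambda>x. x i)" for i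
    by (rule continuous_map_coordinate[OF lin_top_ind_proj coordinate_mem_nbhds(2)])
qed (rule limitin_truncate_ind_proj)

lemma continuous_map_truncation_unique:
  assumes X: "truncation_space X" and Z: "truncation_space Z"
    and f: "continuous_map X Z f" "continuous_map X Z g"
    and eq: "\<And>x. finite {i. x i \<noteq> 0} \<Longrightarrow> f x = g x" and x: "x \<in> topspace X"
  shows "f x = g x"
proof
  fix i
  have lim: "((\<lambda>S. f (truncate S x) i) \<longlongrightarrow> f x i) (finite_subsets_at_top UNIV)" if "continuous_map X Z f" for f
  proof -
    have "continuous_map X euclidean ((\<lambda>z. z i) \<circ> f)"
      using that Z unfolding truncation_space_def by (blast intro: continuous_map_compose)
    moreover have "limitin X (\<lambda>S. truncate S x) x (finite_subsets_at_top UNIV)"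
      using X x unfolding truncation_space_def by blast
    ultimately have "limitin euclidean (((\<lambda>z. z i) \<circ> f) \<circ> (\<lambda>S. truncate S x)) (((\<lambda>z. z i) \<circ> f) x) (finite_subsets_at_top UNIV)"
      by (rule continuous_map_limit)
    then show ?thesis by (simp add: comp_def)
  qed
  have "eventually (\<lambda>S. f (truncate S x) i = g (truncate S x) i) (finite_subsets_at_top UNIV)"
  proof (rule eventually_finite_subsets_at_top_weakI)
    fix S :: "'a set" assume "finite S"
    then have "finite {i. truncate S x i \<noteq> 0}" by (rule rev_finite_subset) (auto simp: truncate_def)
    then show "f (truncate S x) i = g (truncate S x) i" using eq by simp
  qed
  from Lim_transform_eventually[OF lim[OF f(1)] this]
  show "f x i = g x i" by (rule tendsto_unique[OF finite_subsets_at_top_neq_bot _ lim[OF f(2)]])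
qed

lemma uniquely_extendable_kernel_comp:
  fixes X :: "('d3::finite, 'd2::finite) kernel topology" and Y :: "('d2, 'd1::finite) kernel topology"
    and Z :: "('d3, 'd1) kernel topology"
  assumes X: "truncation_space X" and Y: "truncation_space Y" and Z: "truncation_space Z"
    and bic: "bicontinuous X Y Z kernel_comp"
    and T: "\<And>K2 K1. K2 \<in> A0_hat \<Longrightarrow> K1 \<in> A0_hat \<Longrightarrow> T (K2, K1) = kernel_comp K2 K1"
  shows "uniquely_extendable T (A0_hat \<times> A0_hat) X Y Z"
  unfolding uniquely_extendable_def
proof (intro conjI)
  have A0: "A0_hat \<subseteq> topspace X" "A0_hat \<subseteq> topspace Y"
    using X Y by (auto simp: truncation_space_def A0_hat_def)
  then show sub: "A0_hat \<times> A0_hat \<subseteq> topspace X \<times> topspace Y" by blast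
  let ?U = "restrict (\<lambda>(x, y). kernel_comp x y) (topspace X \<times> topspace Y)"
  let ?P = "\<lambda>U. U \<in> topspace X \<times> topspace Y \<rightarrow>\<^sub>E topspace Z \<and> (\<forall>k\<in>A0_hat \<times> A0_hat. U k = T k) \<and>
        separately_continuous X Y Z U \<and> sequentially_continuous_map (prod_topology X Y) Z U"
  have bic1: "\<And>x y. x \<in> topspace X \<Longrightarrow> y \<in> topspace Y \<Longrightarrow> kernel_comp x y \<in> topspace Z"
    and bic2: "\<And>y. y \<in> topspace Y \<Longrightarrow> continuous_map X Z (\<lambda>x. kernel_comp x y)"
    and bic3: "\<And>x. x \<in> topspace X \<Longrightarrow> continuous_map Y Z (kernel_comp x)"
    and bic4: "\<And>x y l m. limitin X x l sequentially \<Longrightarrow> limitin Y y m sequentially \<Longrightarrow>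
        limitin Z (\<lambda>n. kernel_comp (x n) (y n)) (kernel_comp l m) sequentially"
    using bic unfolding bicontinuous_def by simp_all
  show "\<exists>!U. ?P U"
  proof (rule ex1I[of _ ?U])
    show "?P ?U"
    proof (intro conjI ballI)
      show "?U \<in> topspace X \<times> topspace Y \<rightarrow>\<^sub>E topspace Z" using bic1 by auto
      show "?U k = T k" if "k \<in> A0_hat \<times> A0_hat" for k
        using that sub T by auto
      show "separately_continuous X Y Z ?U"
        unfolding separately_continuous_def
      proof (intro conjI ballI)
        show "continuous_map X Z (\<lambda>x. ?U (x, y))" if "y \<in> topspace Y" for y
          by (rule continuous_map_eq[OF bic2[OF that]]) (use that in simp)
        show "continuous_map Y Z (\<lambda>y. ?U (x, y))" if "x \<in> topspace X" for x
          by (rule continuous_map_eq[OF bic3[OF that]]) (use that in simp)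
      qed
      show "sequentially_continuous_map (prod_topology X Y) Z ?U"
        unfolding sequentially_continuous_map_def
      proof (intro allI impI)
        fix x l assume lim: "limitin (prod_topology X Y) x l sequentially"
        then have lims: "limitin X (\<lambda>n. fst (x n)) (fst l) sequentially" "limitin Y (\<lambda>n. snd (x n)) (snd l) sequentially"
          unfolding limitin_pairwise by (simp_all add: comp_def)
        then have l: "l \<in> topspace X \<times> topspace Y" by (simp add: limitin_def mem_Times_iff)
        have "eventually (\<lambda>n. x n \<in> topspace (prod_topology X Y)) sequentially"
          using lim by (auto simp: limitin_def simp del: topspace_prod_topology)
        then have "eventually (\<lambda>n. kernel_comp (fst (x n)) (snd (x n)) = ?U (x n)) sequentially"
          by (rule eventually_mono) (auto simp: case_prod_beta)
        from limitin_transform_eventually[OF this bic4[OF lims]]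
        show "limitin Z (\<lambda>n. ?U (x n)) (?U l) sequentially" using l by (simp add: case_prod_beta)
      qed
    qed
  next
    fix U assume U: "?P U"
    have U1: "continuous_map X Z (\<lambda>x. U (x, y))" if "y \<in> topspace Y" for y
      using U that unfolding separately_continuous_def by blast
    have U2: "continuous_map Y Z (\<lambda>y. U (x, y))" if "x \<in> topspace X" for x
      using U that unfolding separately_continuous_def by blast
    have U0: "U (x, y) = kernel_comp x y" if "finite {i. x i \<noteq> 0}" "finite {i. y i \<noteq> 0}" for x y
      using U T[of x y] that by (auto simp: A0_hat_def)
    have "U (x, y) = kernel_comp x y" if x: "x \<in> topspace X" and y: "y \<in> topspace Y" for x y
    proof (rule continuous_map_truncation_unique[OF Y Z U2[OF x] bic3[OF x] _ y])
      fix y :: "('d2, 'd1) kernel" assume y: "finite {i. y i \<noteq> 0}"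
      then have "y \<in> topspace Y" using A0(2) by (auto simp: A0_hat_def)
      from continuous_map_truncation_unique[OF X Z U1[OF this] bic2[OF this] _ x]
      show "U (x, y) = kernel_comp x y" using U0 y by blast
    qed
    then show "U = ?U"
      using U by (intro PiE_ext[of U "topspace X \<times> topspace Y" "\<lambda>_. topspace Z"]) (use bic1 in auto)
  qed
qed

section \<open>The weights theta\<close>

lemma summable_on_mlen:
  fixes \<phi> :: "nat \<Rightarrow> real"
  assumes nn: "\<And>n. 0 \<le> \<phi> n" and B: "\<And>n. \<phi> n * (1 + real n) ^ (2 * CARD('n)) \<le> B"
  shows "(\<lambda>\<alpha> :: nat ^ 'n::finite. \<phi> (mlen \<alpha>)) summable_on UNIV"
proof (rule nonneg_bdd_above_summable_on)
  let ?f = "\<lambda>k::nat. 1 / (real (Suc k))\<^sup>2"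
  have f_sum: "summable ?f"
    using inverse_power_summable[of 2, where 'a = real] by (subst summable_Suc_iff) (simp add: field_simps)
  have "0 \<le> B" using B[of 0] nn[of 0] by simp
  have le: "\<phi> (mlen \<alpha>) \<le> B * (\<Prod>i\<in>UNIV. ?f (\<alpha> $ i))" for \<alpha> :: "nat ^ 'n"
  proof -
    have "(\<Prod>i\<in>UNIV. (real (Suc (\<alpha> $ i)))\<^sup>2) \<le> (\<Prod>i\<in>(UNIV :: 'n set). (1 + real (mlen \<alpha>))\<^sup>2)"
    proof (rule prod_mono, intro conjI power_mono)
      fix i
      have "\<alpha> $ i \<le> mlen \<alpha>" unfolding mlen_def by (rule member_le_sum) auto
      then show "real (Suc (\<alpha> $ i)) \<le> 1 + real (mlen \<alpha>)" by simp
    qed auto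
    also have "\<dots> = (1 + real (mlen \<alpha>)) ^ (2 * CARD('n))" by (simp add: power_mult)
    finally have "\<phi> (mlen \<alpha>) * (\<Prod>i\<in>UNIV. (real (Suc (\<alpha> $ i)))\<^sup>2) \<le> B"
      using mult_left_mono[OF _ nn] B order_trans by blast
    moreover have "0 < (\<Prod>i\<in>UNIV. (real (Suc (\<alpha> $ i)))\<^sup>2)" by (intro prod_pos) simp
    ultimately show ?thesis by (simp add: prod_dividef field_simps)
  qed
  show "bdd_above (sum (\<lambda>\<alpha> :: nat ^ 'n. \<phi> (mlen \<alpha>)) ` {F. F \<subseteq> UNIV \<and> finite F})"
  proof (rule bdd_aboveI2)
    fix F :: "(nat ^ 'n) set" assume "F \<in> {F. F \<subseteq> UNIV \<and> finite F}"
    then have F: "finite F" by simp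
    define M where "M = Suc (Max (insert 0 (mlen ` F)))"
    have lt: "\<alpha> $ i < M" if "\<alpha> \<in> F" for \<alpha> i
    proof -
      have "\<alpha> $ i \<le> mlen \<alpha>" unfolding mlen_def by (rule member_le_sum) auto
      also have "\<dots> \<le> Max (insert 0 (mlen ` F))" using F that by (intro Max_ge) auto
      finally show ?thesis by (simp add: M_def)
    qed
    have "(\<Sum>\<alpha>\<in>F. \<phi> (mlen \<alpha>)) \<le> (\<Sum>\<alpha>\<in>F. B * (\<Prod>i\<in>UNIV. ?f (\<alpha> $ i)))" by (intro sum_mono le)
    also have "\<dots> = B * (\<Sum>\<alpha>\<in>F. \<Prod>i\<in>UNIV. ?f (\<alpha> $ i))" by (simp only: sum_distrib_left)
    also have "(\<Sum>\<alpha>\<in>F. \<Prod>i\<in>UNIV. ?f (\<alpha> $ i)) = (\<Sum>g\<in>($) ` F. \<Prod>i\<in>UNIV. ?f (g i))"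
      by (subst sum.reindex) (auto simp: inj_on_def vec_eq_iff)
    also have "\<dots> \<le> (\<Sum>g\<in>PiE (UNIV :: 'n set) (\<lambda>_. {..<M}). \<Prod>i\<in>UNIV. ?f (g i))"
    proof (rule sum_mono2)
      show "($) ` F \<subseteq> PiE (UNIV :: 'n set) (\<lambda>_. {..<M})" using lt by auto
      show "0 \<le> (\<Prod>i\<in>UNIV. ?f (g i))" for g :: "'n \<Rightarrow> nat" by (intro prod_nonneg) simp
    qed (intro finite_PiE, auto)
    also have "\<dots> = (\<Prod>i\<in>(UNIV :: 'n set). \<Sum>k<M. ?f k)"
      by (rule prod_sum_PiE[symmetric]) auto
    also have "\<dots> \<le> (\<Prod>i\<in>(UNIV :: 'n set). suminf ?f)"
      by (intro prod_mono conjI sum_nonneg sum_le_suminf f_sum) auto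
    finally show "(\<Sum>\<alpha>\<in>F. \<phi> (mlen \<alpha>)) \<le> B * (\<Prod>i\<in>(UNIV :: 'n set). suminf ?f)"
      using \<open>0 \<le> B\<close> by (simp add: mult_left_mono)
  qed
qed (rule nn)

lemma exp_powr_times_power_bounded:
  fixes c \<kappa> :: real
  assumes c: "0 < c" "0 < \<kappa>"
  shows "\<exists>B. \<forall>n::nat. exp (- c * real n powr \<kappa>) * (1 + real n) ^ d \<le> B"
proof -
  have "(\<lambda>n::nat. exp (- c * real n powr \<kappa>) * (1 + real n) ^ d) \<longlonglongrightarrow> 0"
    using c by real_asymp
  then have "Bseq (\<lambda>n::nat. exp (- c * real n powr \<kappa>) * (1 + real n) ^ d)"
    by (intro convergent_imp_Bseq convergentI)
  then show ?thesis unfolding Bseq_def by (auto simp: abs_mult)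
qed

lemma exp_decay_summable:
  fixes c \<kappa> q :: real
  assumes "0 < c" "0 < \<kappa>" "0 < q"
  shows "(\<lambda>\<alpha> :: nat ^ 'n::finite. exp (- c * real (mlen \<alpha>) powr \<kappa>) powr q) summable_on UNIV"
proof -
  obtain B where B: "\<And>n::nat. exp (- (q * c) * real n powr \<kappa>) * (1 + real n) ^ (2 * CARD('n)) \<le> B"
    using exp_powr_times_power_bounded[of "q * c" \<kappa>] assms by auto
  have "(\<lambda>\<alpha> :: nat ^ 'n. exp (- (q * c) * real (mlen \<alpha>) powr \<kappa>)) summable_on UNIV"
    by (rule summable_on_mlen[OF _ B]) simp
  then show ?thesis by (simp add: powr_def mult.assoc)
qed

lemma nuclear_family_increasing:
  assumes "\<And>r r' m. 0 < r \<Longrightarrow> r \<le> r' \<Longrightarrow> w r m \<le> w r' m" "\<And>r m. 0 < r \<Longrightarrow> 0 < w r m"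
    "\<And>m. \<exists>r>0. w r m < \<infinity>"
    "\<And>q r. 0 < q \<Longrightarrow> 0 < r \<Longrightarrow> summable_gain w q r"
  shows "nuclear_family w"
  unfolding nuclear_family_def
proof (intro conjI allI impI exI[of _ "\<lambda>k. 1 / real (Suc k)"])
  fix r :: real assume r: "0 < r"
  then obtain k where "1 / real (Suc k) < r" by (metis nat_approx_posE)
  then have "\<forall>m. w (1 / real (Suc k)) m \<le> w r m" by (intro allI assms(1)) auto
  then show "\<exists>k. \<forall>m. w (1 / real (Suc k)) m \<le> w r m" by blast
next
  show "w (1 / real (Suc (Suc k))) m \<le> w (1 / real (Suc k)) m" for k m
    by (rule assms(1)) (auto simp: field_simps)
qed (use assms in auto)

lemma nuclear_family_decreasing:
  assumes "\<And>r r' m. 0 < r \<Longrightarrow> r \<le> r' \<Longrightarrow> w r' m \<le> w r m" "\<And>r m. 0 < r \<Longrightarrow> 0 < w r m"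
    "\<And>m. \<exists>r>0. w r m < \<infinity>"
    "\<And>q r. 0 < q \<Longrightarrow> 0 < r \<Longrightarrow> summable_gain w q r"
  shows "nuclear_family w"
  unfolding nuclear_family_def
proof (intro conjI allI impI exI[of _ "\<lambda>k. real (Suc k)"])
  fix r :: real assume r: "0 < r"
  obtain k where "r \<le> real k" using real_arch_simple by blast
  then have "\<forall>m. w (real (Suc k)) m \<le> w r m" using r by (intro allI assms(1)) auto
  then show "\<exists>k. \<forall>m. w (real (Suc k)) m \<le> w r m" by blast
next
  show "w (real (Suc (Suc k))) m \<le> w (real (Suc k)) m" for k m
    by (rule assms(1)) auto
qed (use assms in auto)

lemma mfact_pos: "0 < mfact \<alpha>"
  unfolding mfact_def by (intro prod_pos) simp

lemma theta_mono:
  assumes s: "s \<in> R_flat_infty" and r: "0 < r" "r \<le> r'"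
  shows "theta r s \<alpha> \<le> theta r' s \<alpha>"
proof (cases s)
  case (Fin x)
  then have "0 < x" using s by (auto simp: R_flat_infty_def)
  then show ?thesis using Fin r by (auto intro!: ennreal_leI mult_right_mono)
next
  case (Flat x)
  then show ?thesis using r by (auto intro!: ennreal_leI mult_right_mono power_mono)
next
  case Infty
  then show ?thesis using r by (auto intro!: ennreal_leI powr_mono)
qed

lemma theta_pos: "0 < r \<Longrightarrow> 0 < theta r s \<alpha>"
  using mfact_pos[of \<alpha>] add_pos_nonneg[OF zero_less_one zero_le_power2, of "real (mlen \<alpha>)"]
  by (cases s) auto

lemma theta_finite: "s \<in> R_flat_infty \<Longrightarrow> theta r s \<alpha> < \<infinity>"
  by (cases s) (auto simp: R_flat_infty_def)

lemma theta_Flat_scale: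
  assumes "0 < c" "0 < r"
  shows "theta (exp (- c) * r) (Flat \<sigma>) \<alpha> = ennreal (exp (- c * real (mlen \<alpha>) powr 1)) * theta r (Flat \<sigma>) \<alpha>"
  using assms mfact_pos[of \<alpha>]
  by (simp add: power_mult_distrib exp_of_nat_mult[symmetric] mult.assoc mult.commute[of c] flip: ennreal_mult'')

lemma nuclear_family_theta:
  assumes s: "s \<in> R_flat_closed"
  shows "nuclear_family (\<lambda>r (\<alpha> :: nat ^ 'n::finite). theta r s \<alpha>)"
proof (cases "s = Fin 0")
  case True
  show ?thesis
  proof (rule nuclear_family_decreasing)
    show "\<exists>r>0. theta r s m < \<infinity>" for m :: "nat ^ 'n"
      using True by (intro exI[of _ "real (mlen m) + 1"]) simp
    fix q r :: real assume qr: "0 < q" "0 < r"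
    let ?h = "\<lambda>m :: nat ^ 'n. exp r * exp (- 1 * real (mlen m) powr 1)"
    have "(\<lambda>m. exp r powr q * exp (- 1 * real (mlen m) powr 1) powr q) summable_on (UNIV :: (nat ^ 'n) set)"
      by (intro summable_on_cmult_right exp_decay_summable qr) auto
    moreover have "theta r s m \<le> ennreal (?h m) * theta r s m" for m
    proof (cases "real (mlen m) \<le> r")
      case le: True
      then have "1 \<le> ?h m" by (simp flip: exp_add)
      then have "ennreal 1 \<le> ennreal (?h m)" by (rule ennreal_leI)
      then show ?thesis using True le by simp
    next
      case False
      then show ?thesis using True by (simp add: ennreal_mult_top)
    qed
    ultimately show "summable_gain (\<lambda>r (\<alpha> :: nat ^ 'n). theta r s \<alpha>) q r"
      using qr by (intro exI[of _ r] conjI exI[of _ ?h]) (auto simp: powr_mult)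
  qed (use True theta_pos in auto)
next
  case False
  with s have s': "s \<in> R_flat_infty" and cases: "(\<exists>x>0. s = Fin x) \<or> (\<exists>\<sigma>. s = Flat \<sigma>)"
    by (auto simp: R_flat_closed_def R_flat_infty_def)
  show ?thesis
  proof (rule nuclear_family_increasing)
    show "\<exists>r>0. theta r s m < \<infinity>" for m :: "nat ^ 'n"
      using theta_finite[OF s'] by (intro exI[of _ 1]) simp
    fix q r :: real assume qr: "0 < q" "0 < r"
    from cases show "summable_gain (\<lambda>r (\<alpha> :: nat ^ 'n). theta r s \<alpha>) q r"
    proof (elim disjE exE conjE)
      fix x assume x: "0 < x" "s = Fin x"
      let ?h = "\<lambda>m :: nat ^ 'n. exp (- (r / 2) * real (mlen m) powr (1 / (2 * x)))"
      have "theta (r / 2) s m = ennreal (?h m) * theta r s m" for m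
        using x by (simp add: exp_add[symmetric] field_simps flip: ennreal_mult'')
      then show ?thesis
        using qr x by (intro exI[of _ "r / 2"] conjI exI[of _ ?h] exp_decay_summable) auto
    next
      fix \<sigma> assume \<sigma>: "s = Flat \<sigma>"
      have "theta (exp (- 1) * r) s m = ennreal (exp (- 1 * real (mlen m) powr 1)) * theta r s m" for m :: "nat ^ 'n"
        unfolding \<sigma> by (rule theta_Flat_scale[OF zero_less_one qr(2)])
      then show ?thesis
        using qr by (intro exI[of _ "exp (- 1) * r"] conjI exI[of _ "\<lambda>m. exp (- 1 * real (mlen m) powr 1)"] exp_decay_summable)
          (auto simp del: theta.simps)
    qed
  qed (use theta_pos theta_mono[OF s'] in auto)
qed

lemma nuclear_family_inverse_theta:
  assumes s: "s \<in> R_flat_infty"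
  shows "nuclear_family (\<lambda>r (\<alpha> :: nat ^ 'n::finite). inverse (theta r s \<alpha>))"
proof (rule nuclear_family_decreasing)
  show "inverse (theta r' s m) \<le> inverse (theta r s m)" if "0 < r" "r \<le> r'" for r r' and m :: "nat ^ 'n"
    by (intro ennreal_inverse_antimono theta_mono[OF s] that)
  show "0 < inverse (theta r s m)" for r and m :: "nat ^ 'n"
    using theta_finite[OF s, of r m] by (simp add: ennreal_inverse_positive)
  show "\<exists>r>0. inverse (theta r s m) < \<infinity>" for m :: "nat ^ 'n"
    using theta_pos[of 1 s m] by (intro exI[of _ 1]) (simp add: less_top[symmetric])
  have scale: "summable_gain (\<lambda>r (\<alpha> :: nat ^ 'n). inverse (theta r s \<alpha>)) q r"
    if "0 < r'" "\<And>m. 0 < h m" "(\<lambda>m. h m powr q) summable_on UNIV"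
      "\<And>m. theta r s m \<le> ennreal (h m) * theta r' s m" for r r' q and h :: "nat ^ 'n \<Rightarrow> real"
    using that ennreal_inverse_le_scale by (intro exI[of _ r'] conjI exI[of _ h]) auto
  fix q r :: real assume qr: "0 < q" "0 < r"
  from s consider x where "0 < x" "s = Fin x" | \<sigma> where "s = Flat \<sigma>" | "s = Infty"
    by (auto simp: R_flat_infty_def)
  then show "summable_gain (\<lambda>r (\<alpha> :: nat ^ 'n). inverse (theta r s \<alpha>)) q r"
  proof cases
    case (1 x)
    show ?thesis
    proof (rule scale)
      show "theta r s m \<le> ennreal (exp (- r * real (mlen m) powr (1 / (2 * x)))) * theta (2 * r) s m" for m :: "nat ^ 'n"
        using 1 by (simp add: exp_add[symmetric] field_simps flip: ennreal_mult'')
      show "(\<lambda>m. exp (- r * real (mlen m) powr (1 / (2 * x))) powr q) summable_on (UNIV :: (nat ^ 'n) set)"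
        by (rule exp_decay_summable) (use qr 1 in auto)
    qed (use qr in auto)
  next
    case (2 \<sigma>)
    show ?thesis
    proof (rule scale)
      show "theta r s m \<le> ennreal (exp (- 1 * real (mlen m) powr 1)) * theta (exp 1 * r) s m" for m :: "nat ^ 'n"
      proof -
        have eq: "exp (- 1) * (exp 1 * r) = r" by (simp add: exp_minus)
        show ?thesis
          using theta_Flat_scale[of 1 "exp 1 * r" \<sigma> m] qr unfolding 2 eq by (simp del: theta.simps)
      qed
      show "(\<lambda>m. exp (- 1 * real (mlen m) powr 1) powr q) summable_on (UNIV :: (nat ^ 'n) set)"
        by (rule exp_decay_summable) (use qr in auto)
    qed (use qr in auto)
  next
    case 3
    define d where "d = 2 * CARD('n)"
    define t where "t = 2 * real d / q"
    have t: "0 < t" "q * (t / 2) = real d" using qr by (simp_all add: t_def d_def)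
    let ?h = "\<lambda>n::nat. (1 + (real n)\<^sup>2) powr (- t / 2)"
    have pos: "0 < 1 + (real n)\<^sup>2" for n by (simp add: add_pos_nonneg)
    have h: "?h n powr q = 1 / (1 + (real n)\<^sup>2) ^ d" for n
    proof -
      have "?h n powr q = (1 + (real n)\<^sup>2) powr (- real d)" using t(2) by (simp add: powr_powr mult.commute)
      also have "\<dots> = 1 / (1 + (real n)\<^sup>2) ^ d" using pos[of n] by (simp add: powr_minus powr_realpow divide_inverse)
      finally show ?thesis .
    qed
    show ?thesis
    proof (rule scale)
      show "0 < r + t" using qr t by simp
      show "0 < ?h (mlen m)" for m :: "nat ^ 'n" using pos[of "mlen m"] by simp
      show "(\<lambda>m. ?h (mlen m) powr q) summable_on (UNIV :: (nat ^ 'n) set)"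
      proof (rule summable_on_mlen)
        fix n :: nat
        have "real n \<le> (real n)\<^sup>2" by (cases n) (auto simp: power2_eq_square)
        then have "(1 + real n) ^ d \<le> (1 + (real n)\<^sup>2) ^ d" by (intro power_mono) auto
        then show "?h n powr q * (1 + real n) ^ (2 * CARD('n)) \<le> 1"
          unfolding h d_def[symmetric] using pos[of n] by (simp add: field_simps)
      qed simp
      show "theta r s m \<le> ennreal (?h (mlen m)) * theta (r + t) s m" for m :: "nat ^ 'n"
        unfolding 3 using pos[of "mlen m"] by (simp add: add_divide_distrib flip: ennreal_mult'' powr_add)
    qed
  qed
qed

abbreviation kernel_comp_extendable where
  "kernel_comp_extendable T p A B G \<equiv>
     uniquely_extendable T (A0_hat \<times> A0_hat) (proj_ind p A) (ind_proj p B) (ind_proj p G) \<and>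
     uniquely_extendable T (A0_hat \<times> A0_hat) (ind_proj p A) (proj_ind p B) (ind_proj p G) \<and>
     uniquely_extendable T (A0_hat \<times> A0_hat) (proj_ind p A) (proj_ind p B) (proj_ind p G)"

lemma kernel_comp_extendable_quotient_weight:
  fixes w3 :: "real \<Rightarrow> nat ^ 'd3::finite \<Rightarrow> ennreal" and w2 :: "real \<Rightarrow> nat ^ 'd2::finite \<Rightarrow> ennreal"
    and w1 :: "real \<Rightarrow> nat ^ 'd1::finite \<Rightarrow> ennreal"
  assumes p: "0 < p" and w: "nuclear_family w3" "nuclear_family w2" "nuclear_family w1"
    and T: "\<And>K2 K1. K2 \<in> A0_hat \<Longrightarrow> K1 \<in> A0_hat \<Longrightarrow> T (K2, K1) = kernel_comp K2 K1"
  shows "kernel_comp_extendable T p (quotient_weight w3 w2 fst snd) (quotient_weight w2 w1 fst snd)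
      (quotient_weight w3 w1 fst snd)" (is ?plain)
    and "kernel_comp_extendable T p (quotient_weight w2 w3 snd fst) (quotient_weight w1 w2 snd fst)
      (quotient_weight w1 w3 snd fst)" (is ?swapped)
proof -
  obtain \<rho> C where "bilinear_weights (quotient_weight w3 w2 fst snd) (quotient_weight w2 w1 fst snd)
      (quotient_weight w3 w1 fst snd) kernel_comp \<rho> C"
    using bilinear_weights_kernel_comp(1)[OF w] by blast
  then interpret bilinear_weights "quotient_weight w3 w2 fst snd" "quotient_weight w2 w1 fst snd"
      "quotient_weight w3 w1 fst snd" kernel_comp \<rho> C .
  show ?plain
    unfolding A.limits_eq_sup[OF p] B.limits_eq_sup[OF p] G.limits_eq_sup[OF p]
    by (intro conjI uniquely_extendable_kernel_comp T bicontinuous_proj_ind_ind_proj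
        bicontinuous_ind_proj_proj_ind bicontinuous_proj_ind_proj_ind
        A.truncation_space_proj_ind A.truncation_space_ind_proj B.truncation_space_proj_ind
        B.truncation_space_ind_proj G.truncation_space_proj_ind G.truncation_space_ind_proj)
next
  obtain \<rho> C where "bilinear_weights (quotient_weight w1 w2 snd fst) (quotient_weight w2 w3 snd fst)
      (quotient_weight w1 w3 snd fst) (\<lambda>y x. kernel_comp x y) \<rho> C"
    using bilinear_weights_kernel_comp(2)[OF w] by blast
  then interpret bilinear_weights "quotient_weight w1 w2 snd fst" "quotient_weight w2 w3 snd fst"
      "quotient_weight w1 w3 snd fst" "\<lambda>y x. kernel_comp x y" \<rho> C .
  show ?swapped
    unfolding A.limits_eq_sup[OF p] B.limits_eq_sup[OF p] G.limits_eq_sup[OF p]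
    by (intro conjI uniquely_extendable_kernel_comp T bicontinuous_swap[OF bicontinuous_proj_ind_ind_proj]
        bicontinuous_swap[OF bicontinuous_ind_proj_proj_ind] bicontinuous_swap[OF bicontinuous_proj_ind_proj_ind]
        A.truncation_space_proj_ind A.truncation_space_ind_proj B.truncation_space_proj_ind
        B.truncation_space_ind_proj G.truncation_space_proj_ind G.truncation_space_ind_proj)
qed

lemma quotient_weight_theta:
  "quotient_weight (\<lambda>r \<alpha>. theta r s2 \<alpha>) (\<lambda>r \<alpha>. theta r s1 \<alpha>) fst snd b a = omega (s2, s1) b a"
  "quotient_weight (\<lambda>r \<alpha>. theta r s1 \<alpha>) (\<lambda>r \<alpha>. theta r s2 \<alpha>) snd fst b a = omega_star (s2, s1) a b"
  by (auto simp: quotient_weight_def fun_eq_iff)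

lemma ennreal_inverse_inverse: "inverse (inverse x) = (x :: ennreal)"
  using one_divide_one_divide_ennreal[of x] by (simp add: divide_ennreal_def)

lemma quotient_weight_inverse_theta:
  "quotient_weight (\<lambda>r \<alpha>. inverse (theta r s1 \<alpha>)) (\<lambda>r \<alpha>. inverse (theta r s2 \<alpha>)) snd fst b a = omega (s2, s1) a b"
  "quotient_weight (\<lambda>r \<alpha>. inverse (theta r s2 \<alpha>)) (\<lambda>r \<alpha>. inverse (theta r s1 \<alpha>)) fst snd b a = omega_star (s2, s1) b a"
  by (auto simp: quotient_weight_def fun_eq_iff divide_ennreal_def ennreal_inverse_inverse mult.commute)

theorem theorem2p9:
  fixes p :: ennreal and s1 s2 s3 :: windex
    and T :: "('d3::finite, 'd2::finite) kernel \<times> ('d2, 'd1::finite) kernel \<Rightarrow> ('d3, 'd1) kernel"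
  assumes "0 < p"
    and "\<And>K2 K1. K2 \<in> A0_hat \<Longrightarrow> K1 \<in> A0_hat \<Longrightarrow> T (K2, K1) = kernel_comp K2 K1"
  shows
    "({s1, s2, s3} \<subseteq> R_flat_closed \<longrightarrow>
        uniquely_extendable T (A0_hat \<times> A0_hat)
          (B_hat p (s3, s2)) (C_hat p (s2, s1)) (C_hat p (s3, s1)) \<and>
        uniquely_extendable T (A0_hat \<times> A0_hat)
          (C_hat p (s3, s2)) (B_hat p (s2, s1)) (C_hat p (s3, s1)) \<and>
        uniquely_extendable T (A0_hat \<times> A0_hat)
          (B_hat p (s3, s2)) (B_hat p (s2, s1)) (B_hat p (s3, s1)) \<and>
        uniquely_extendable T (A0_hat \<times> A0_hat)
          (B_hat_star p (s3, s2)) (C_hat_star p (s2, s1)) (C_hat_star p (s3, s1)) \<and>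
        uniquely_extendable T (A0_hat \<times> A0_hat)
          (C_hat_star p (s3, s2)) (B_hat_star p (s2, s1)) (C_hat_star p (s3, s1)) \<and>
        uniquely_extendable T (A0_hat \<times> A0_hat)
          (B_hat_star p (s3, s2)) (B_hat_star p (s2, s1)) (B_hat_star p (s3, s1))) \<and>
     ({s1, s2, s3} \<subseteq> R_flat_infty \<longrightarrow>
        uniquely_extendable T (A0_hat \<times> A0_hat)
          (B0_hat p (s3, s2)) (C0_hat p (s2, s1)) (C0_hat p (s3, s1)) \<and>
        uniquely_extendable T (A0_hat \<times> A0_hat)
          (C0_hat p (s3, s2)) (B0_hat p (s2, s1)) (C0_hat p (s3, s1)) \<and>
        uniquely_extendable T (A0_hat \<times> A0_hat)
          (B0_hat p (s3, s2)) (B0_hat p (s2, s1)) (B0_hat p (s3, s1)) \<and>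
        uniquely_extendable T (A0_hat \<times> A0_hat)
          (B0_hat_star p (s3, s2)) (C0_hat_star p (s2, s1)) (C0_hat_star p (s3, s1)) \<and>
        uniquely_extendable T (A0_hat \<times> A0_hat)
          (C0_hat_star p (s3, s2)) (B0_hat_star p (s2, s1)) (C0_hat_star p (s3, s1)) \<and>
        uniquely_extendable T (A0_hat \<times> A0_hat)
          (B0_hat_star p (s3, s2)) (B0_hat_star p (s2, s1)) (B0_hat_star p (s3, s1)))"
    (is "(_ \<longrightarrow> ?closed) \<and> (_ \<longrightarrow> ?infty)")
proof (intro conjI[of "_ \<longrightarrow> _"] impI)
  assume "{s1, s2, s3} \<subseteq> R_flat_closed"
  then have w: "nuclear_family (\<lambda>r \<alpha> :: nat ^ 'd3. theta r s3 \<alpha>)" "nuclear_family (\<lambda>r \<alpha> :: nat ^ 'd2. theta r s2 \<alpha>)"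
    "nuclear_family (\<lambda>r \<alpha> :: nat ^ 'd1. theta r s1 \<alpha>)"
    using nuclear_family_theta by auto
  note plain = kernel_comp_extendable_quotient_weight(1)[where T = T, OF assms(1) w assms(2),
      unfolded proj_ind_def ind_proj_def quotient_weight_theta, folded B_hat_def C_hat_def]
  note star = kernel_comp_extendable_quotient_weight(2)[where T = T, OF assms(1) w assms(2),
      unfolded proj_ind_def ind_proj_def quotient_weight_theta, folded B_hat_star_def C_hat_star_def]
  show ?closed
    using plain star by simp
next
  assume "{s1, s2, s3} \<subseteq> R_flat_infty"
  then have w: "nuclear_family (\<lambda>r \<alpha> :: nat ^ 'd3. inverse (theta r s3 \<alpha>))"
    "nuclear_family (\<lambda>r \<alpha> :: nat ^ 'd2. inverse (theta r s2 \<alpha>))" "nuclear_family (\<lambda>r \<alpha> :: nat ^ 'd1. inverse (theta r s1 \<alpha>))"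
    using nuclear_family_inverse_theta by auto
  note plain = kernel_comp_extendable_quotient_weight(2)[where T = T, OF assms(1) w assms(2),
      unfolded proj_ind_def ind_proj_def quotient_weight_inverse_theta, folded B0_hat_def C0_hat_def]
  note star = kernel_comp_extendable_quotient_weight(1)[where T = T, OF assms(1) w assms(2),
      unfolded proj_ind_def ind_proj_def quotient_weight_inverse_theta, folded B0_hat_star_def C0_hat_star_def]
  show ?infty
    using plain star by simp
qed

end
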